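(* Let $S$ be a string of length $n$ over an alphabet $\Sigma$, let $k$ be a positive integer and let $a,b,c\in\{0,1,\dots,k-1\}$ be pairwise different. For every character $\sigma\in\Sigma$, the $(a,b,c)$-partial-$k$-cadences of $S$ with character $\sigma$ can be counted in $\mathcal{O}(n(\log n)^2)$ time. Also, if all $n_\sigma$ occurrences of $\sigma$ in $S$ are known, the $(a,b,c)$-partial-$k$-cadences with $\sigma$ can be counted in $\mathcal{O}(n_\sigma^2)$ time.
   Context: A string $S=S[1]S[2]\cdots S[n]$ is a sequence of characters from $\Sigma$. For pairwise different integers $a,b,c\in\{0,\dots,k-1\}$, an $(a,b,c)$-partial-$k$-cadence of $S$ is a triple $(i,d,k)$ with positive integers $i,d$ such that $i-d\le 0$, $i+(k-1)d\le n<i+kd$ and $S[i+ad]=S[i+bd]=S[i+cd]$. It is a partial-cadence with character $\sigma$ if this common character is $\sigma$. Computational model: arithmetic operations on integers with $\mathcal{O}(\log n)$ bits take constant time; each character $S[j]$ can be read in constant time; characters are sufficiently small integers. The standard fact that the acyclic convolution of two sequences of length $m$ can be computed in $\mathcal{O}(m\log m)$ operations is assumed. Constants in $\mathcal{O}$ are absolute. *)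

theory Defs
  imports Complex_Main "HOL-Library.Landau_Symbols"
begin

section \<open>Partial cadences\<close>

text \<open>
  Strings are lists of integer characters; the character \<open>S[j]\<close> with the usual 1-based
  indexing is \<open>S ! (j - 1)\<close>.
\<close>

definition char_at :: "int list \<Rightarrow> nat \<Rightarrow> int" where
  "char_at S j = S ! (j - 1)"

text \<open>
  Over the natural numbers \<open>i - d \<le> 0\<close> has to be written \<open>i \<le> d\<close>.  For \<open>a, b, c < k\<close> the
  three positions below lie in \<open>{1..length S}\<close>.
\<close>

definition partial_cadence ::
    "nat \<Rightarrow> nat \<Rightarrow> nat \<Rightarrow> int list \<Rightarrow> nat \<times> nat \<times> nat \<Rightarrow> bool" where
  "partial_cadence a b c S = (\<lambda>(i, d, k).
     0 < i \<and> 0 < d \<and> i \<le> d \<and>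
     i + (k - 1) * d \<le> length S \<and> length S < i + k * d \<and>
     char_at S (i + a * d) = char_at S (i + b * d) \<and>
     char_at S (i + b * d) = char_at S (i + c * d))"

definition partial_cadences_with ::
    "nat \<Rightarrow> nat \<Rightarrow> nat \<Rightarrow> nat \<Rightarrow> int list \<Rightarrow> int \<Rightarrow> (nat \<times> nat \<times> nat) set" where
  "partial_cadences_with k a b c S \<sigma> =
     {(i, d, k') | i d k'. k' = k \<and> partial_cadence a b c S (i, d, k') \<and>
        char_at S (i + a * d) = \<sigma>}"

definition occurrences :: "int list \<Rightarrow> int \<Rightarrow> nat set" where
  "occurrences S \<sigma> = {j. 1 \<le> j \<and> j \<le> length S \<and> char_at S j = \<sigma>}"

section \<open>A unit-cost word machine\<close>

text \<open>
  A while language over integer variables and integer arrays.  The parameter \<open>W\<close> is the word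
  limit: a program whose computation touches a value of absolute value greater than \<open>W\<close>,
  indexes an array with a negative number, or divides by zero, gets stuck.  All operations on
  words cost one unit.
\<close>

type_synonym vname = string

datatype arith_op = Add | Sub | Mul | Div | Mod | Lt | Eq

datatype aexp = Const int | Var vname | Read vname aexp | Bin arith_op aexp aexp

datatype com =
    Skip
  | Assign vname aexp
  | Store vname aexp aexp
  | Seq com com
  | If aexp com com
  | While aexp com

record state =
  var :: "vname \<Rightarrow> int"
  arr :: "vname \<Rightarrow> nat \<Rightarrow> int"

definition word :: "int \<Rightarrow> int \<Rightarrow> int option" where
  "word W v = (if \<bar>v\<bar> \<le> W then Some v else None)"

fun op_val :: "arith_op \<Rightarrow> int \<Rightarrow> int \<Rightarrow> int option" where
  "op_val Add u v = Some (u + v)"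
| "op_val Sub u v = Some (u - v)"
| "op_val Mul u v = Some (u * v)"
| "op_val Div u v = (if v = 0 then None else Some (u div v))"
| "op_val Mod u v = (if v = 0 then None else Some (u mod v))"
| "op_val Lt u v = Some (if u < v then 1 else 0)"
| "op_val Eq u v = Some (if u = v then 1 else 0)"

fun aval :: "int \<Rightarrow> state \<Rightarrow> aexp \<Rightarrow> int option" where
  "aval W s (Const v) = word W v"
| "aval W s (Var x) = word W (var s x)"
| "aval W s (Read x e) =
     Option.bind (aval W s e) (\<lambda>i. if 0 \<le> i then word W (arr s x (nat i)) else None)"
| "aval W s (Bin f e1 e2) =
     Option.bind (aval W s e1) (\<lambda>u. Option.bind (aval W s e2) (\<lambda>v.
       Option.bind (op_val f u v) (word W)))"

fun cost :: "aexp \<Rightarrow> nat" where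
  "cost (Const v) = 1"
| "cost (Var x) = 1"
| "cost (Read x e) = 1 + cost e"
| "cost (Bin f e1 e2) = 1 + cost e1 + cost e2"

text \<open>
  \<open>exec W P s t s'\<close>: with word limit \<open>W\<close>, program \<open>P\<close> started in \<open>s\<close> halts in \<open>s'\<close>,
  without getting stuck, after exactly \<open>t\<close> units of time.
\<close>

inductive exec :: "int \<Rightarrow> com \<Rightarrow> state \<Rightarrow> nat \<Rightarrow> state \<Rightarrow> bool" for W :: int where
  Skip: "exec W Skip s 1 s"
| Assign: "aval W s e = Some v \<Longrightarrow>
    exec W (Assign x e) s (1 + cost e) (s\<lparr>var := (var s)(x := v)\<rparr>)"
| Store: "aval W s e1 = Some i \<Longrightarrow> 0 \<le> i \<Longrightarrow> aval W s e2 = Some v \<Longrightarrow>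
    exec W (Store x e1 e2) s (1 + cost e1 + cost e2)
      (s\<lparr>arr := (arr s)(x := (arr s x)(nat i := v))\<rparr>)"
| Seq: "exec W P s t s' \<Longrightarrow> exec W Q s' t' s'' \<Longrightarrow> exec W (Seq P Q) s (t + t') s''"
| IfTrue: "aval W s e = Some v \<Longrightarrow> v \<noteq> 0 \<Longrightarrow> exec W P s t s' \<Longrightarrow>
    exec W (If e P Q) s (1 + cost e + t) s'"
| IfFalse: "aval W s e = Some v \<Longrightarrow> v = 0 \<Longrightarrow> exec W Q s t s' \<Longrightarrow>
    exec W (If e P Q) s (1 + cost e + t) s'"
| WhileFalse: "aval W s e = Some v \<Longrightarrow> v = 0 \<Longrightarrow> exec W (While e P) s (1 + cost e) s"
| WhileTrue: "aval W s e = Some v \<Longrightarrow> v \<noteq> 0 \<Longrightarrow> exec W P s t s' \<Longrightarrow>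
    exec W (While e P) s' t' s'' \<Longrightarrow> exec W (While e P) s (1 + cost e + t + t') s''"

text \<open>Executions are deterministic, so an existing execution determines cost and result.\<close>

inductive_cases exec_elims:
  "exec W Skip s t s'"
  "exec W (Assign x e) s t s'"
  "exec W (Store x e1 e2) s t s'"
  "exec W (Seq P Q) s t s'"
  "exec W (If e P Q) s t s'"
  "exec W (While e P) s t s'"

lemma exec_deterministic:
  "exec W P s t s' \<Longrightarrow> exec W P s u s'' \<Longrightarrow> u = t \<and> s'' = s'"
proof (induction arbitrary: u s'' rule: exec.induct)
  case (Skip s)
  then show ?case by (elim exec_elims(1)) simp
next
  case (Assign s e v x)
  then show ?case by (elim exec_elims(2)) simp
next
  case (Store s e1 i e2 v x)
  then show ?case by (elim exec_elims(3)) simp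
next
  case (Seq P s t s' Q t' r)
  from Seq.prems show ?case
    by (rule exec_elims(4)) (metis Seq.IH)
next
  case (IfTrue s e v P t s' Q)
  from IfTrue.prems show ?case
    by (rule exec_elims(5)) (use IfTrue.hyps(1,2) IfTrue.IH in force)+
next
  case (IfFalse s e v Q t s' P)
  from IfFalse.prems show ?case
    by (rule exec_elims(5)) (use IfFalse.hyps(1,2) IfFalse.IH in force)+
next
  case (WhileFalse s e v P)
  from WhileFalse.prems show ?case
    by (rule exec_elims(6)) (use WhileFalse.hyps in auto)
next
  case (WhileTrue s e v P t s' t' r)
  from WhileTrue.prems show ?case
    by (rule exec_elims(6)) (use WhileTrue.hyps(1,2) WhileTrue.IH in force)+
qed

definition holds_array :: "state \<Rightarrow> vname \<Rightarrow> int list \<Rightarrow> bool" where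
  "holds_array s x xs \<longleftrightarrow> (\<forall>j < length xs. arr s x j = xs ! j)"

section \<open>The convolution fact\<close>

definition acyclic_conv :: "int list \<Rightarrow> int list \<Rightarrow> nat \<Rightarrow> int" where
  "acyclic_conv x y j =
     (\<Sum>(p, q) \<in> {(p, q). p < length x \<and> q < length y \<and> p + q = j}. x ! p * y ! q)"

text \<open>
  For sequences of length \<open>m\<close> whose entries have \<open>O(log m)\<close> bits, there is a program that
  computes the acyclic convolution in \<open>O(m log m)\<close> time on words of \<open>O(log m)\<close> bits.  Memory
  other than the inputs may initially contain anything.
\<close>

definition fast_convolution :: bool where
  "fast_convolution \<longleftrightarrow>
     (\<forall>e :: nat. \<exists>(P :: com) (q :: nat) (T :: nat \<Rightarrow> real).
        T \<in> O(\<lambda>m. real m * ln (real m)) \<and>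
        (\<forall>W m x y s.
           length x = m \<and> length y = m \<and>
           (\<forall>v \<in> set x \<union> set y. \<bar>v\<bar> \<le> (int m + 2) ^ e) \<and>
           (int m + 2) ^ q \<le> W \<and>
           var s ''m'' = int m \<and> holds_array s ''x'' x \<and> holds_array s ''y'' y \<longrightarrow>
           (\<exists>t s'. exec W P s t s' \<and> real t \<le> T m \<and>
              (\<forall>j < 2 * m - 1. arr s' ''z'' j = acyclic_conv x y j))))"

section \<open>Problem instances in memory\<close>

text \<open>
  The alphabet \<open>\<Sigma>\<close> is a set of integers that fit into a word; so does \<open>k\<close>.  Cell \<open>j - 1\<close> of
  the array \<open>S\<close> contains \<open>S[j]\<close>.  Memory other than the inputs is arbitrary.
\<close>

definition instance_in_memory ::
    "int \<Rightarrow> int set \<Rightarrow> int list \<Rightarrow> nat \<Rightarrow> nat \<Rightarrow> nat \<Rightarrow> nat \<Rightarrow> int \<Rightarrow> state \<Rightarrow> bool" where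
  "instance_in_memory W \<Sigma> S k a b c \<sigma> s \<longleftrightarrow>
     (\<forall>x \<in> \<Sigma>. \<bar>x\<bar> \<le> W) \<and> int k \<le> W \<and>
     holds_array s ''S'' S \<and>
     var s ''n'' = int (length S) \<and> var s ''k'' = int k \<and>
     var s ''a'' = int a \<and> var s ''b'' = int b \<and> var s ''c'' = int c \<and>
     var s ''sigma'' = \<sigma>"

definition occurrences_in_memory :: "int list \<Rightarrow> int \<Rightarrow> nat list \<Rightarrow> state \<Rightarrow> bool" where
  "occurrences_in_memory S \<sigma> occ s \<longleftrightarrow>
     distinct occ \<and> set occ = occurrences S \<sigma> \<and>
     holds_array s ''occ'' (map int occ) \<and> var s ''n_sigma'' = int (length occ)"

end

theory Submission
  imports Defs
begin

text \<open>
  With the occurrences at hand, the outer two positions \<open>x = i + a d\<close>, \<open>z = i + c d\<close> determine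
  \<open>i\<close> and \<open>d\<close>, so it suffices to run over all pairs of occurrences and to look up the third
  character.

  For the quasilinear bound sort \<open>a < b < c\<close>.  If \<open>n < k\<^sup>2\<close>, at most four values of \<open>d\<close> are possible
  and brute force takes linear time.  Otherwise, for every residue of the positions modulo \<open>c - a\<close>,
  the candidates are the lattice points of a quadrilateral in the \<open>(x, z)\<close>-plane, and the middle
  position is an affine function of \<open>x\<close> and \<open>z\<close>.  A quadtree splits a square around the
  quadrilateral; on a cell inside the quadrilateral the hits are counted by one acyclic convolution
  of length proportional to \<open>c - a\<close> times the cell width.  Each of the four sides crosses at most one
  cell of every antidiagonal, hence only linearly many cells per level are split, every level
  costs \<open>O(n log n)\<close> over all residues, and there are \<open>O(log n)\<close> levels.
\<close>

section \<open>Timed execution\<close>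

text \<open>A convolution sums products over a full rectangle of index pairs, but the side
  conditions couple \<open>i\<close> and \<open>d\<close>; hence the subdivision into squares on
  which all conditions hold. Fixing the residue pays twice: every lattice point is then a candidate,
  and all positions move with fixed strides, \<open>c - a\<close> for the outer ones,
  \<open>c - b\<close> and \<open>b - a\<close> for the middle one. So a cell of width
  \<open>w\<close> costs a convolution of length about \<open>(c - a) * w\<close>, wherever it lies.
  The threshold \<open>k * k\<close> comes from summing over the residues. The square has width of
  order at most \<open>n / k\<close> divided by \<open>c - a\<close>, so one level costs
  \<open>(c - a) * n / k\<close> up to the logarithm, which is linear in \<open>n\<close>. Rounding
  in the range of \<open>d\<close> adds a multiple of \<open>k * k\<close>, which only a long string
  absorbs. Word size is a separate obstacle. An instance only promises that \<open>k\<close> and the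
  characters fit into a word, so products with \<open>k\<close> are formed only after the test
  \<open>k <= n\<close>, and characters are compared but never computed with.\<close>

definition setv :: "state \<Rightarrow> vname \<Rightarrow> int \<Rightarrow> state" where
  "setv s x v = s\<lparr>var := (var s)(x := v)\<rparr>"

definition seta :: "state \<Rightarrow> vname \<Rightarrow> nat \<Rightarrow> int \<Rightarrow> state" where
  "seta s x i v = s\<lparr>arr := (arr s)(x := (arr s x)(i := v))\<rparr>"

lemma set_simps [simp]:
  "var (setv s x v) y = (if y = x then v else var s y)"
  "arr (setv s x v) = arr s"
  "var (seta s x i v) = var s"
  "arr (seta s x i v) y j = (if y = x \<and> j = i then v else arr s y j)"
  by (auto simp: setv_def seta_def)

text \<open>Total correctness within a time budget. The budget is real: it can be split by
  subtraction without truncation, an overdrawn budget makes the statement false, and logarithms may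
  occur in it.\<close>

definition runs :: "int \<Rightarrow> com \<Rightarrow> state \<Rightarrow> real \<Rightarrow> (state \<Rightarrow> bool) \<Rightarrow> bool" where
  "runs W P s \<beta> Q \<longleftrightarrow> (\<exists>t s'. exec W P s t s' \<and> real t \<le> \<beta> \<and> Q s')"

lemma runs_mono:
  assumes "runs W P s \<beta>' Q'" "\<beta>' \<le> \<beta>" "\<And>s'. Q' s' \<Longrightarrow> Q s'"
  shows "runs W P s \<beta> Q"
  using assms unfolding runs_def by (meson order_trans)

lemma runs_seq:
  assumes "runs W P s \<beta>\<^sub>1 (\<lambda>s'. runs W Q s' (\<beta> - \<beta>\<^sub>1) R)"
  shows "runs W (Seq P Q) s \<beta> R"
proof -
  obtain t s' t' s'' where "exec W P s t s'" "real t \<le> \<beta>\<^sub>1"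
    "exec W Q s' t' s''" "real t' \<le> \<beta> - \<beta>\<^sub>1" "R s''"
    using assms unfolding runs_def by blast
  moreover from this have "real (t + t') \<le> \<beta>" by simp
  ultimately show ?thesis unfolding runs_def using exec.Seq by blast
qed

text \<open>The form used at procedure calls: a proved specification supplies both the share of the
  budget and all that is known about the intermediate state.\<close>

lemma runs_call:
  assumes "runs W P s \<beta>' Q'" "\<And>s'. Q' s' \<Longrightarrow> runs W Q s' (\<beta> - \<beta>') R"
  shows "runs W (Seq P Q) s \<beta> R"
  by (rule runs_seq, rule runs_mono[OF assms(1)]) (use assms(2) in auto)

lemma runs_seq_assoc: "runs W (Seq P (Seq Q R)) s \<beta> S \<Longrightarrow> runs W (Seq (Seq P Q) R) s \<beta> S"
  unfolding runs_def
  by (elim exE conjE exec_elims(4)) (auto simp: add.assoc intro!: exI intro: exec.Seq)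

lemma runs_skip_seq:
  assumes "runs W P s (\<beta> - 1) Q"
  shows "runs W (Seq Skip P) s \<beta> Q"
proof -
  obtain t s' where "exec W P s t s'" "real t \<le> \<beta> - 1" "Q s'"
    using assms unfolding runs_def by blast
  moreover from this have "real (1 + t) \<le> \<beta>" by simp
  ultimately show ?thesis unfolding runs_def using exec.Seq exec.Skip by blast
qed

lemma runs_skip: "1 \<le> \<beta> \<Longrightarrow> Q s \<Longrightarrow> runs W Skip s \<beta> Q"
  unfolding runs_def using exec.Skip by fastforce

lemma runs_assign':
  "aval W s e = Some v \<Longrightarrow> real (1 + cost e) \<le> \<beta> \<Longrightarrow> Q (setv s x v) \<Longrightarrow> runs W (Assign x e) s \<beta> Q"
  unfolding runs_def setv_def using exec.Assign by blast

lemma runs_store':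
  "aval W s e1 = Some i \<Longrightarrow> 0 \<le> i \<Longrightarrow> aval W s e2 = Some v \<Longrightarrow>
    real (1 + cost e1 + cost e2) \<le> \<beta> \<Longrightarrow> Q (seta s x (nat i) v) \<Longrightarrow> runs W (Store x e1 e2) s \<beta> Q"
  unfolding runs_def seta_def using exec.Store by blast

lemma runs_if':
  assumes "aval W s e = Some v"
    and "v \<noteq> 0 \<Longrightarrow> runs W P s (\<beta> - real (1 + cost e)) R"
    and "v = 0 \<Longrightarrow> runs W Q s (\<beta> - real (1 + cost e)) R"
  shows "runs W (If e P Q) s \<beta> R"
proof (cases "v = 0")
  case True
  then obtain t s' where "exec W Q s t s'" "real t \<le> \<beta> - real (1 + cost e)" "R s'"
    using assms(3) unfolding runs_def by blast
  moreover from this have "real (1 + cost e + t) \<le> \<beta>" by simp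
  ultimately show ?thesis unfolding runs_def using exec.IfFalse[OF assms(1) True] by blast
next
  case False
  then obtain t s' where "exec W P s t s'" "real t \<le> \<beta> - real (1 + cost e)" "R s'"
    using assms(2) unfolding runs_def by blast
  moreover from this have "real (1 + cost e + t) \<le> \<beta>" by simp
  ultimately show ?thesis unfolding runs_def using exec.IfTrue[OF assms(1) False] by blast
qed

text \<open>The continuation is copied into both branches, so symbolic execution needs no assertion
  for the point where the branches meet.\<close>

lemma runs_if_seq':
  assumes "aval W s e = Some v"
    and "v \<noteq> 0 \<Longrightarrow> runs W (Seq P R) s (\<beta> - real (1 + cost e)) S"
    and "v = 0 \<Longrightarrow> runs W (Seq Q R) s (\<beta> - real (1 + cost e)) S"
  shows "runs W (Seq (If e P Q) R) s \<beta> S"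
proof (cases "v = 0")
  case True
  then obtain t s' u s'' where "exec W Q s t s'" "exec W R s' u s''"
    "real (t + u) \<le> \<beta> - real (1 + cost e)" "S s''"
    using assms(3) unfolding runs_def by (auto elim!: exec_elims(4))
  moreover from this have "real (1 + cost e + t + u) \<le> \<beta>" by simp
  ultimately show ?thesis
    unfolding runs_def using exec.Seq[OF exec.IfFalse[OF assms(1) True]] by blast
next
  case False
  then obtain t s' u s'' where "exec W P s t s'" "exec W R s' u s''"
    "real (t + u) \<le> \<beta> - real (1 + cost e)" "S s''"
    using assms(2) unfolding runs_def by (auto elim!: exec_elims(4))
  moreover from this have "real (1 + cost e + t + u) \<le> \<beta>" by simp
  ultimately show ?thesis
    unfolding runs_def using exec.Seq[OF exec.IfTrue[OF assms(1) False]] by blast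
qed

text \<open>The potential \<open>\<Phi>\<close> pays for the iterations, so it also proves termination.\<close>

lemma runs_while':
  fixes I :: "'g \<Rightarrow> state \<Rightarrow> bool"
  assumes "I g s"
    and bnd: "\<And>g s. I g s \<Longrightarrow> aval W s e = Some (b s)"
    and step: "\<And>g s. I g s \<Longrightarrow> b s \<noteq> 0 \<Longrightarrow>
      runs W P s (\<tau> g) (\<lambda>s'. \<exists>g'. I g' s' \<and> \<tau> g + real (1 + cost e) + \<Phi> g' \<le> \<Phi> g)"
    and pot: "\<And>g s. I g s \<Longrightarrow> real (1 + cost e) \<le> \<Phi> g"
    and "\<Phi> g \<le> \<beta>"
    and final: "\<And>g s. I g s \<Longrightarrow> b s = 0 \<Longrightarrow> Q s"
  shows "runs W (While e P) s \<beta> Q"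
proof -
  have "runs W (While e P) s (\<Phi> g) Q"
    using assms(1)
  proof (induction "nat \<lceil>\<Phi> g\<rceil>" arbitrary: g s rule: less_induct)
    case less
    show ?case
    proof (cases "b s = 0")
      case True
      then show ?thesis
        using bnd[OF less.prems] pot[OF less.prems] final[OF less.prems] exec.WhileFalse
        unfolding runs_def by blast
    next
      case False
      then obtain t s' g' where t: "exec W P s t s'" "I g' s'"
        and le: "real t + real (1 + cost e) + \<Phi> g' \<le> \<Phi> g"
        using step[OF less.prems] unfolding runs_def by fastforce
      \<comment> \<open>The potential drops by at least 1 and \<open>pot\<close> keeps it positive,
        so the decrease stays strict after rounding to a natural number.\<close>
      have "nat \<lceil>\<Phi> g'\<rceil> < nat \<lceil>\<Phi> g\<rceil>" using le pot[OF less.prems] by linarith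
      from less.hyps[OF this t(2)] obtain t' s'' where
        "exec W (While e P) s' t' s''" "real t' \<le> \<Phi> g'" "Q s''"
        unfolding runs_def by blast
      moreover from this have "real (1 + cost e + t + t') \<le> \<Phi> g" using le by simp
      ultimately show ?thesis
        unfolding runs_def using exec.WhileTrue[OF bnd[OF less.prems] False t(1)] by blast
    qed
  qed
  then show ?thesis using runs_mono assms(5) by blast
qed

section \<open>Expression values under a word limit\<close>

fun ev :: "state \<Rightarrow> aexp \<Rightarrow> int" where
  "ev s (Const v) = v"
| "ev s (Var x) = var s x"
| "ev s (Read x e) = arr s x (nat (ev s e))"
| "ev s (Bin Add e1 e2) = ev s e1 + ev s e2"
| "ev s (Bin Sub e1 e2) = ev s e1 - ev s e2"
| "ev s (Bin Mul e1 e2) = ev s e1 * ev s e2"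
| "ev s (Bin Div e1 e2) = ev s e1 div ev s e2"
| "ev s (Bin Mod e1 e2) = ev s e1 mod ev s e2"
| "ev s (Bin Lt e1 e2) = of_bool (ev s e1 < ev s e2)"
| "ev s (Bin Eq e1 e2) = of_bool (ev s e1 = ev s e2)"

text \<open>The exponent of a size estimate: if all inputs are at most \<open>B\<close>, operations
  at worst multiply bounds. A read yields a stored value of at most \<open>B\<close>, but its index
  must fit into a word too, so the leaves of the index are counted.\<close>

fun leaves :: "aexp \<Rightarrow> nat" where
  "leaves (Const v) = 1"
| "leaves (Var x) = 1"
| "leaves (Read x e) = leaves e"
| "leaves (Bin f e1 e2) = leaves e1 + leaves e2"

fun bounded :: "int \<Rightarrow> state \<Rightarrow> aexp \<Rightarrow> bool" where
  "bounded B s (Const v) \<longleftrightarrow> \<bar>v\<bar> \<le> B"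
| "bounded B s (Var x) \<longleftrightarrow> \<bar>var s x\<bar> \<le> B"
| "bounded B s (Read x e) \<longleftrightarrow> bounded B s e \<and> 0 \<le> ev s e \<and> \<bar>arr s x (nat (ev s e))\<bar> \<le> B"
| "bounded B s (Bin f e1 e2) \<longleftrightarrow> bounded B s e1 \<and> bounded B s e2 \<and>
     (f = Div \<or> f = Mod \<longrightarrow> ev s e2 \<noteq> 0)"

lemma leaves_pos: "0 < leaves e"
  by (induction e) auto

lemma abs_div_le: "\<bar>u div v\<bar> \<le> \<bar>u\<bar>" for u v :: int
proof -
  have pos: "\<bar>x div y\<bar> \<le> \<bar>x\<bar>" if "0 < y" for x y :: int
  proof (cases "0 \<le> x")
    case True
    then show ?thesis using that zdiv_mono2[of x 1 y] pos_imp_zdiv_nonneg_iff[of y x] by simp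
  next
    case False
    then show ?thesis
      using that zdiv_mono2_neg[of x 1 y] pos_imp_zdiv_nonneg_iff[of y x] by simp
  qed
  show ?thesis
    using pos[of v u] pos[of "- v" "- u"] by (cases v "0 :: int" rule: linorder_cases) auto
qed

text \<open>For bounds of at least 2 the product also dominates the sum, because
  \<open>(A - 1) * (C - 1) >= 1\<close>; so one multiplicative bound serves all operations.\<close>

lemma abs_op_val_le:
  assumes "op_val f u v = Some r" "\<bar>u\<bar> \<le> A" "\<bar>v\<bar> \<le> C" "2 \<le> A" "2 \<le> C"
  shows "\<bar>r\<bar> \<le> A * C"
proof -
  have le: "A \<le> A * C" "C \<le> A * C" "A + C \<le> A * C"
  proof -
    show "A \<le> A * C" "C \<le> A * C"
      using assms(4,5) mult_left_mono[of 1 C A] mult_right_mono[of 1 A C] by simp_all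
    have "1 * 1 \<le> (A - 1) * (C - 1)" using assms(4,5) by (intro mult_mono) auto
    then show "A + C \<le> A * C" by (simp add: algebra_simps)
  qed
  have "\<bar>u * v\<bar> \<le> A * C" using assms(2-5) by (simp add: abs_mult mult_mono)
  moreover have "\<bar>u div v\<bar> \<le> A * C" using abs_div_le[of u v] assms(2) le(1) by linarith
  moreover have "v \<noteq> 0 \<Longrightarrow> \<bar>u mod v\<bar> \<le> A * C" using abs_mod_less[of v u] assms(3) le(2) by linarith
  moreover have "\<bar>u + v\<bar> \<le> A * C" "\<bar>u - v\<bar> \<le> A * C" using assms(2,3) le(3) by linarith+
  moreover have "1 \<le> A * C" using assms(4) le(1) by linarith
  moreover note assms(1)[symmetric]
  ultimately show ?thesis by (cases f) (simp_all split: if_splits)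
qed

lemma aval_bounded:
  assumes "bounded B s e" "2 \<le> B" "B ^ leaves e \<le> W"
  shows "aval W s e = Some (ev s e) \<and> \<bar>ev s e\<bar> \<le> B ^ leaves e"
  using assms
proof (induction e)
  case (Read x e)
  then have "B ^ 1 \<le> B ^ leaves e"
    using leaves_pos[of e] by (intro power_increasing) auto
  with Read show ?case by (auto simp: word_def)
next
  case (Bin f e1 e2)
  let ?a = "B ^ leaves e1" and ?b = "B ^ leaves e2"
  have ge: "2 \<le> ?a" "2 \<le> ?b"
    using \<open>2 \<le> B\<close> leaves_pos[of e1] leaves_pos[of e2] self_le_power[of B "leaves e1"]
      self_le_power[of B "leaves e2"] by linarith+
  have le: "?a \<le> ?a * ?b" "?b \<le> ?a * ?b"
    using ge mult_left_mono[of 1 ?b ?a] mult_right_mono[of 1 ?a ?b] by simp_all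
  have W: "?a * ?b \<le> W" using Bin.prems(3) by (simp add: power_add)
  obtain u v where uv: "aval W s e1 = Some u" "\<bar>u\<bar> \<le> ?a" "aval W s e2 = Some v" "\<bar>v\<bar> \<le> ?b"
      "ev s e1 = u" "ev s e2 = v"
    using Bin le W by auto
  have "op_val f u v = Some (ev s (Bin f e1 e2))"
    using uv(5,6) Bin.prems(1) by (cases f) auto
  moreover from this have "\<bar>ev s (Bin f e1 e2)\<bar> \<le> ?a * ?b"
    using abs_op_val_le[OF _ uv(2,4) ge] by blast
  ultimately show ?case using uv W by (simp add: word_def power_add)
qed (auto simp: word_def)

text \<open>Stored values are meant to stay below \<open>B\<close>; the power 32 is room for the
  intermediate results of a single expression with at most 32 leaves.\<close>

locale word_bound =
  fixes W B :: int
  assumes B_ge: "2 \<le> B" and B_pow: "B ^ 32 \<le> W"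
begin

lemma aval_ev:
  assumes "bounded B s e" "leaves e \<le> 32"
  shows "aval W s e = Some (ev s e)"
proof -
  have "B ^ leaves e \<le> B ^ 32" using B_ge by (intro power_increasing assms) auto
  then show ?thesis using aval_bounded[OF assms(1) B_ge order_trans[OF _ B_pow]] by simp
qed

lemma runs_assign:
  "bounded B s e \<Longrightarrow> leaves e \<le> 32 \<Longrightarrow> real (1 + cost e) \<le> \<beta> \<Longrightarrow>
    Q (setv s x (ev s e)) \<Longrightarrow> runs W (Assign x e) s \<beta> Q"
  by (rule runs_assign'[OF aval_ev])

lemma runs_assign_seq:
  "bounded B s e \<Longrightarrow> leaves e \<le> 32 \<Longrightarrow>
    runs W P (setv s x (ev s e)) (\<beta> - real (1 + cost e)) Q \<Longrightarrow>
    runs W (Seq (Assign x e) P) s \<beta> Q"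
  by (rule runs_seq, rule runs_assign) auto

lemma runs_store:
  assumes "bounded B s e1" "leaves e1 \<le> 32" "bounded B s e2" "leaves e2 \<le> 32" "0 \<le> ev s e1"
    "real (1 + cost e1 + cost e2) \<le> \<beta>" "Q (seta s x (nat (ev s e1)) (ev s e2))"
  shows "runs W (Store x e1 e2) s \<beta> Q"
  using runs_store'[of W s e1 "ev s e1" e2 "ev s e2" \<beta> Q x] aval_ev assms by blast

lemma runs_store_seq:
  "bounded B s e1 \<Longrightarrow> leaves e1 \<le> 32 \<Longrightarrow> bounded B s e2 \<Longrightarrow> leaves e2 \<le> 32 \<Longrightarrow> 0 \<le> ev s e1 \<Longrightarrow>
    runs W P (seta s x (nat (ev s e1)) (ev s e2)) (\<beta> - real (1 + cost e1 + cost e2)) Q \<Longrightarrow>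
    runs W (Seq (Store x e1 e2) P) s \<beta> Q"
  by (rule runs_seq, rule runs_store) auto

lemma runs_if:
  "bounded B s e \<Longrightarrow> leaves e \<le> 32 \<Longrightarrow>
    (ev s e \<noteq> 0 \<Longrightarrow> runs W P s (\<beta> - real (1 + cost e)) R) \<Longrightarrow>
    (ev s e = 0 \<Longrightarrow> runs W Q s (\<beta> - real (1 + cost e)) R) \<Longrightarrow>
    runs W (If e P Q) s \<beta> R"
  by (rule runs_if'[OF aval_ev])

lemma runs_if_seq:
  "bounded B s e \<Longrightarrow> leaves e \<le> 32 \<Longrightarrow>
    (ev s e \<noteq> 0 \<Longrightarrow> runs W (Seq P R) s (\<beta> - real (1 + cost e)) S) \<Longrightarrow>
    (ev s e = 0 \<Longrightarrow> runs W (Seq Q R) s (\<beta> - real (1 + cost e)) S) \<Longrightarrow>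
    runs W (Seq (If e P Q) R) s \<beta> S"
  by (rule runs_if_seq'[OF aval_ev])

lemmas straight_line =
  runs_assign_seq runs_store_seq runs_assign runs_store runs_skip_seq runs_seq_assoc runs_skip

text \<open>Characters may be as large as \<open>W\<close>, so a comparison with one falls outside
  \<open>bounded\<close>. Comparing creates no large value, hence \<open>W\<close> suffices as a
  bound on both sides.\<close>

lemma runs_if_read_seq:
  assumes "bounded B s e" "leaves e \<le> 32" "0 \<le> ev s e" "\<bar>arr s x (nat (ev s e))\<bar> \<le> W" "\<bar>var s y\<bar> \<le> W"
    and "arr s x (nat (ev s e)) = var s y \<Longrightarrow> runs W (Seq P R) s (\<beta> - real (4 + cost e)) S"
    and "arr s x (nat (ev s e)) \<noteq> var s y \<Longrightarrow> runs W (Seq Q R) s (\<beta> - real (4 + cost e)) S"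
  shows "runs W (Seq (If (Bin Eq (Read x e) (Var y)) P Q) R) s \<beta> S"
proof (rule runs_if_seq')
  have "1 \<le> W" using self_le_power[of B 32] B_ge B_pow by linarith
  then show "aval W s (Bin Eq (Read x e) (Var y)) = Some (if arr s x (nat (ev s e)) = var s y then 1 else 0)"
    using aval_ev[OF assms(1,2)] assms(3-5) by (simp add: word_def)
qed (use assms(6,7) in \<open>simp_all split: if_split_asm\<close>)

lemma runs_while:
  fixes I :: "'g \<Rightarrow> state \<Rightarrow> bool"
  assumes "I g s"
    and "\<And>g s. I g s \<Longrightarrow> bounded B s e" "leaves e \<le> 32"
    and "\<And>g s. I g s \<Longrightarrow> ev s e \<noteq> 0 \<Longrightarrow>
      runs W P s (\<tau> g) (\<lambda>s'. \<exists>g'. I g' s' \<and> \<tau> g + real (1 + cost e) + \<Phi> g' \<le> \<Phi> g)"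
    and "\<And>g s. I g s \<Longrightarrow> real (1 + cost e) \<le> \<Phi> g"
    and "\<Phi> g \<le> \<beta>"
    and "\<And>g s. I g s \<Longrightarrow> ev s e = 0 \<Longrightarrow> Q s"
  shows "runs W (While e P) s \<beta> Q"
  using assms
  by (intro runs_while'[where b = "\<lambda>s. ev s e" and I = I and \<tau> = \<tau> and \<Phi> = \<Phi>] aval_ev)

text \<open>A counted loop: the potential is linear in the number of remaining rounds, and the extra
  summand pays for the last, failing test.\<close>

lemma runs_for:
  fixes I :: "nat \<Rightarrow> state \<Rightarrow> bool"
  assumes "I 0 s"
    and "\<And>j s. j \<le> N \<Longrightarrow> I j s \<Longrightarrow> bounded B s e \<and> (ev s e \<noteq> 0 \<longleftrightarrow> j < N)" "leaves e \<le> 32"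
    and "\<And>j s. j < N \<Longrightarrow> I j s \<Longrightarrow> runs W P s \<tau> (I (Suc j))"
    and "real N * (\<tau> + real (1 + cost e)) + real (1 + cost e) \<le> \<beta>" "0 \<le> \<tau>"
    and "\<And>s. I N s \<Longrightarrow> Q s"
  shows "runs W (While e P) s \<beta> Q"
proof (rule runs_while[where I = "\<lambda>j s. j \<le> N \<and> I j s" and g = 0 and \<tau> = "\<lambda>_. \<tau>"
      and \<Phi> = "\<lambda>j. real (N - j) * (\<tau> + real (1 + cost e)) + real (1 + cost e)"], goal_cases)
  case (4 j s)
  then have j: "j < N" using assms(2) by blast
  have "runs W P s \<tau> (I (Suc j))" using assms(4)[OF j] 4 by blast
  then show ?case
  proof (rule runs_mono[OF _ order_refl])
    fix s' assume "I (Suc j) s'"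
    moreover have "real (N - j) = real (N - Suc j) + 1" using j by (simp add: of_nat_diff)
    then have "\<tau> + real (1 + cost e) + (real (N - Suc j) * (\<tau> + real (1 + cost e)) + real (1 + cost e)) \<le>
        real (N - j) * (\<tau> + real (1 + cost e)) + real (1 + cost e)"
      by (simp only: distrib_right) simp
    ultimately show "\<exists>j'. (j' \<le> N \<and> I j' s') \<and> \<tau> + real (1 + cost e) +
        (real (N - j') * (\<tau> + real (1 + cost e)) + real (1 + cost e))
        \<le> real (N - j) * (\<tau> + real (1 + cost e)) + real (1 + cost e)"
      using j by (intro exI[of _ "Suc j"]) auto
  qed
next
  case (7 j s)
  then have "j = N" using assms(2) by (metis nat_less_le)
  then show ?case using 7 assms(7) by blast
qed (use assms in auto)

end

section \<open>Notation and frame conditions\<close>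

abbreviation eAdd (infixl "[+]" 65) where "e1 [+] e2 \<equiv> Bin Add e1 e2"
abbreviation eSub (infixl "[-]" 65) where "e1 [-] e2 \<equiv> Bin Sub e1 e2"
abbreviation eMul (infixl "[*]" 70) where "e1 [*] e2 \<equiv> Bin Mul e1 e2"
abbreviation eLt (infix "[<]" 50) where "e1 [<] e2 \<equiv> Bin Lt e1 e2"
abbreviation eLe (infix "[<=]" 50) where "e1 [<=] e2 \<equiv> Bin Lt e1 (Bin Add e2 (Const 1))"
abbreviation eEq (infix "[=]" 50) where "e1 [=] e2 \<equiv> Bin Eq e1 e2"
abbreviation cSeq (infixr ";;" 60) where "P ;; Q \<equiv> Seq P Q"
abbreviation cAssign (infix "::=" 61) where "x ::= e \<equiv> Assign x e"

definition agree :: "vname set \<Rightarrow> vname set \<Rightarrow> state \<Rightarrow> state \<Rightarrow> bool" where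
  "agree A C s s' \<longleftrightarrow> (\<forall>x. x \<notin> A \<longrightarrow> var s' x = var s x) \<and> (\<forall>x. x \<notin> C \<longrightarrow> arr s' x = arr s x)"

lemma agree_refl [simp]: "agree A C s s"
  by (simp add: agree_def)

lemma agree_setv [simp]: "x \<in> A \<Longrightarrow> agree A C s s' \<Longrightarrow> agree A C s (setv s' x v)"
  by (auto simp: agree_def)

lemma agree_seta [simp]: "x \<in> C \<Longrightarrow> agree A C s s' \<Longrightarrow> agree A C s (seta s' x i v)"
  by (auto simp: agree_def fun_eq_iff)

lemma agree_trans: "agree A C s s' \<Longrightarrow> agree A' C' s' s'' \<Longrightarrow> A \<subseteq> D \<Longrightarrow> A' \<subseteq> D \<Longrightarrow> C \<subseteq> E \<Longrightarrow> C' \<subseteq> E \<Longrightarrow>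
    agree D E s s''"
  unfolding agree_def by (metis subsetD)

primrec writes :: "com \<Rightarrow> vname set" where
  "writes Skip = {}"
| "writes (Assign x e) = {x}"
| "writes (Store x e1 e2) = {x}"
| "writes (Seq P Q) = writes P \<union> writes Q"
| "writes (If e P Q) = writes P \<union> writes Q"
| "writes (While e P) = writes P"

lemma finite_writes: "finite (writes P)"
  by (induction P) auto

lemma exec_agree: "exec W P s t s' \<Longrightarrow> agree (writes P) (writes P) s s'"
  by (induction rule: exec.induct) (auto simp: agree_def)

text \<open>For a program known only by its specification, such as the assumed convolution program:
  whatever it computes, it changes no name that does not occur in it.\<close>

lemma runs_agree:
  assumes "runs W P s \<beta> Q"
  shows "runs W P s \<beta> (\<lambda>s'. Q s' \<and> agree (writes P) (writes P) s s')"
  using assms exec_agree unfolding runs_def by blast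

section \<open>Counting pairs of occurrences\<close>

locale cadence_instance =
  fixes S :: "int list" and \<sigma> :: int and n k a b c :: nat
  assumes n_def: "n = length S"
    and k_pos: "0 < k" and less_k: "a < k" "b < k" "c < k"
    and distinct: "a \<noteq> b" "a \<noteq> c" "b \<noteq> c"
begin

text \<open>The conditions that mention no characters, over the integers to avoid truncated
  subtraction. In the \<open>(i, d)\<close>-plane they cut out the lattice points of the
  quadrilateral.\<close>

definition poly :: "int \<Rightarrow> int \<Rightarrow> bool" where
  "poly i d \<longleftrightarrow> 0 < i \<and> i \<le> d \<and> i + (int k - 1) * d \<le> int n \<and> int n < i + int k * d"

definition occ_at :: "int \<Rightarrow> bool" where
  "occ_at j \<longleftrightarrow> 1 \<le> j \<and> j \<le> int n \<and> S ! nat (j - 1) = \<sigma>"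

lemma poly_pos:
  assumes "poly i d" "l < k"
  shows "1 \<le> i + int l * d" "i + int l * d \<le> int n"
proof -
  have d: "1 \<le> d" "1 \<le> i" "i + (int k - 1) * d \<le> int n" using assms(1) by (auto simp: poly_def)
  then show "1 \<le> i + int l * d" using mult_nonneg_nonneg[of "int l" d] by linarith
  have "int l * d \<le> (int k - 1) * d" using d assms(2) by (intro mult_right_mono) auto
  then show "i + int l * d \<le> int n" using d by linarith
qed

definition cadences :: "(int \<times> int) set" where
  "cadences = {(i, d). poly i d \<and> occ_at (i + int a * d) \<and> occ_at (i + int b * d) \<and> occ_at (i + int c * d)}"

lemma cadences_subset: "cadences \<subseteq> {1..int n} \<times> {1..int n}"
proof -
  have "1 \<le> i \<and> i \<le> int n \<and> 1 \<le> d \<and> d \<le> int n" if "poly i d" for i d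
  proof -
    have "2 < k" using less_k distinct by linarith
    then have "1 * d \<le> (int k - 1) * d" using that by (intro mult_right_mono) (auto simp: poly_def)
    then have "d \<le> (int k - 1) * d" by simp
    then show ?thesis using that unfolding poly_def by linarith
  qed
  then show ?thesis by (auto simp: cadences_def)
qed

lemma card_cadences: "card (partial_cadences_with k a b c S \<sigma>) = card cadences"
proof (rule bij_betw_same_card[of "\<lambda>(i, d, _). (int i, int d)"], rule bij_betwI')
  fix x y assume "x \<in> partial_cadences_with k a b c S \<sigma>" "y \<in> partial_cadences_with k a b c S \<sigma>"
  then obtain i d i' d' where "x = (i, d, k)" "y = (i', d', k)"
    unfolding partial_cadences_with_def by blast
  then show "((case x of (i, d, _) \<Rightarrow> (int i, int d)) = (case y of (i, d, _) \<Rightarrow> (int i, int d))) = (x = y)"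
    by simp
next
  have occ: "occ_at (int i + int l * int d) \<longleftrightarrow> char_at S (i + l * d) = \<sigma>"
    if "poly (int i) (int d)" "l < k" for i d l
  proof -
    have "nat (int i + int l * int d - 1) = i + l * d - 1"
    proof -
      have "nat (int t - 1) = t - 1" for t by simp
      from this[of "i + l * d"] show ?thesis by simp
    qed
    then show ?thesis using poly_pos[OF that] by (auto simp: occ_at_def char_at_def)
  qed
  have poly: "poly (int i) (int d) \<longleftrightarrow>
      0 < i \<and> 0 < d \<and> i \<le> d \<and> i + (k - 1) * d \<le> length S \<and> length S < i + k * d" for i d
  proof -
    have "int i + (int k - 1) * int d = int (i + (k - 1) * d)"
      "int i + int k * int d = int (i + k * d)" using k_pos by (simp_all add: of_nat_diff)
    then show ?thesis unfolding poly_def n_def[symmetric] by (auto simp del: of_nat_add of_nat_mult)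
  qed
  fix x assume x: "x \<in> partial_cadences_with k a b c S \<sigma>"
  then obtain i d where id: "x = (i, d, k)" "partial_cadence a b c S (i, d, k)" "char_at S (i + a * d) = \<sigma>"
    unfolding partial_cadences_with_def by blast
  then have "poly (int i) (int d)" "char_at S (i + b * d) = \<sigma>" "char_at S (i + c * d) = \<sigma>"
    unfolding partial_cadence_def prod.case poly by simp_all
  then show "(case x of (i, d, _) \<Rightarrow> (int i, int d)) \<in> cadences"
    using less_k id by (simp add: cadences_def occ)
next
  fix y assume y: "y \<in> cadences"
  then obtain i d where id: "y = (i, d)" "poly i d" "occ_at (i + int a * d)" "occ_at (i + int b * d)"
    "occ_at (i + int c * d)" by (auto simp: cadences_def)
  have pos: "1 \<le> i" "1 \<le> d" using id(2) by (auto simp: poly_def)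
  show "\<exists>x\<in>partial_cadences_with k a b c S \<sigma>. y = (case x of (i, d, _) \<Rightarrow> (int i, int d))"
  proof (rule bexI[of _ "(nat i, nat d, k)"])
    show "y = (case (nat i, nat d, k) of (i, d, _) \<Rightarrow> (int i, int d))" using pos id(1) by simp
    have char: "char_at S (nat i + l * nat d) = \<sigma>" if "occ_at (i + int l * d)" for l
    proof -
      have "int (nat i + l * nat d) = i + int l * d" using pos by simp
      then have "nat (i + int l * d - 1) = nat i + l * nat d - 1" by linarith
      then show ?thesis using that by (simp add: occ_at_def char_at_def)
    qed
    have "i + (int k - 1) * d = int (nat i + (k - 1) * nat d)" "i + int k * d = int (nat i + k * nat d)"
      using k_pos pos by (simp_all add: of_nat_diff)
    then have "0 < nat i" "0 < nat d" "nat i \<le> nat d" "nat i + (k - 1) * nat d \<le> length S"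
      "length S < nat i + k * nat d"
      using id(2) pos unfolding poly_def n_def[symmetric]
      by (auto simp del: of_nat_add of_nat_mult simp: nat_mono)
    then have "partial_cadence a b c S (nat i, nat d, k)"
      using char id unfolding partial_cadence_def prod.case by simp
    then show "(nat i, nat d, k) \<in> partial_cadences_with k a b c S \<sigma>"
      using char id unfolding partial_cadences_with_def by blast
  qed
qed

text \<open>Even the smallest candidate \<open>i = d = 1\<close> reaches position \<open>k\<close>.
  The programs test this case first, since for \<open>k\<close> of the size of a word the later
  products would overflow.\<close>

lemma cadences_empty: "n < k \<Longrightarrow> cadences = {}"
proof -
  assume "n < k"
  have False if "poly i d" for i d
  proof -
    have "(int k - 1) * 1 \<le> (int k - 1) * d" using that k_pos by (intro mult_left_mono) (auto simp: poly_def)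
    then show False using that \<open>n < k\<close> by (auto simp: poly_def)
  qed
  then show ?thesis by (auto simp: cadences_def)
qed

text \<open>No order of \<open>a\<close> and \<open>c\<close> is assumed here. Once the remainder
  vanishes the division is exact, whatever the sign of \<open>c - a\<close>.\<close>

definition pair_hit :: "int \<Rightarrow> int \<Rightarrow> bool" where
  "pair_hit x z \<longleftrightarrow> (z - x) mod (int c - int a) = 0 \<and>
     (let d = (z - x) div (int c - int a); i = x - int a * d in poly i d \<and> occ_at (i + int b * d))"

lemma card_cadences_pairs:
  "card cadences = (\<Sum>x\<in>occurrences S \<sigma>. \<Sum>z\<in>occurrences S \<sigma>. of_bool (pair_hit (int x) (int z)))"
proof -
  let ?O = "occurrences S \<sigma>"
  have fin: "finite ?O" by (rule finite_subset[of _ "{1..length S}"]) (auto simp: occurrences_def)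
  have occ: "occ_at j \<longleftrightarrow> 0 \<le> j \<and> nat j \<in> ?O" for j
  proof -
    have "nat (j - 1) = nat j - 1" by simp
    then show ?thesis
      unfolding occ_at_def occurrences_def char_at_def n_def[symmetric] mem_Collect_eq by auto
  qed
  have ca: "int c - int a \<noteq> 0" using distinct by simp
  have "card cadences = card {(x, z). x \<in> ?O \<and> z \<in> ?O \<and> pair_hit (int x) (int z)}"
  proof (rule bij_betw_same_card[of "\<lambda>(i, d). (nat (i + int a * d), nat (i + int c * d))"], rule bij_betwI')
    fix x y assume "x \<in> cadences" "y \<in> cadences"
    then obtain i d i' d' where *: "x = (i, d)" "y = (i', d')" "poly i d" "poly i' d'"
      by (auto simp: cadences_def)
    have "i = i' \<and> d = d'" if "i + int a * d = i' + int a * d'" "i + int c * d = i' + int c * d'"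
    proof -
      have "(int c - int a) * (d - d') = 0" using that by (simp add: algebra_simps)
      then show ?thesis using that ca by simp
    qed
    then show "((case x of (i, d) \<Rightarrow> (nat (i + int a * d), nat (i + int c * d))) =
        (case y of (i, d) \<Rightarrow> (nat (i + int a * d), nat (i + int c * d)))) = (x = y)"
      using poly_pos[OF *(3) less_k(1)] poly_pos[OF *(3) less_k(3)]
        poly_pos[OF *(4) less_k(1)] poly_pos[OF *(4) less_k(3)] * by auto
  next
    fix x assume "x \<in> cadences"
    then obtain i d where *: "x = (i, d)" "poly i d" "occ_at (i + int a * d)" "occ_at (i + int b * d)"
      "occ_at (i + int c * d)" by (auto simp: cadences_def)
    have "i + int c * d - (i + int a * d) = d * (int c - int a)" by (simp add: algebra_simps)
    then show "(case x of (i, d) \<Rightarrow> (nat (i + int a * d), nat (i + int c * d)))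
        \<in> {(x, z). x \<in> ?O \<and> z \<in> ?O \<and> pair_hit (int x) (int z)}"
      using * ca by (auto simp: pair_hit_def occ Let_def)
  next
    fix y assume "y \<in> {(x, z). x \<in> ?O \<and> z \<in> ?O \<and> pair_hit (int x) (int z)}"
    then obtain x z where *: "y = (x, z)" "x \<in> ?O" "z \<in> ?O" "pair_hit (int x) (int z)" by auto
    define d where "d = (int z - int x) div (int c - int a)"
    define i where "i = int x - int a * d"
    have zx: "int z - int x = d * (int c - int a)"
      using *(4) by (auto simp: pair_hit_def d_def)
    have eq: "i + int a * d = int x" "i + int c * d = int z"
      using zx by (simp_all add: i_def algebra_simps)
    have "poly i d" "occ_at (i + int b * d)"
      using *(4) by (auto simp: pair_hit_def d_def i_def Let_def)
    then have "(i, d) \<in> cadences" using * by (simp add: cadences_def eq) (simp add: occ)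
    then show "\<exists>x\<in>cadences. y = (case x of (i, d) \<Rightarrow> (nat (i + int a * d), nat (i + int c * d)))"
      by (rule bexI[rotated]) (simp add: eq *)
  qed
  also have "{(x, z). x \<in> ?O \<and> z \<in> ?O \<and> pair_hit (int x) (int z)} =
      (SIGMA x:?O. {z \<in> ?O. pair_hit (int x) (int z)})" by auto
  also have "card \<dots> = (\<Sum>x\<in>?O. card {z \<in> ?O. pair_hit (int x) (int z)})"
    using fin by (simp add: card_SigmaI)
  also have "\<dots> = (\<Sum>x\<in>?O. \<Sum>z\<in>?O. of_bool (pair_hit (int x) (int z)))"
  proof (rule sum.cong[OF refl])
    fix x
    have "{z \<in> ?O. pair_hit (int x) (int z)} = ?O \<inter> {z. pair_hit (int x) (int z)}" by auto
    then show "card {z \<in> ?O. pair_hit (int x) (int z)} = (\<Sum>z\<in>?O. of_bool (pair_hit (int x) (int z)))"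
      using fin by (simp add: of_bool_def sum.If_cases)
  qed
  finally show ?thesis .
qed

end

text \<open>Conjunctions are products of tests with values 0 and 1. The character is read only
  behind the test of the side conditions, because outside of them the index might be negative and
  the machine would get stuck.\<close>

definition pairs_body :: com where
  "pairs_body =
     ''x'' ::= Read ''occ'' (Var ''u'') ;;
     ''z'' ::= Read ''occ'' (Var ''v'') ;;
     If (Bin Mod (Var ''z'' [-] Var ''x'') (Var ''c'' [-] Var ''a'') [=] Const 0)
      (''d'' ::= Bin Div (Var ''z'' [-] Var ''x'') (Var ''c'' [-] Var ''a'') ;;
       ''i'' ::= Var ''x'' [-] Var ''a'' [*] Var ''d'' ;;
       If ((Const 1 [<=] Var ''i'') [*] (Var ''i'' [<=] Var ''d'') [*]
           (Var ''i'' [+] (Var ''k'' [-] Const 1) [*] Var ''d'' [<=] Var ''n'') [*]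
           (Var ''n'' [<] Var ''i'' [+] Var ''k'' [*] Var ''d''))
        (If (Read ''S'' (Var ''i'' [+] Var ''b'' [*] Var ''d'' [-] Const 1) [=] Var ''sigma'')
          (''count'' ::= Var ''count'' [+] Const 1) Skip) Skip) Skip ;;
     ''v'' ::= Var ''v'' [+] Const 1"

definition pairs_prog :: com where
  "pairs_prog =
     ''count'' ::= Const 0 ;;
     If (Var ''k'' [<=] Var ''n'')
      (''u'' ::= Const 0 ;;
       While (Var ''u'' [<] Var ''n_sigma'')
        (''v'' ::= Const 0 ;;
         While (Var ''v'' [<] Var ''n_sigma'') pairs_body ;;
         ''u'' ::= Var ''u'' [+] Const 1)) Skip"

locale pairs_run = cadence_instance + word_bound +
  fixes occ :: "nat list"
  assumes B_large: "(int n + 2) ^ 3 \<le> B" and k_le: "k \<le> n"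
    and chars: "\<forall>x \<in> set S. \<bar>x\<bar> \<le> W" "\<bar>\<sigma>\<bar> \<le> W"
    and occ: "distinct occ" "set occ = occurrences S \<sigma>"
begin

definition frame :: "state \<Rightarrow> bool" where
  "frame s \<longleftrightarrow> (\<forall>j<n. arr s ''S'' j = S ! j) \<and> (\<forall>j<length occ. arr s ''occ'' j = int (occ ! j)) \<and>
     var s ''n'' = int n \<and> var s ''k'' = int k \<and> var s ''a'' = int a \<and> var s ''b'' = int b \<and>
     var s ''c'' = int c \<and> var s ''sigma'' = \<sigma> \<and> var s ''n_sigma'' = int (length occ)"

lemma frameD:
  assumes "frame s"
  shows "j < n \<Longrightarrow> arr s ''S'' j = S ! j" "j < length occ \<Longrightarrow> arr s ''occ'' j = int (occ ! j)"
    "var s ''n'' = int n" "var s ''k'' = int k" "var s ''a'' = int a" "var s ''b'' = int b"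
    "var s ''c'' = int c" "var s ''sigma'' = \<sigma>" "var s ''n_sigma'' = int (length occ)"
  using assms by (auto simp: frame_def)

lemma frame_setv [simp]:
  "x \<notin> {''n'', ''k'', ''a'', ''b'', ''c'', ''sigma'', ''n_sigma''} \<Longrightarrow> frame (setv s x v) = frame s"
  by (auto simp: frame_def)

lemma occ_le: "j < length occ \<Longrightarrow> occ ! j \<le> n"
  using occ(2) nth_mem[of j occ] by (auto simp: occurrences_def n_def)

lemma length_occ: "length occ \<le> n"
proof -
  have "set occ \<subseteq> {1..n}" unfolding occ(2) by (auto simp: occurrences_def n_def)
  then have "card (set occ) \<le> card {1..n}" by (intro card_mono) auto
  then show ?thesis using distinct_card[OF occ(1)] by simp
qed

lemma B_bounds: "int n + 2 \<le> B" "int n * int n + int n + 2 \<le> B"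
proof -
  have "(int n + 2) ^ 3 = int n ^ 3 + 6 * (int n * int n) + 12 * int n + 8"
    by (simp add: power3_eq_cube algebra_simps)
  moreover have "0 \<le> int n ^ 3" "0 \<le> int n * int n" by simp_all
  ultimately show "int n + 2 \<le> B" "int n * int n + int n + 2 \<le> B" using B_large by linarith+
qed

definition hits :: "nat \<Rightarrow> nat \<Rightarrow> int" where
  "hits u v = of_bool (pair_hit (int (occ ! u)) (int (occ ! v)))"

lemma pairs_body:
  assumes "frame s" "var s ''u'' = int u" "u < length occ" "var s ''v'' = int v" "v < length occ"
    "0 \<le> var s ''count''" "var s ''count'' < B"
  shows "runs W pairs_body s 120 (\<lambda>s'. frame s' \<and> var s' ''u'' = int u \<and> var s' ''v'' = int (Suc v) \<and>
     var s' ''count'' = var s ''count'' + hits u v)"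
proof -
  note fr = frameD[OF assms(1)]
  define x where "x = int (occ ! u)"
  define z where "z = int (occ ! v)"
  define d where "d = (z - x) div (int c - int a)"
  define i where "i = x - int a * d"
  have xz: "0 \<le> x" "x \<le> int n" "0 \<le> z" "z \<le> int n"
    using occ_le assms by (auto simp: x_def z_def)
  have d: "\<bar>d\<bar> \<le> int n"
    using abs_div_le[of "z - x" "int c - int a"] xz by (simp add: d_def)
  \<comment> \<open>The side conditions have not been tested yet and \<open>d\<close> may be
    negative, so \<open>i\<close> is controlled only through \<open>a < k <= n\<close>. This forces
    \<open>B\<close> to be at least quadratic in \<open>n\<close>.\<close>
  have "\<bar>int a * d\<bar> \<le> int n * int n"
    using d less_k k_le by (simp add: abs_mult mult_mono)
  then have i: "\<bar>i\<bar> \<le> int n * int n + int n" using xz by (simp add: i_def)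
  have bounds: "\<bar>x\<bar> \<le> B" "\<bar>z\<bar> \<le> B" "\<bar>d\<bar> \<le> B" "\<bar>i\<bar> \<le> B" "int n \<le> B" "int k \<le> B" "int a \<le> B" "int b \<le> B"
      "int c \<le> B" "int (length occ) \<le> B" "int u \<le> B" "int v \<le> B" "1 \<le> B" "0 \<le> B"
      "d \<le> B" "i \<le> B" "x \<le> B" "z \<le> B"
    using xz d i B_bounds k_le less_k length_occ assms by linarith+
  have ca: "int c - int a \<noteq> 0" using distinct by simp
  have pos: "0 < i + int b * d" "nat (i + int b * d - 1) < n" if "poly i d"
    using poly_pos[OF that less_k(2)] by linarith+
  have ch: "\<bar>S ! nat (i + int b * d - 1)\<bar> \<le> W" if "poly i d"
    using chars(1) pos[OF that] by (simp add: n_def)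
  have hit: "pair_hit x z \<longleftrightarrow> (z - x) mod (int c - int a) = 0 \<and> poly i d \<and> S ! nat (i + int b * d - 1) = \<sigma>"
    using poly_pos[of i d b] less_k by (auto simp: pair_hit_def Let_def d_def i_def occ_at_def)
  define h where "h = hits u v"
  have h: "h = of_bool (pair_hit x z)" by (simp add: h_def hits_def x_def z_def)
  have BW: "B \<le> W" using self_le_power[of B 32] B_ge B_pow by linarith
  have cnt: "\<bar>var s ''count''\<bar> \<le> B" using assms by linarith
  show ?thesis
    unfolding pairs_body_def x_def[symmetric] z_def[symmetric] h_def[symmetric]
    apply (intro straight_line)
    apply (simp_all add: assms fr bounds x_def[symmetric] z_def[symmetric])
    apply (rule runs_if_seq)
       apply (simp_all add: assms fr bounds distinct[symmetric])
     apply (intro straight_line)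
           apply (simp_all add: assms fr bounds distinct[symmetric] d_def[symmetric] i_def[symmetric])
     apply (rule runs_if_seq)
        apply (simp_all add: assms fr bounds)
      apply (rule runs_if_read_seq)
            apply (simp_all add: assms fr bounds cnt chars pos[unfolded poly_def] ch[unfolded poly_def])
        apply (intro straight_line; simp add: assms fr bounds cnt[simplified abs_le_iff] h hit poly_def; blast)+
    done
qed

lemma sum_hits_le: "(\<Sum>v<m. hits u v) \<le> int m" "0 \<le> (\<Sum>v<m. hits u v)"
  using sum_bounded_above[of "{..<m}" "hits u" 1] by (auto simp: hits_def sum_nonneg)

lemma n_le_B: "int n \<le> B" "int (length occ) \<le> B" "j \<le> length occ \<Longrightarrow> int j \<le> B"
  using B_bounds length_occ by linarith+

lemma inner_loop:
  assumes "frame s" "var s ''u'' = int u" "u < length occ" "var s ''v'' = 0"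
    "0 \<le> var s ''count''" "var s ''count'' + int (length occ) < B"
  shows "runs W (While (Var ''v'' [<] Var ''n_sigma'') pairs_body) s (130 * real (length occ) + 4)
    (\<lambda>s'. frame s' \<and> var s' ''u'' = int u \<and>
      var s' ''count'' = var s ''count'' + (\<Sum>v<length occ. hits u v))"
proof (rule runs_for[where \<tau> = 120 and N = "length occ" and I = "\<lambda>v s'. frame s' \<and>
      var s' ''u'' = int u \<and> var s' ''v'' = int v \<and>
      var s' ''count'' = var s ''count'' + (\<Sum>j<v. hits u j)"], goal_cases)
  case (4 v s')
  have *: "0 \<le> var s' ''count''" "var s' ''count'' < B"
    using sum_hits_le[of u v] assms 4 by linarith+
  show ?case
    by (rule runs_mono[OF pairs_body[of s' u v]]) (use assms 4 * in auto)
qed (use assms n_le_B in \<open>auto simp: frameD\<close>)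

lemma outer_loop:
  assumes "frame s" "var s ''u'' = 0" "var s ''count'' = 0"
  shows "runs W (While (Var ''u'' [<] Var ''n_sigma'')
        (''v'' ::= Const 0 ;; While (Var ''v'' [<] Var ''n_sigma'') pairs_body ;;
         ''u'' ::= Var ''u'' [+] Const 1)) s (130 * (real (length occ))\<^sup>2 + 20 * real (length occ) + 4)
    (\<lambda>s'. var s' ''count'' = (\<Sum>u<length occ. \<Sum>v<length occ. hits u v))"
proof (rule runs_for[where \<tau> = "130 * real (length occ) + 10" and N = "length occ"
      and I = "\<lambda>u s'. frame s' \<and> var s' ''u'' = int u \<and>
         var s' ''count'' = (\<Sum>i<u. \<Sum>j<length occ. hits i j)"], goal_cases)
  case (4 u s')
  note u = 4
  \<comment> \<open>The count stays below \<open>n * n\<close>, so it remains under \<open>B\<close>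
    even after another complete row.\<close>
  have "(\<Sum>i<u. \<Sum>j<length occ. hits i j) \<le> (\<Sum>i<u. int (length occ))"
    by (intro sum_mono sum_hits_le)
  also have "\<dots> \<le> int n * int n"
    using u(1) length_occ by (auto intro!: mult_mono)
  finally have *: "0 \<le> var s' ''count''" "var s' ''count'' + int (length occ) < B"
    using u B_bounds length_occ by (auto intro!: sum_nonneg simp: hits_def)
  let ?s = "setv s' ''v'' 0"
  have "runs W (While (Var ''v'' [<] Var ''n_sigma'') pairs_body) ?s (130 * real (length occ) + 4)
    (\<lambda>s'. frame s' \<and> var s' ''u'' = int u \<and>
      var s' ''count'' = var ?s ''count'' + (\<Sum>v<length occ. hits u v))"
    using u * by (intro inner_loop) auto
  then show ?case
    apply (intro runs_assign_seq)
      apply (use B_ge in simp)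
     apply simp
    apply (unfold ev.simps)
    apply (erule runs_call)
    apply (intro straight_line)
       apply (use u n_le_B B_ge in \<open>auto simp: algebra_simps\<close>)
    done
next
  case 5
  show ?case by (simp add: power2_eq_square algebra_simps)
qed (use assms n_le_B in \<open>auto simp: frameD\<close>)

lemma sum_hits: "(\<Sum>u<length occ. \<Sum>v<length occ. hits u v) = int (card cadences)"
proof -
  have nth: "(\<Sum>u<length occ. f (occ ! u)) = sum f (occurrences S \<sigma>)" for f :: "nat \<Rightarrow> int"
  proof -
    have "(\<Sum>u<length occ. f (occ ! u)) = sum_list (map f occ)"
      by (simp add: sum_list_sum_nth atLeast0LessThan)
    then show ?thesis using occ by (simp add: sum_list_distinct_conv_sum_set)
  qed
  show ?thesis
    unfolding hits_def card_cadences_pairs of_nat_sum of_nat_of_bool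
    by (subst nth[of "\<lambda>x. \<Sum>v<length occ. of_bool (pair_hit (int x) (int (occ ! v)))"], subst nth)
      (rule refl)
qed

end

lemma pairs_prog_correct:
  assumes "set S \<subseteq> \<Sigma>" "0 < k" "a \<in> {0..k-1}" "b \<in> {0..k-1}" "c \<in> {0..k-1}"
    "a \<noteq> b" "a \<noteq> c" "b \<noteq> c" "\<sigma> \<in> \<Sigma>" "(int (length S) + 2) ^ 96 \<le> W"
    "instance_in_memory W \<Sigma> S k a b c \<sigma> s" "occurrences_in_memory S \<sigma> occ s"
  shows "runs W pairs_prog s (130 * (real (length occ))\<^sup>2 + 20 * real (length occ) + 20)
    (\<lambda>s'. var s' ''count'' = int (card (partial_cadences_with k a b c S \<sigma>)))"
proof -
  interpret cadence_instance S \<sigma> "length S" k a b c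
    using assms by unfold_locales auto
  \<comment> \<open>A cubic \<open>B\<close> dominates the count and all intermediate positions; its
    32nd power gives the exponent 96.\<close>
  let ?B = "(int (length S) + 2) ^ 3"
  have "2 ^ 1 \<le> (int (length S) + 2) ^ 1" by simp
  also have "\<dots> \<le> ?B" by (rule power_increasing) auto
  finally have B2: "2 \<le> ?B" by simp
  interpret word_bound W ?B
    using assms(10) B2 by unfold_locales (auto simp flip: power_mult)
  have le: "int (length S) + 2 \<le> ?B"
    using power_increasing[of 1 3 "int (length S) + 2"] by simp
  have BW: "?B \<le> W" using self_le_power[of ?B 32] B2 B_pow by linarith
  note mem = assms(11)[unfolded instance_in_memory_def] assms(12)[unfolded occurrences_in_memory_def]
  let ?s = "setv s ''count'' 0"
  \<comment> \<open>Before this test \<open>k\<close> is known to be at most \<open>W\<close> only,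
    not at most \<open>B\<close>, so the test is evaluated directly.\<close>
  have kn: "aval W ?s (Var ''k'' [<=] Var ''n'') = Some (of_bool (k \<le> length S))"
    using mem le BW by (auto simp: word_def)
  show ?thesis
  proof (cases "k \<le> length S")
    case True
    interpret pairs_run S \<sigma> "length S" k a b c W ?B occ
      using True mem assms by unfold_locales auto
    have "frame (setv ?s ''u'' 0)"
      using mem by (auto simp: frame_def holds_array_def)
    from outer_loop[OF this] have loop: "runs W (While (Var ''u'' [<] Var ''n_sigma'')
        (''v'' ::= Const 0 ;; While (Var ''v'' [<] Var ''n_sigma'') pairs_body ;;
         ''u'' ::= Var ''u'' [+] Const 1)) (setv ?s ''u'' 0)
        (130 * (real (length occ))\<^sup>2 + 20 * real (length occ) + 4)
        (\<lambda>s'. var s' ''count'' = int (card cadences))"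
      unfolding sum_hits by simp
    show ?thesis
      unfolding pairs_prog_def card_cadences
      apply (intro straight_line)
        apply simp
       apply simp
      apply (unfold ev.simps)
      apply (rule runs_if'[OF kn])
       apply (intro straight_line)
         apply simp
        apply simp
       apply (simp, rule runs_mono[OF loop])
      using True apply auto
      done
  next
    case False
    then have "cadences = {}" using cadences_empty by simp
    then show ?thesis
      unfolding pairs_prog_def card_cadences
      apply (intro straight_line)
        apply simp
       apply simp
      apply (unfold ev.simps)
      apply (rule runs_if'[OF kn])
       apply (simp add: False)
      apply (intro straight_line)
       apply simp_all
      done
  qed
qed

section \<open>Decomposition into cells\<close>

locale sorted_instance = cadence_instance +
  assumes ab: "a < b" and bc: "b < c"
begin

definition d\<^sub>0 :: nat where "d\<^sub>0 = n div (k + 1)"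
definition d\<^sub>1 :: nat where "d\<^sub>1 = n div (k - 1)"

definition occ_val :: "int \<Rightarrow> int" where
  "occ_val j = of_bool (occ_at j)"

lemma k_ge: "3 \<le> k"
  using ab bc less_k by linarith

text \<open>By \<open>i <= d\<close>, the condition \<open>n < i + k * d\<close> yields
  \<open>n < (k + 1) * d\<close>; by \<open>0 < i\<close>, the condition on the last position yields
  \<open>(k - 1) * d <= n\<close>.\<close>

lemma poly_range:
  assumes "poly i d"
  shows "0 < i" "i \<le> d" "int d\<^sub>0 < d" "d \<le> int d\<^sub>1"
proof -
  have p: "0 < i" "i \<le> d" "i + (int k - 1) * d \<le> int n" "int n < i + int k * d"
    using assms by (auto simp: poly_def)
  then show "0 < i" "i \<le> d" by auto
  have "int n < d * (int k + 1)" using p by (simp add: algebra_simps)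
  moreover have "int n div (int k + 1) * (int k + 1) \<le> int n"
    using div_mult_mod_eq[of "int n" "int k + 1"] pos_mod_sign[of "int k + 1" "int n"] by linarith
  ultimately have "int n div (int k + 1) * (int k + 1) < d * (int k + 1)" by linarith
  then have "int n div (int k + 1) < d" by (simp add: mult_less_cancel_right)
  then show "int d\<^sub>0 < d" by (simp add: d\<^sub>0_def zdiv_int add.commute)
  have "d * (int k - 1) \<le> int n" using p by (simp add: algebra_simps)
  then have "d * (int k - 1) div (int k - 1) \<le> int n div (int k - 1)"
    using k_ge by (intro zdiv_mono1) auto
  then have "d \<le> int n div (int k - 1)" using k_ge by simp
  then show "d \<le> int d\<^sub>1" using k_ge by (simp add: d\<^sub>1_def zdiv_int of_nat_diff)
qed

text \<open>Common to both algorithms: \<open>h\<close> lists a superset of the cadences without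
  repetition, by difference and start in the brute force, by residue and two quotients in the
  quadtree.\<close>

lemma card_cadences_sum:
  assumes "finite T" "inj_on h T" "cadences \<subseteq> h ` T"
  shows "int (card cadences) = (\<Sum>t\<in>T. of_bool (h t \<in> cadences))"
proof -
  have "bij_betw h {t \<in> T. h t \<in> cadences} cadences"
    using assms by (auto simp: bij_betw_def inj_on_def)
  then have "card cadences = card {t \<in> T. h t \<in> cadences}"
    using bij_betw_same_card by fastforce
  moreover have "{t \<in> T. h t \<in> cadences} = T \<inter> {t. h t \<in> cadences}" by auto
  ultimately show ?thesis using assms(1) by simp
qed

lemma card_cadences_brute:
  "int (card cadences) =
     (\<Sum>e<d\<^sub>1 - d\<^sub>0. \<Sum>j<d\<^sub>0 + 1 + e. of_bool ((int j + 1, int (d\<^sub>0 + 1 + e)) \<in> cadences))"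
proof -
  let ?T = "SIGMA e:{..<d\<^sub>1 - d\<^sub>0}. {..<d\<^sub>0 + 1 + e}"
  let ?h = "\<lambda>(e, j). (int j + 1, int (d\<^sub>0 + 1 + e))"
  have "int (card cadences) = (\<Sum>t\<in>?T. of_bool (?h t \<in> cadences))"
  proof (rule card_cadences_sum)
    show "inj_on ?h ?T" by (auto simp: inj_on_def)
    show "cadences \<subseteq> ?h ` ?T"
    proof
      fix x assume x: "x \<in> cadences"
      then obtain i d where *: "x = (i, d)" "poly i d" by (auto simp: cadences_def)
      note r = poly_range[OF *(2)]
      show "x \<in> ?h ` ?T"
        by (rule image_eqI[of _ _ "(nat d - d\<^sub>0 - 1, nat (i - 1))"]) (use r * in auto)
    qed
  qed auto
  also have "\<dots> = (\<Sum>e<d\<^sub>1 - d\<^sub>0. \<Sum>j<d\<^sub>0 + 1 + e. of_bool (?h (e, j) \<in> cadences))"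
    by (subst sum.Sigma, simp, simp, simp only: split_def fst_conv snd_conv)
  finally show ?thesis by (simp only: prod.case)
qed

text \<open>
  A candidate \<open>(i, d)\<close> is given by coordinates \<open>(r, x, z)\<close> with \<open>r < c - a\<close> such that
  \<open>i + a (d - d\<^sub>0) = r + (c - a) x\<close> and \<open>i + c (d - d\<^sub>0) = r + (c - a) z\<close>.  Fixing the residue \<open>r\<close>
  makes the divisibility condition on \<open>d\<close> disappear.
\<close>

definition i_at :: "nat \<Rightarrow> nat \<Rightarrow> nat \<Rightarrow> int" where
  "i_at r x z = int r + int c * int x - int a * int z"

definition d_at :: "nat \<Rightarrow> nat \<Rightarrow> int" where
  "d_at x z = int d\<^sub>0 + int z - int x"

definition hit :: "nat \<Rightarrow> nat \<Rightarrow> nat \<Rightarrow> int" where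
  "hit r x z = of_bool ((i_at r x z, d_at x z) \<in> cadences)"

definition weight :: "nat \<Rightarrow> nat \<Rightarrow> nat \<Rightarrow> nat \<Rightarrow> int" where
  "weight r X Z w = (\<Sum>s<w. \<Sum>t<w. hit r (X + s) (Z + t))"

text \<open>The coefficients \<open>c - b\<close> and \<open>b - a\<close> of the middle position
  become the strides of the convolution; their sum is the stride \<open>c - a\<close> of the outer
  positions. The right-hand sides are natural numbers, ready to serve as array indices.\<close>

lemma positions:
  "i_at r x z + int a * d_at x z = int (a * d\<^sub>0 + r + (c - a) * x)"
  "i_at r x z + int b * d_at x z = int (b * d\<^sub>0 + r + (c - b) * x + (b - a) * z)"
  "i_at r x z + int c * d_at x z = int (c * d\<^sub>0 + r + (c - a) * z)"
proof -
  have diff: "int (c - a) = int c - int a" "int (c - b) = int c - int b" "int (b - a) = int b - int a"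
    using ab bc by simp_all
  show "i_at r x z + int a * d_at x z = int (a * d\<^sub>0 + r + (c - a) * x)"
    "i_at r x z + int b * d_at x z = int (b * d\<^sub>0 + r + (c - b) * x + (b - a) * z)"
    "i_at r x z + int c * d_at x z = int (c * d\<^sub>0 + r + (c - a) * z)"
    unfolding of_nat_add of_nat_mult diff i_at_def d_at_def by algebra+
qed

text \<open>Division with remainder by \<open>c - a\<close> makes the coordinates unique. The
  assumption makes the square wide enough: \<open>r + (c - a) * z = i + c * (d - d\<^sub>0)\<close>
  is at most \<open>d\<^sub>1 + c * (d\<^sub>1 - d\<^sub>0)\<close>, and
  \<open>x <= z\<close>.\<close>

lemma card_cadences_weight:
  assumes "d\<^sub>1 + c * (d\<^sub>1 - d\<^sub>0) < w * (c - a)"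
  shows "int (card cadences) = (\<Sum>r<c - a. weight r 0 0 w)"
proof -
  let ?T = "{..<c - a} \<times> {..<w} \<times> {..<w}"
  let ?h = "\<lambda>(r, x, z). (i_at r x z, d_at x z)"
  have "int (card cadences) = (\<Sum>t\<in>?T. of_bool (?h t \<in> cadences))"
  proof (rule card_cadences_sum)
    show "inj_on ?h ?T"
    proof (rule inj_onI)
      fix p q assume "p \<in> ?T" "q \<in> ?T" "?h p = ?h q"
      moreover obtain r x z r' x' z' where pq: "p = (r, x, z)" "q = (r', x', z')" by (metis prod.exhaust)
      ultimately have r: "r < c - a" "r' < c - a" and eq: "i_at r x z = i_at r' x' z'" "d_at x z = d_at x' z'"
        by auto
      have "a * d\<^sub>0 + r + (c - a) * x = a * d\<^sub>0 + r' + (c - a) * x'"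
        using positions(1)[of r x z] positions(1)[of r' x' z'] eq by (metis of_nat_eq_iff)
      then have e: "r + (c - a) * x = r' + (c - a) * x'" by simp
      then have "r = r'"
        using r by (metis mod_less mod_mult_self2)
      moreover from this e have "x = x'" using ab bc by simp
      moreover from this eq have "z = z'" by (simp add: d_at_def)
      ultimately show "p = q" by (simp add: pq)
    qed
    show "cadences \<subseteq> ?h ` ?T"
    proof
      fix p assume "p \<in> cadences"
      then obtain i d where *: "p = (i, d)" "poly i d" by (auto simp: cadences_def)
      note rg = poly_range[OF *(2)]
      define e where "e = nat (d - int d\<^sub>0)"
      define u where "u = nat i + a * e"
      define r where "r = u mod (c - a)"
      define x where "x = u div (c - a)"
      define z where "z = x + e"
      have u: "u = r + (c - a) * x" by (simp add: r_def x_def)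
      have ca: "0 < c - a" using ab bc by simp
      have d: "d = int d\<^sub>0 + int e" using rg by (simp add: e_def)
      have i: "i = int (nat i)" using rg by simp
      have e_le: "e \<le> d\<^sub>1 - d\<^sub>0" "nat i \<le> d\<^sub>1" using rg by (auto simp: e_def)
      have iu: "int u = i + int a * int e" using i by (simp add: u_def)
      have "(c - a) * z \<le> u + (c - a) * e" by (simp add: u z_def algebra_simps)
      also have "\<dots> = nat i + c * e" using ab bc by (simp add: u_def diff_mult_distrib)
      also have "\<dots> \<le> d\<^sub>1 + c * (d\<^sub>1 - d\<^sub>0)" using e_le by (intro add_mono mult_le_mono) auto
      also have "\<dots> < (c - a) * w" using assms by (simp add: mult.commute)
      finally have "z < w" by simp
      moreover from this have "x < w" by (simp add: z_def)
      moreover have "r < c - a" using ca by (simp add: r_def)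
      moreover have "i_at r x z = i" "d_at x z = d"
      proof -
        show "d_at x z = d" using d by (simp add: d_at_def z_def)
        have "int u = int r + (int c - int a) * int x" using u ab bc by (simp add: of_nat_diff)
        then show "i_at r x z = i" using iu by (simp add: i_at_def z_def algebra_simps)
      qed
      ultimately show "p \<in> ?h ` ?T"
        by (intro image_eqI[of _ _ "(r, x, z)"]) (auto simp: *)
    qed
  qed auto
  then show ?thesis
    by (simp add: weight_def hit_def sum.cartesian_product' case_prod_beta)
qed

lemma weight_split:
  "weight r X Z (w + w) = weight r X Z w + weight r (X + w) Z w + weight r X (Z + w) w + weight r (X + w) (Z + w) w"
proof -
  have split: "(\<Sum>i<w + w. f i) = (\<Sum>i<w. f i) + (\<Sum>i<w. f (w + i))" for f :: "nat \<Rightarrow> int"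
    using sum.atLeastLessThan_concat[of 0 w "w + w" f] sum.shift_bounds_nat_ivl[of f 0 w w]
    by (simp add: lessThan_atLeast0 add.commute)
  show ?thesis
    by (simp add: weight_def split sum.distrib ac_simps)
qed

lemma weight_nonneg: "0 \<le> weight r X Z w"
  by (auto simp: weight_def hit_def intro!: sum_nonneg)

text \<open>The pairs \<open>(x, z)\<close> satisfying one side condition are cut out by a monotone function,
  whose extreme values on a cell are attained at two opposite corners.\<close>

definition inside :: "nat \<Rightarrow> nat \<Rightarrow> nat \<Rightarrow> nat \<Rightarrow> bool" where
  "inside r X Z w \<longleftrightarrow>
     0 < i_at r X (Z + w - 1) \<and>
     i_at r X (Z + w - 1) + (int k - 1) * d_at X (Z + w - 1) \<le> int n \<and>
     i_at r (X + w - 1) Z \<le> d_at (X + w - 1) Z \<and>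
     int n < i_at r (X + w - 1) Z + int k * d_at (X + w - 1) Z"

definition outside :: "nat \<Rightarrow> nat \<Rightarrow> nat \<Rightarrow> nat \<Rightarrow> bool" where
  "outside r X Z w \<longleftrightarrow>
     i_at r (X + w - 1) Z \<le> 0 \<or>
     int n < i_at r (X + w - 1) Z + (int k - 1) * d_at (X + w - 1) Z \<or>
     d_at X (Z + w - 1) < i_at r X (Z + w - 1) \<or>
     i_at r X (Z + w - 1) + int k * d_at X (Z + w - 1) \<le> int n"

text \<open>Increasing \<open>x\<close> and decreasing \<open>z\<close> raises \<open>i\<close> and
  lowers the other three expressions; for those involving \<open>k\<close> the signs of the
  coefficients follow from \<open>a < k\<close> and \<open>c < k\<close>. As the direction is
  common, the same two corners decide all four conditions.\<close>

lemma corner_mono: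
  assumes "x \<le> x'" "z' \<le> z"
  shows "i_at r x z \<le> i_at r x' z'"
    "i_at r x' z' + (int k - 1) * d_at x' z' \<le> i_at r x z + (int k - 1) * d_at x z"
    "d_at x' z' - i_at r x' z' \<le> d_at x z - i_at r x z"
    "i_at r x' z' + int k * d_at x' z' \<le> i_at r x z + int k * d_at x z"
proof -
  define u where "u = x' - x"
  define v where "v = z - z'"
  have uv: "x' = x + u" "z = z' + v" using assms by (simp_all add: u_def v_def)
  show "i_at r x z \<le> i_at r x' z'" by (simp add: uv i_at_def algebra_simps)
  have nonneg: "0 \<le> (int k - 1 - int c) * int u" "0 \<le> (int k - 1 - int a) * int v"
    "0 \<le> (int k - int c) * int u" "0 \<le> (int k - int a) * int v"
    using less_k by (auto intro!: mult_nonneg_nonneg)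
  have "i_at r x z + (int k - 1) * d_at x z =
      i_at r x' z' + (int k - 1) * d_at x' z' + (int k - 1 - int c) * int u + (int k - 1 - int a) * int v"
    unfolding uv i_at_def d_at_def of_nat_add by algebra
  then show "i_at r x' z' + (int k - 1) * d_at x' z' \<le> i_at r x z + (int k - 1) * d_at x z"
    using nonneg(1,2) by linarith
  have "i_at r x z + int k * d_at x z =
      i_at r x' z' + int k * d_at x' z' + (int k - int c) * int u + (int k - int a) * int v"
    unfolding uv i_at_def d_at_def of_nat_add by algebra
  then show "i_at r x' z' + int k * d_at x' z' \<le> i_at r x z + int k * d_at x z"
    using nonneg(3,4) by linarith
  show "d_at x' z' - i_at r x' z' \<le> d_at x z - i_at r x z"
    by (simp add: uv i_at_def d_at_def algebra_simps)
qed

lemma inside_poly: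
  assumes "inside r X Z w" "s < w" "t < w"
  shows "poly (i_at r (X + s) (Z + t)) (d_at (X + s) (Z + t))"
proof -
  have A: "X \<le> X + s" "Z + t \<le> Z + w - 1" and B: "X + s \<le> X + w - 1" "Z \<le> Z + t"
    using assms by auto
  note mono = corner_mono[OF A, of r] corner_mono[OF B, of r]
  have "0 < i_at r (X + s) (Z + t)" using mono(1) assms(1) unfolding inside_def by (meson order.trans order.strict_trans1 order.strict_trans2)
  moreover have "i_at r (X + s) (Z + t) + (int k - 1) * d_at (X + s) (Z + t) \<le> int n"
    using mono(2) assms(1) unfolding inside_def by (meson order.trans order.strict_trans1 order.strict_trans2)
  moreover have "0 \<le> d_at (X + w - 1) Z - i_at r (X + w - 1) Z"
    using assms(1) unfolding inside_def by simp
  then have "0 \<le> d_at (X + s) (Z + t) - i_at r (X + s) (Z + t)"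
    using mono(7) by (meson order.trans order.strict_trans1 order.strict_trans2)
  moreover have "int n < i_at r (X + s) (Z + t) + int k * d_at (X + s) (Z + t)"
    using mono(8) assms(1) unfolding inside_def by (meson order.trans order.strict_trans1 order.strict_trans2)
  ultimately show ?thesis by (simp add: poly_def)
qed

text \<open>One condition fails at its best corner, hence on the whole cell. A cell may miss the
  quadrilateral without such a single culprit; it then counts as crossing and is merely split
  further.\<close>

lemma outside_weight:
  assumes "outside r X Z w"
  shows "weight r X Z w = 0"
proof -
  have "hit r (X + s) (Z + t) = 0" if "s < w" "t < w" for s t
  proof -
    have A: "X \<le> X + s" "Z + t \<le> Z + w - 1" and B: "X + s \<le> X + w - 1" "Z \<le> Z + t"
      using that by auto
    note mono = corner_mono[OF A, of r] corner_mono[OF B, of r]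
    consider "i_at r (X + w - 1) Z \<le> 0"
      | "int n < i_at r (X + w - 1) Z + (int k - 1) * d_at (X + w - 1) Z"
      | "d_at X (Z + w - 1) - i_at r X (Z + w - 1) < 0"
      | "i_at r X (Z + w - 1) + int k * d_at X (Z + w - 1) \<le> int n"
      using assms(1) unfolding outside_def by fastforce
    then have "\<not> poly (i_at r (X + s) (Z + t)) (d_at (X + s) (Z + t))"
    proof cases
      case 1
      then have "i_at r (X + s) (Z + t) \<le> 0" using mono(5) by (meson order.trans order.strict_trans1 order.strict_trans2)
      then show ?thesis by (simp add: poly_def)
    next
      case 2
      then have "int n < i_at r (X + s) (Z + t) + (int k - 1) * d_at (X + s) (Z + t)"
        using mono(6) by (meson order.trans order.strict_trans1 order.strict_trans2)
      then show ?thesis by (simp add: poly_def)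
    next
      case 3
      then have "d_at (X + s) (Z + t) - i_at r (X + s) (Z + t) < 0" using mono(3) by (meson order.trans order.strict_trans1 order.strict_trans2)
      then show ?thesis by (simp add: poly_def)
    next
      case 4
      then have "i_at r (X + s) (Z + t) + int k * d_at (X + s) (Z + t) \<le> int n"
        using mono(4) by (meson order.trans order.strict_trans1 order.strict_trans2)
      then show ?thesis by (simp add: poly_def)
    qed
    then show ?thesis by (simp add: hit_def cadences_def)
  qed
  then show ?thesis by (simp add: weight_def)
qed

definition crossing :: "nat \<Rightarrow> nat \<Rightarrow> nat \<Rightarrow> nat \<Rightarrow> bool" where
  "crossing r X Z w \<longleftrightarrow> \<not> inside r X Z w \<and> \<not> outside r X Z w"

text \<open>For width 1 both corners coincide and \<open>outside\<close> is the exact negation of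
  \<open>inside\<close>, so the subdivision ends at single points.\<close>

lemma not_crossing_1: "\<not> crossing r X Z 1"
  by (auto simp: crossing_def inside_def outside_def)

end

section \<open>Hits in an inner cell as a convolution\<close>

lemma sum_support:
  fixes f :: "nat \<Rightarrow> int"
  assumes "0 < p" "\<And>t. t < w \<Longrightarrow> p * t < m"
    and "\<And>u. u < m \<Longrightarrow> xs ! u = (if p dvd u \<and> u div p < w then f (u div p) else 0)"
  shows "(\<Sum>u<m. xs ! u * g u) = (\<Sum>t<w. f t * g (p * t))"
proof -
  have "(\<Sum>u<m. xs ! u * g u) = (\<Sum>u\<in>(\<lambda>t. p * t) ` {..<w}. xs ! u * g u)"
    by (rule sum.mono_neutral_right) (use assms in \<open>auto simp: dvd_def image_iff\<close>)
  also have "\<dots> = (\<Sum>t<w. xs ! (p * t) * g (p * t))"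
    using assms(1) by (subst sum.reindex) (auto simp: inj_on_def)
  finally show ?thesis using assms by simp
qed

text \<open>Storing \<open>f\<close> with stride \<open>p\<close> and \<open>g\<close> with stride
  \<open>q\<close> puts the product of \<open>f s\<close> and \<open>g t\<close> at index
  \<open>p * s + q * t\<close> of the convolution. All these indices are below \<open>m\<close>, so
  the first \<open>m\<close> entries contain everything.\<close>

lemma sum_acyclic_conv:
  fixes f g h :: "nat \<Rightarrow> int"
  assumes pq: "0 < p" "0 < q" and w: "0 < w" and m: "m = (w - 1) * (p + q) + 1"
    and len: "length xs = m" "length ys = m"
    and xs: "\<And>u. u < m \<Longrightarrow> xs ! u = (if p dvd u \<and> u div p < w then f (u div p) else 0)"
    and ys: "\<And>u. u < m \<Longrightarrow> ys ! u = (if q dvd u \<and> u div q < w then g (u div q) else 0)"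
  shows "(\<Sum>j<m. acyclic_conv xs ys j * h j) = (\<Sum>s<w. \<Sum>t<w. f s * g t * h (p * s + q * t))"
proof -
  \<comment> \<open>Cutting \<open>h\<close> off at \<open>m\<close> extends the triangle
    \<open>u + v < m\<close> to a full square, over which the two sums separate.\<close>
  let ?h = "\<lambda>j. if j < m then h j else 0"
  have lt: "p * s + q * t < m" if "s < w" "t < w" for s t
  proof -
    have "p * s \<le> p * (w - 1)" "q * t \<le> q * (w - 1)" using that by auto
    moreover have "m = p * (w - 1) + q * (w - 1) + 1" unfolding m by (simp only: distrib_left mult.commute)
    ultimately show ?thesis by linarith
  qed
  have "(\<Sum>j<m. acyclic_conv xs ys j * h j) =
      (\<Sum>j<m. \<Sum>(u, v) \<in> {(u, v). u < m \<and> v < m \<and> u + v = j}. xs ! u * ys ! v * h (u + v))"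
    unfolding acyclic_conv_def len sum_distrib_right by (intro sum.cong) auto
  also have "\<dots> = (\<Sum>(u, v) \<in> (\<Union>j\<in>{..<m}. {(u, v). u < m \<and> v < m \<and> u + v = j}). xs ! u * ys ! v * h (u + v))"
    by (rule sum.UNION_disjoint[symmetric])
      (auto intro: finite_subset[of _ "{..<m} \<times> {..<m}"])
  also have "\<dots> = (\<Sum>(u, v) \<in> {..<m} \<times> {..<m}. xs ! u * ys ! v * ?h (u + v))"
    by (rule sum.mono_neutral_cong_left) auto
  also have "\<dots> = (\<Sum>u<m. xs ! u * (\<Sum>v<m. ys ! v * ?h (u + v)))"
    by (simp add: sum.cartesian_product[symmetric] sum_distrib_left mult.assoc)
  also have "\<dots> = (\<Sum>s<w. f s * (\<Sum>v<m. ys ! v * ?h (p * s + v)))"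
    using lt[of _ 0] w by (intro sum_support) (use pq xs in auto)
  also have "\<dots> = (\<Sum>s<w. f s * (\<Sum>t<w. g t * ?h (p * s + q * t)))"
  proof (rule sum.cong[OF refl])
    fix s assume "s \<in> {..<w}"
    have "(\<Sum>v<m. ys ! v * ?h (p * s + v)) = (\<Sum>t<w. g t * ?h (p * s + q * t))"
      using lt[of 0] w by (intro sum_support) (use pq ys in auto)
    then show "f s * (\<Sum>v<m. ys ! v * ?h (p * s + v)) = f s * (\<Sum>t<w. g t * ?h (p * s + q * t))"
      by (rule arg_cong)
  qed
  also have "\<dots> = (\<Sum>s<w. \<Sum>t<w. f s * g t * h (p * s + q * t))"
    by (simp add: sum_distrib_left mult.assoc lt)
  finally show ?thesis .
qed

text \<open>Each first index belongs to at most one pair, so an entry has at most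
  \<open>length xs\<close> summands. The bound keeps the gathered sums within a word.\<close>

lemma abs_acyclic_conv_le:
  assumes "\<forall>v \<in> set xs \<union> set ys. \<bar>v\<bar> \<le> 1"
  shows "\<bar>acyclic_conv xs ys j\<bar> \<le> int (length xs)"
proof -
  let ?P = "{(p, q). p < length xs \<and> q < length ys \<and> p + q = j}"
  have "\<bar>acyclic_conv xs ys j\<bar> \<le> (\<Sum>(p, q) \<in> ?P. \<bar>xs ! p * ys ! q\<bar>)"
    unfolding acyclic_conv_def by (rule order_trans[OF sum_abs]) (simp add: case_prod_beta)
  also have "\<dots> \<le> (\<Sum>_ \<in> ?P. 1)"
    using assms by (intro sum_mono) (auto simp: abs_mult intro!: mult_le_one)
  also have "\<dots> = int (card ?P)" by simp
  also have "card ?P \<le> card {..<length xs}"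
    by (rule card_inj_on_le[of fst]) (auto simp: inj_on_def)
  finally show ?thesis by simp
qed

text \<open>On an inner cell a hit is just a product of three occurrence indicators. The convolution
  counts, for each middle position, the pairs of outer occurrences belonging to it, and the last
  factor keeps the middle positions that are occurrences.\<close>

lemma (in sorted_instance) weight_conv:
  assumes "inside r X Z w" "0 < w" and m: "m = (w - 1) * (c - a) + 1"
    and len: "length xs = m" "length ys = m"
    and xs: "\<And>u. u < m \<Longrightarrow> xs ! u = (if (c - b) dvd u \<and> u div (c - b) < w
      then occ_val (int (a * d\<^sub>0 + r + (c - a) * (X + u div (c - b)))) else 0)"
    and ys: "\<And>u. u < m \<Longrightarrow> ys ! u = (if (b - a) dvd u \<and> u div (b - a) < w
      then occ_val (int (c * d\<^sub>0 + r + (c - a) * (Z + u div (b - a)))) else 0)"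
  shows "(\<Sum>j<m. acyclic_conv xs ys j *
      occ_val (int (b * d\<^sub>0 + r + (c - b) * X + (b - a) * Z + j))) = weight r X Z w"
proof -
  have m': "m = (w - 1) * ((c - b) + (b - a)) + 1" using m ab bc by simp
  have "hit r (X + s) (Z + t) =
      occ_val (int (a * d\<^sub>0 + r + (c - a) * (X + s))) * occ_val (int (c * d\<^sub>0 + r + (c - a) * (Z + t))) *
      occ_val (int (b * d\<^sub>0 + r + (c - b) * X + (b - a) * Z + ((c - b) * s + (b - a) * t)))"
    if "s < w" "t < w" for s t
  proof -
    have y: "b * d\<^sub>0 + r + (c - b) * (X + s) + (b - a) * (Z + t) =
        b * d\<^sub>0 + r + (c - b) * X + (b - a) * Z + ((c - b) * s + (b - a) * t)"
      by (simp add: distrib_left)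
    show ?thesis
      using inside_poly[OF assms(1) that]
      unfolding hit_def cadences_def mem_Collect_eq prod.case positions y occ_val_def
      by (simp only: of_bool_conj) simp
  qed
  then show ?thesis
    unfolding weight_def
    by (subst sum_acyclic_conv[OF _ _ assms(2) m' len xs ys]) (use ab bc in auto)
qed

text \<open>A monotone function changes sign on at most one cell of each antidiagonal.\<close>

lemma sign_changes_le:
  fixes \<phi> :: "nat \<Rightarrow> nat \<Rightarrow> int"
  assumes mono: "\<And>x x' z z'. x \<le> x' \<Longrightarrow> z' \<le> z \<Longrightarrow> \<phi> x z \<le> \<phi> x' z'" and w: "0 < w"
  shows "(\<Sum>u<M. \<Sum>v<M. of_bool (\<phi> (X + u * w) (Z + v * w + w - 1) < 0 \<and>
    0 \<le> \<phi> (X + u * w + w - 1) (Z + v * w))) \<le> 2 * M"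
proof -
  define P where "P u v \<longleftrightarrow> \<phi> (X + u * w) (Z + v * w + w - 1) < 0 \<and> 0 \<le> \<phi> (X + u * w + w - 1) (Z + v * w)" for u v
  let ?C = "{(u, v). u < M \<and> v < M \<and> P u v}"
  \<comment> \<open>If one cell lies further along in \<open>x\<close> and further back in
    \<open>z\<close>, its lowest value is at least the highest value of the other cell. So the two
    cannot both change sign.\<close>
  have less: "\<not> (u < u' \<and> v' < v)" if "P u v" "P u' v'" for u v u' v'
  proof
    assume "u < u' \<and> v' < v"
    then have "Suc u * w \<le> u' * w" "Suc v' * w \<le> v * w" by (intro mult_le_mono1; simp)+
    then have "X + u * w + w - 1 \<le> X + u' * w" "Z + v' * w + w - 1 \<le> Z + v * w" by auto
    from mono[OF this] that show False unfolding P_def by linarith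
  qed
  have "inj_on (\<lambda>(u, v). u + v) ?C"
  proof (rule inj_onI, clarify)
    fix u v u' v' :: nat assume "P u v" "P u' v'" "u + v = u' + v'"
    then show "u = u' \<and> v = v'"
      using less[of u v u' v'] less[of u' v' u v] by linarith
  qed
  moreover have "(\<lambda>(u, v). u + v) ` ?C \<subseteq> {..<2 * M}" by auto
  ultimately have "card ?C \<le> 2 * M" using card_inj_on_le[of _ ?C "{..<2 * M}"] by fastforce
  moreover have "?C = (SIGMA u:{..<M}. {..<M} \<inter> {v. P u v})" by auto
  ultimately show ?thesis by (simp add: P_def)
qed

section \<open>Number of split cells and size of the square\<close>

context sorted_instance
begin

definition crossings :: "nat \<Rightarrow> nat \<Rightarrow> nat \<Rightarrow> nat \<Rightarrow> nat \<Rightarrow> nat" where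
  "crossings r h M X Z = (\<Sum>u<M. \<Sum>v<M. of_bool (crossing r (X + u * 2 ^ h) (Z + v * 2 ^ h) (2 ^ h)))"

text \<open>A crossing cell is not inside, so some condition fails at its worst corner; it is not
  outside, so the same condition holds at its best corner. Hence one of four monotone functions
  changes sign there, and each does so at most \<open>2 * M\<close> times.\<close>

lemma crossings_le: "crossings r h M X Z \<le> 8 * M"
proof -
  let ?w = "2 ^ h :: nat"
  define C where "C \<phi> u v = (of_bool (\<phi> (X + u * ?w) (Z + v * ?w + ?w - 1) < 0 \<and>
    0 \<le> \<phi> (X + u * ?w + ?w - 1) (Z + v * ?w)) :: nat)" for \<phi> :: "nat \<Rightarrow> nat \<Rightarrow> int" and u v
  \<comment> \<open>All four functions are oriented to grow with \<open>x\<close> and shrink with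
    \<open>z\<close>. The shifts by 1 place the boundary of each condition between -1 and 0.\<close>
  define \<phi>\<^sub>1 where "\<phi>\<^sub>1 x z = i_at r x z - 1" for x z
  define \<phi>\<^sub>2 where "\<phi>\<^sub>2 x z = int n - (i_at r x z + (int k - 1) * d_at x z)" for x z
  define \<phi>\<^sub>3 where "\<phi>\<^sub>3 x z = - 1 - (d_at x z - i_at r x z)" for x z
  define \<phi>\<^sub>4 where "\<phi>\<^sub>4 x z = int n - (i_at r x z + int k * d_at x z)" for x z
  note defs = \<phi>\<^sub>1_def \<phi>\<^sub>2_def \<phi>\<^sub>3_def \<phi>\<^sub>4_def
  have "of_bool (crossing r (X + u * ?w) (Z + v * ?w) ?w) \<le> C \<phi>\<^sub>1 u v + C \<phi>\<^sub>2 u v + C \<phi>\<^sub>3 u v + C \<phi>\<^sub>4 u v" for u v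
    unfolding C_def defs crossing_def inside_def outside_def
    by (auto simp: not_le not_less simp del: of_nat_add)
  then have "crossings r h M X Z \<le> (\<Sum>u<M. \<Sum>v<M. C \<phi>\<^sub>1 u v + C \<phi>\<^sub>2 u v + C \<phi>\<^sub>3 u v + C \<phi>\<^sub>4 u v)"
    unfolding crossings_def by (intro sum_mono)
  also have "\<dots> = (\<Sum>u<M. \<Sum>v<M. C \<phi>\<^sub>1 u v) + (\<Sum>u<M. \<Sum>v<M. C \<phi>\<^sub>2 u v) +
      (\<Sum>u<M. \<Sum>v<M. C \<phi>\<^sub>3 u v) + (\<Sum>u<M. \<Sum>v<M. C \<phi>\<^sub>4 u v)"
    by (simp add: sum.distrib)
  also have "\<dots> \<le> 2 * M + 2 * M + 2 * M + 2 * M"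
  proof -
    have "\<phi> x z \<le> \<phi> x' z'" if "x \<le> x'" "z' \<le> z" "\<phi> \<in> {\<phi>\<^sub>1, \<phi>\<^sub>2, \<phi>\<^sub>3, \<phi>\<^sub>4}" for \<phi> x x' z z'
      using corner_mono[OF that(1,2), of r] that(3) unfolding defs[abs_def] by auto
    then show ?thesis
      unfolding C_def by (intro add_mono sign_changes_le) auto
  qed
  finally show ?thesis by simp
qed

text \<open>The total width of the cells handled below the given cell of width \<open>2 ^ l\<close>.\<close>

primrec visits :: "nat \<Rightarrow> nat \<Rightarrow> nat \<Rightarrow> nat \<Rightarrow> nat" where
  "visits r 0 X Z = 1"
| "visits r (Suc l) X Z = 2 ^ Suc l + (if crossing r X Z (2 ^ Suc l)
     then visits r l X Z + visits r l (X + 2 ^ l) Z + visits r l X (Z + 2 ^ l) + visits r l (X + 2 ^ l) (Z + 2 ^ l)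
     else 0)"

lemma crossings_double:
  "crossings r h (M + M) X Z = crossings r h M X Z + crossings r h M (X + M * 2 ^ h) Z +
     crossings r h M X (Z + M * 2 ^ h) + crossings r h M (X + M * 2 ^ h) (Z + M * 2 ^ h)"
proof -
  have split: "(\<Sum>i<M + M. f i) = (\<Sum>i<M. f i) + (\<Sum>i<M. f (M + i))" for f :: "nat \<Rightarrow> nat"
    using sum.atLeastLessThan_concat[of 0 M "M + M" f] sum.shift_bounds_nat_ivl[of f 0 M M]
    by (simp add: lessThan_atLeast0 add.commute)
  show ?thesis
    unfolding crossings_def split sum.distrib by (simp only: distrib_right ac_simps)
qed

text \<open>Every visited cell but the first has a crossing parent. A crossing cell of width
  \<open>2 ^ Suc j\<close> is charged the widths of its four children,
  \<open>4 * 2 ^ j\<close>.\<close>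

lemma visits_le_crossings:
  "visits r l X Z \<le> 2 ^ l + (\<Sum>j<l. 4 * 2 ^ j * crossings r (Suc j) (2 ^ (l - Suc j)) X Z)"
proof (induction l arbitrary: X Z)
  case (Suc l)
  show ?case
  proof (cases "crossing r X Z (2 ^ Suc l)")
    case True
    let ?X = "X + 2 ^ l" and ?Z = "Z + 2 ^ l"
    let ?c = "\<lambda>X Z j. 4 * 2 ^ j * crossings r (Suc j) (2 ^ (l - Suc j)) X Z"
    have "?c X Z j + ?c ?X Z j + ?c X ?Z j + ?c ?X ?Z j =
        4 * 2 ^ j * crossings r (Suc j) (2 ^ (Suc l - Suc j)) X Z" if "j < l" for j
    proof -
      have "2 ^ (Suc l - Suc j) = 2 ^ (l - Suc j) + (2 ^ (l - Suc j) :: nat)"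
        using that by (simp add: mult_2[symmetric] Suc_diff_Suc flip: power_Suc)
      moreover have "2 ^ (l - Suc j) * 2 ^ Suc j = (2 ^ l :: nat)"
        using that by (simp only: flip: power_add) simp
      ultimately show ?thesis
        by (simp only: crossings_double distrib_left)
    qed
    then have "(\<Sum>j<l. ?c X Z j) + (\<Sum>j<l. ?c ?X Z j) + (\<Sum>j<l. ?c X ?Z j) + (\<Sum>j<l. ?c ?X ?Z j) =
        (\<Sum>j<l. 4 * 2 ^ j * crossings r (Suc j) (2 ^ (Suc l - Suc j)) X Z)"
      unfolding sum.distrib[symmetric] by (intro sum.cong) auto
    moreover have "crossings r (Suc l) (2 ^ (Suc l - Suc l)) X Z = 1"
      using True by (simp add: crossings_def)
    ultimately show ?thesis
      using Suc.IH[of X Z] Suc.IH[of ?X Z] Suc.IH[of X ?Z] Suc.IH[of ?X ?Z] True by simp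
  qed simp
qed simp

text \<open>Halving the cells doubles their number along the sides, so every level contributes the
  same amount \<open>4 * 2 ^ j * 8 * 2 ^ (l - Suc j) = 16 * 2 ^ l\<close>. The factor
  \<open>l\<close> is the source of one of the two logarithms; the other comes from the
  convolution.\<close>

lemma visits_le: "visits r l X Z \<le> 2 ^ l * (1 + 16 * l)"
proof -
  have "(\<Sum>j<l. 4 * 2 ^ j * crossings r (Suc j) (2 ^ (l - Suc j)) X Z) \<le> (\<Sum>j<l. 16 * 2 ^ l)"
  proof (rule sum_mono)
    fix j assume "j \<in> {..<l}"
    then have e: "2 ^ l = 2 * (2 ^ j * 2 ^ (l - Suc j) :: nat)"
      by (simp flip: power_add power_Suc)
    have "4 * 2 ^ j * crossings r (Suc j) (2 ^ (l - Suc j)) X Z \<le> 4 * 2 ^ j * (8 * 2 ^ (l - Suc j))"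
      by (intro mult_le_mono crossings_le order_refl)
    also have "\<dots> = 16 * 2 ^ l" unfolding e by simp
    finally show "4 * 2 ^ j * crossings r (Suc j) (2 ^ (l - Suc j)) X Z \<le> 16 * 2 ^ l" .
  qed
  then show ?thesis
    using visits_le_crossings[of r l X Z] by (simp add: algebra_simps)
qed

text \<open>The third bound says that few differences are possible. It combines
  \<open>(k - 1) * d\<^sub>1 <= n\<close> with \<open>n < (k + 1) * (d\<^sub>0 + 1)\<close>, whose
  right-hand side is \<open>(k - 1) * d\<^sub>0 + 2 * d\<^sub>0 + k + 1\<close>.\<close>

lemma d_bounds: "(k + 1) * d\<^sub>0 \<le> n" "(k - 1) * d\<^sub>1 \<le> n" "(k - 1) * (d\<^sub>1 - d\<^sub>0) \<le> 2 * d\<^sub>0 + k" "d\<^sub>1 \<le> n"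
proof -
  show 1: "(k + 1) * d\<^sub>0 \<le> n" "(k - 1) * d\<^sub>1 \<le> n" unfolding d\<^sub>0_def d\<^sub>1_def by (rule times_div_less_eq_dividend)+
  have "n < (k + 1) * (d\<^sub>0 + 1)"
    unfolding d\<^sub>0_def using dividend_less_div_times[of "k + 1" n] by (simp add: algebra_simps)
  moreover have "(k + 1) * (d\<^sub>0 + 1) = (k - 1) * d\<^sub>0 + 2 * d\<^sub>0 + k + 1"
    using k_ge by (simp add: algebra_simps)
  ultimately have "(k - 1) * d\<^sub>1 \<le> (k - 1) * d\<^sub>0 + 2 * d\<^sub>0 + k" using 1 by linarith
  then show "(k - 1) * (d\<^sub>1 - d\<^sub>0) \<le> 2 * d\<^sub>0 + k" by (simp only: diff_mult_distrib2)
  have "1 * d\<^sub>1 \<le> (k - 1) * d\<^sub>1" using k_ge by (intro mult_le_mono1) simp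
  then show "d\<^sub>1 \<le> n" using 1(2) by linarith
qed

text \<open>The term \<open>d\<^sub>1\<close> costs a factor \<open>k / (k - 1) <= 3 / 2\<close>.
  The term \<open>c * (d\<^sub>1 - d\<^sub>0)\<close> is at most \<open>2 * d\<^sub>0 + k\<close>;
  times \<open>k\<close> this leaves a summand \<open>k * k\<close>, which is at most
  \<open>n\<close> by assumption.\<close>

lemma square_size:
  assumes "k * k \<le> n"
  shows "k * (d\<^sub>1 + c * (d\<^sub>1 - d\<^sub>0)) \<le> 5 * n"
proof -
  have "2 * k * d\<^sub>1 \<le> 3 * (k - 1) * d\<^sub>1" using k_ge by (intro mult_le_mono1) simp
  also have "\<dots> \<le> 3 * n" using d_bounds(2) by (simp add: mult.assoc)
  finally have "2 * (k * d\<^sub>1) \<le> 3 * n" by (simp only: mult.assoc)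
  moreover have "k * (c * (d\<^sub>1 - d\<^sub>0)) \<le> 3 * n"
  proof -
    have "c * (d\<^sub>1 - d\<^sub>0) \<le> (k - 1) * (d\<^sub>1 - d\<^sub>0)" using less_k by (intro mult_le_mono1) simp
    also have "\<dots> \<le> 2 * d\<^sub>0 + k" by (rule d_bounds)
    finally have "k * (c * (d\<^sub>1 - d\<^sub>0)) \<le> k * (2 * d\<^sub>0 + k)" by (rule mult_le_mono2)
    also have "\<dots> = 2 * (k * d\<^sub>0) + k * k" by (simp add: algebra_simps)
    also have "\<dots> \<le> 3 * n" using d_bounds(1) assms by simp
    finally show ?thesis .
  qed
  ultimately show ?thesis by (simp add: distrib_left)
qed

text \<open>A short string has \<open>d\<^sub>0 <= k - 1\<close>, so
  \<open>2 * d\<^sub>0 + k <= 3 * k - 2 <= 4 * (k - 1)\<close>.\<close>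

lemma few_differences:
  assumes "n < k * k"
  shows "d\<^sub>1 - d\<^sub>0 \<le> 4"
proof -
  have "k * d\<^sub>0 \<le> (k + 1) * d\<^sub>0" by simp
  then have "k * d\<^sub>0 < k * k" using d_bounds(1) assms by linarith
  then have "d\<^sub>0 < k" by simp
  then have "d\<^sub>0 \<le> k - 1" by simp
  then have "(k - 1) * (d\<^sub>1 - d\<^sub>0) \<le> (k - 1) * 4" using d_bounds(3) k_ge by linarith
  then show ?thesis unfolding mult_le_cancel1 using k_ge by linarith
qed

end

section \<open>The quadtree program\<close>

text \<open>
  The given convolution program \<open>P\<close> may overwrite every name that occurs in it; all data that have
  to survive its calls live under names with the prefix \<open>pre\<close>.
\<close>

locale conv_run = sorted_instance + word_bound +
  fixes P :: com and pre :: string and \<kappa> :: real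
  assumes fresh: "pre @ x \<notin> writes P"
    and pre_neq: "7 < length pre"
    and B_large: "1000 * (n + 2) ^ 3 \<le> nat B"
    and \<kappa>_ge: "1 \<le> \<kappa>"
    and conv: "0 < m \<Longrightarrow> m \<le> 5 * n \<Longrightarrow> length xs = m \<Longrightarrow> length ys = m \<Longrightarrow>
      \<forall>v \<in> set xs \<union> set ys. \<bar>v\<bar> \<le> 1 \<Longrightarrow> var s ''m'' = int m \<Longrightarrow>
      holds_array s ''x'' xs \<Longrightarrow> holds_array s ''y'' ys \<Longrightarrow>
      runs W P s (\<kappa> * real m) (\<lambda>s'. \<forall>j < 2 * m - 1. arr s' ''z'' j = acyclic_conv xs ys j)"
begin

lemma pre_simps [simp]:
  "pre @ u \<noteq> ''m''" "pre @ u \<noteq> ''x''" "pre @ u \<noteq> ''y''" "pre @ u \<noteq> ''z''"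
  "''m'' \<noteq> pre @ u" "''x'' \<noteq> pre @ u" "''y'' \<noteq> pre @ u" "''z'' \<noteq> pre @ u"
  "pre @ u \<notin> writes P"
proof -
  have *: "pre @ u \<noteq> v" if "length v \<le> 7" for v
    using pre_neq that by auto
  show "pre @ u \<noteq> ''m''" "pre @ u \<noteq> ''x''" "pre @ u \<noteq> ''y''" "pre @ u \<noteq> ''z''"
    by (rule *, simp)+
  then show "''m'' \<noteq> pre @ u" "''x'' \<noteq> pre @ u" "''y'' \<noteq> pre @ u" "''z'' \<noteq> pre @ u"
    by metis+
qed (rule fresh)

abbreviation V :: "string \<Rightarrow> aexp" where "V x \<equiv> Var (pre @ x)"
abbreviation R :: "string \<Rightarrow> aexp \<Rightarrow> aexp" where "R x e \<equiv> Read (pre @ x) e"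
abbreviation val :: "state \<Rightarrow> string \<Rightarrow> int" where "val s x \<equiv> var s (pre @ x)"

definition env :: "state \<Rightarrow> bool" where
  "env s \<longleftrightarrow> val s ''n'' = int n \<and> val s ''k'' = int k \<and> val s ''a'' = int a \<and> val s ''b'' = int b \<and>
     val s ''c'' = int c \<and> val s ''d0'' = int d\<^sub>0 \<and> val s ''d1'' = int d\<^sub>1 \<and>
     (\<forall>j. 1 \<le> j \<and> j \<le> n \<longrightarrow> arr s (pre @ ''f'') j = occ_val (int j))"

lemma envD:
  assumes "env s"
  shows "val s ''n'' = int n" "val s ''k'' = int k" "val s ''a'' = int a" "val s ''b'' = int b"
    "val s ''c'' = int c" "val s ''d0'' = int d\<^sub>0" "val s ''d1'' = int d\<^sub>1"
    "1 \<le> j \<Longrightarrow> j \<le> n \<Longrightarrow> arr s (pre @ ''f'') j = occ_val (int j)"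
  using assms by (auto simp: env_def)

definition input_regs :: "vname set" where
  "input_regs = (@) pre ` {''n'', ''k'', ''a'', ''b'', ''c'', ''d0'', ''d1''}"

lemma env_agree: "env s \<Longrightarrow> agree A C s s' \<Longrightarrow> A \<inter> input_regs = {} \<Longrightarrow> pre @ ''f'' \<notin> C \<Longrightarrow> env s'"
  unfolding env_def agree_def input_regs_def by (auto simp: disjoint_iff)

text \<open>The coefficients are those of the expanded \<open>1000 * (n + 2) ^ 3\<close>; a cubic
  bound can thus be checked coefficient by coefficient.\<close>

lemma B_bound:
  assumes "q \<le> 1000 * (n * n * n) + 6000 * (n * n) + 12000 * n + 8000"
  shows "int q \<le> B"
proof -
  have "1000 * (n + 2) ^ 3 = 1000 * (n * n * n) + 6000 * (n * n) + 12000 * n + 8000"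
    by (simp add: power3_eq_cube algebra_simps)
  then have "q \<le> nat B" using assms B_large by linarith
  then show ?thesis using B_ge by (simp add: le_nat_iff)
qed

lemma occ_val_bounds: "\<bar>occ_val j\<bar> \<le> 1" "\<bar>occ_val j\<bar> \<le> B"
  using B_ge by (auto simp: occ_val_def)

section \<open>Counting the hits of one inner cell\<close>

definition clear_prog :: com where
  "clear_prog =
     (pre @ ''j'') ::= Const 0 ;;
     While (V ''j'' [<] Var ''m'')
      (Store ''x'' (V ''j'') (Const 0) ;;
       Store ''y'' (V ''j'') (Const 0) ;;
       (pre @ ''j'') ::= V ''j'' [+] Const 1)"

definition fill_prog :: com where
  "fill_prog =
     (pre @ ''j'') ::= Const 0 ;;
     While (V ''j'' [<] V ''w'')
      (Store ''x'' ((V ''c'' [-] V ''b'') [*] V ''j'')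
         (R ''f'' (V ''a'' [*] V ''d0'' [+] V ''r'' [+] (V ''c'' [-] V ''a'') [*] (V ''X'' [+] V ''j''))) ;;
       Store ''y'' ((V ''b'' [-] V ''a'') [*] V ''j'')
         (R ''f'' (V ''c'' [*] V ''d0'' [+] V ''r'' [+] (V ''c'' [-] V ''a'') [*] (V ''Z'' [+] V ''j''))) ;;
       (pre @ ''j'') ::= V ''j'' [+] Const 1)"

definition gather_prog :: com where
  "gather_prog =
     (pre @ ''j'') ::= Const 0 ;;
     While (V ''j'' [<] V ''mm'')
      ((pre @ ''acc'') ::= V ''acc'' [+] Read ''z'' (V ''j'') [*]
         R ''f'' (V ''b'' [*] V ''d0'' [+] V ''r'' [+] (V ''c'' [-] V ''b'') [*] V ''X'' [+]
           (V ''b'' [-] V ''a'') [*] V ''Z'' [+] V ''j'') ;;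
       (pre @ ''j'') ::= V ''j'' [+] Const 1)"

definition conv_prog :: com where
  "conv_prog =
     (pre @ ''mm'') ::= (V ''w'' [-] Const 1) [*] (V ''c'' [-] V ''a'') [+] Const 1 ;;
     ''m'' ::= V ''mm'' ;;
     clear_prog ;; fill_prog ;; P ;; gather_prog"

lemma clear_prog:
  assumes "var s ''m'' = int m" "int m \<le> B"
  shows "runs W clear_prog s (20 * real m + 10) (\<lambda>s'. agree {pre @ ''j''} {''x'', ''y''} s s' \<and>
    (\<forall>u<m. arr s' ''x'' u = 0 \<and> arr s' ''y'' u = 0))"
  unfolding clear_prog_def
proof (intro runs_assign_seq; (use B_ge in simp; fail)?)
  show "runs W (While (V ''j'' [<] Var ''m'')
      (Store ''x'' (V ''j'') (Const 0) ;; Store ''y'' (V ''j'') (Const 0) ;;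
       (pre @ ''j'') ::= V ''j'' [+] Const 1)) (setv s (pre @ ''j'') (ev s (Const 0)))
     (20 * real m + 10 - real (1 + cost (Const 0)))
     (\<lambda>s'. agree {pre @ ''j''} {''x'', ''y''} s s' \<and> (\<forall>u<m. arr s' ''x'' u = 0 \<and> arr s' ''y'' u = 0))"
  proof (rule runs_for[where \<tau> = 12 and N = m and I = "\<lambda>j s'. agree {pre @ ''j''} {''x'', ''y''} s s' \<and>
      val s' ''j'' = int j \<and> var s' ''m'' = int m \<and>
      (\<forall>u<j. arr s' ''x'' u = 0 \<and> arr s' ''y'' u = 0)"], goal_cases)
    case (4 j s')
    then show ?case
      by (intro straight_line; use assms B_ge in \<open>simp add: less_Suc_eq\<close>)
  qed (use assms in auto)
qed

definition pos_x :: "nat \<Rightarrow> nat \<Rightarrow> nat" where "pos_x r x = a * d\<^sub>0 + r + (c - a) * x"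
definition pos_y :: "nat \<Rightarrow> nat \<Rightarrow> nat \<Rightarrow> nat \<Rightarrow> nat" where
  "pos_y r x z j = b * d\<^sub>0 + r + (c - b) * x + (b - a) * z + j"
definition pos_z :: "nat \<Rightarrow> nat \<Rightarrow> nat" where "pos_z r z = c * d\<^sub>0 + r + (c - a) * z"

lemma int_diffs: "int c - int a = int (c - a)" "int c - int b = int (c - b)" "int b - int a = int (b - a)"
  using ab bc by simp_all

lemma pos_bounds:
  assumes "inside r X Z w" "s < w" "t < w"
  shows "1 \<le> pos_x r (X + s)" "pos_x r (X + s) \<le> n" "1 \<le> pos_z r (Z + t)" "pos_z r (Z + t) \<le> n"
    "1 \<le> pos_y r (X + s) (Z + t) 0" "pos_y r (X + s) (Z + t) 0 \<le> n"
  using poly_pos[OF inside_poly[OF assms] less_k(1)] poly_pos[OF inside_poly[OF assms] less_k(2)]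
    poly_pos[OF inside_poly[OF assms] less_k(3)]
  unfolding positions pos_x_def pos_y_def pos_z_def by linarith+

text \<open>Not every \<open>j\<close> is a combination of the two strides, so some of the positions
  read belong to no point of the cell. They still lie between the middle positions of the corners
  \<open>(X, Z)\<close> and \<open>(X + w - 1, Z + w - 1)\<close>, both in the
  quadrilateral.\<close>

lemma pos_y_gather:
  assumes "inside r X Z w" "0 < w" "j < (w - 1) * (c - a) + 1"
  shows "1 \<le> pos_y r X Z j" "pos_y r X Z j \<le> n"
proof -
  have "(c - b) * (X + (w - 1)) + (b - a) * (Z + (w - 1)) =
      (c - b) * X + (b - a) * Z + ((c - b) + (b - a)) * (w - 1)"
    by (simp only: distrib_left distrib_right)
  then have "pos_y r X Z j \<le> pos_y r (X + (w - 1)) (Z + (w - 1)) 0"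
    using assms(3) ab bc by (simp add: pos_y_def mult.commute)
  then show "pos_y r X Z j \<le> n" using pos_bounds(6)[OF assms(1), of "w - 1" "w - 1"] assms(2) by simp
  show "1 \<le> pos_y r X Z j" using pos_bounds(5)[OF assms(1), of 0 0] assms(2) by (simp add: pos_y_def)
qed

definition cell_regs :: "nat \<Rightarrow> nat \<Rightarrow> nat \<Rightarrow> nat \<Rightarrow> state \<Rightarrow> bool" where
  "cell_regs r X Z w s \<longleftrightarrow> val s ''r'' = int r \<and> val s ''X'' = int X \<and> val s ''Z'' = int Z \<and> val s ''w'' = int w"

text \<open>Invariant of all stacked cells: \<open>5 * n\<close> is the longest convolution covered
  by the locale assumption, and \<open>4 * n + 1\<close> bounds the width of the initial
  square.\<close>

definition in_range :: "nat \<Rightarrow> nat \<Rightarrow> nat \<Rightarrow> nat \<Rightarrow> bool" where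
  "in_range r X Z w \<longleftrightarrow> r \<le> n \<and> 0 < w \<and> X + w \<le> 4 * n + 1 \<and> Z + w \<le> 4 * n + 1 \<and> w * (c - a) \<le> 5 * n \<and> k \<le> n"

lemma in_rangeD:
  assumes "in_range r X Z w"
  shows "int r \<le> B" "int X \<le> B" "int Z \<le> B" "int w \<le> B" "0 < w"
    "(w - 1) * (c - a) + 1 \<le> 5 * n" "w \<le> (w - 1) * (c - a) + 1" "(w - 1) * (c - a) + 1 \<le> w * (c - a)"
proof -
  note rg = assms[unfolded in_range_def]
  show "int r \<le> B" "int X \<le> B" "int Z \<le> B" "int w \<le> B" "0 < w" using rg by (auto intro!: B_bound)
  have "1 \<le> c - a" using ab bc by simp
  then have "(w - 1) * 1 \<le> (w - 1) * (c - a)" by (intro mult_le_mono2)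
  then show "w \<le> (w - 1) * (c - a) + 1" by linarith
  have "w * (c - a) = (w - 1) * (c - a) + (c - a)" using rg by (cases w) auto
  then show "(w - 1) * (c - a) + 1 \<le> w * (c - a)" using \<open>1 \<le> c - a\<close> by linarith
  then show "(w - 1) * (c - a) + 1 \<le> 5 * n" using rg by simp
qed

lemma input_bounds:
  assumes "k \<le> n"
  shows "int n \<le> B" "int k \<le> B" "int a \<le> B" "int b \<le> B" "int c \<le> B" "int d\<^sub>0 \<le> B" "int d\<^sub>1 \<le> B"
    "1 \<le> B" "0 \<le> B"
proof -
  have "d\<^sub>0 \<le> (k + 1) * d\<^sub>0" by simp
  then have "d\<^sub>0 \<le> n" using d_bounds(1) by linarith
  then show "int n \<le> B" "int k \<le> B" "int a \<le> B" "int b \<le> B" "int c \<le> B" "int d\<^sub>0 \<le> B" "int d\<^sub>1 \<le> B"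
    using assms less_k d_bounds(4) by (auto intro!: B_bound)
  show "1 \<le> B" "0 \<le> B" using B_ge by auto
qed

lemma index_simps:
  "(int c - int b) * int j = int ((c - b) * j)"
  "(int b - int a) * int j = int ((b - a) * j)"
  "int a * int d\<^sub>0 + int r + (int c - int a) * (int x + int j) = int (pos_x r (x + j))"
  "int c * int d\<^sub>0 + int r + (int c - int a) * (int z + int j) = int (pos_z r (z + j))"
  "int b * int d\<^sub>0 + int r + (int c - int b) * int x + (int b - int a) * int z + int j = int (pos_y r x z j)"
  unfolding int_diffs by (simp_all add: pos_x_def pos_y_def pos_z_def)

text \<open>The sequence \<open>g 0, ..., g (w - 1)\<close> padded with \<open>p - 1\<close> zeros
  between neighbours. As a function of \<open>w\<close> it also describes the partially filled
  array.\<close>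

definition spread :: "nat \<Rightarrow> nat \<Rightarrow> (nat \<Rightarrow> int) \<Rightarrow> nat \<Rightarrow> int" where
  "spread p w g u = (if p dvd u \<and> u div p < w then g (u div p) else 0)"

lemma spread_0 [simp]: "spread p 0 g u = 0"
  by (simp add: spread_def)

lemma spread_Suc:
  "0 < p \<Longrightarrow> spread p (Suc j) g u = (if u = p * j then g j else spread p j g u)"
  by (auto simp: spread_def less_Suc_eq)

definition f_x :: "nat \<Rightarrow> nat \<Rightarrow> nat \<Rightarrow> int" where "f_x r X t = occ_val (int (pos_x r (X + t)))"
definition f_z :: "nat \<Rightarrow> nat \<Rightarrow> nat \<Rightarrow> int" where "f_z r Z t = occ_val (int (pos_z r (Z + t)))"

lemma fill_prog:
  assumes "env s" "cell_regs r X Z w s" "in_range r X Z w" "inside r X Z w"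
    and "\<forall>u<m. arr s ''x'' u = 0 \<and> arr s ''y'' u = 0"
  shows "runs W fill_prog s (60 * real w + 10) (\<lambda>s'. agree {pre @ ''j''} {''x'', ''y''} s s' \<and>
    (\<forall>u<m. arr s' ''x'' u = spread (c - b) w (f_x r X) u \<and>
      arr s' ''y'' u = spread (b - a) w (f_z r Z) u))"
proof -
  have k: "k \<le> n" using assms(3) by (simp add: in_range_def)
  note bnds = input_bounds[OF k] in_rangeD[OF assms(3)]
  have pq: "0 < c - b" "0 < b - a" using ab bc by auto
  let ?I = "\<lambda>j s'. agree {pre @ ''j''} {''x'', ''y''} s s' \<and> val s' ''j'' = int j \<and>
    (\<forall>u<m. arr s' ''x'' u = spread (c - b) j (f_x r X) u \<and>
      arr s' ''y'' u = spread (b - a) j (f_z r Z) u)"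
  have D: "env s'" "cell_regs r X Z w s'" if "?I j s'" for j s'
  proof -
    show "env s'" using that by (intro env_agree[OF assms(1)]) (auto simp: input_regs_def)
    show "cell_regs r X Z w s'" using that assms(2) by (auto simp: cell_regs_def agree_def)
  qed
  show ?thesis
    unfolding fill_prog_def
  proof (intro runs_assign_seq; (use bnds in simp; fail)?)
    show "runs W (While (V ''j'' [<] V ''w'')
        (Store ''x'' ((V ''c'' [-] V ''b'') [*] V ''j'')
         (R ''f'' (V ''a'' [*] V ''d0'' [+] V ''r'' [+] (V ''c'' [-] V ''a'') [*] (V ''X'' [+] V ''j''))) ;;
       Store ''y'' ((V ''b'' [-] V ''a'') [*] V ''j'')
         (R ''f'' (V ''c'' [*] V ''d0'' [+] V ''r'' [+] (V ''c'' [-] V ''a'') [*] (V ''Z'' [+] V ''j''))) ;;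
       (pre @ ''j'') ::= V ''j'' [+] Const 1)) (setv s (pre @ ''j'') (ev s (Const 0)))
      (60 * real w + 10 - real (1 + cost (Const 0)))
      (\<lambda>s'. agree {pre @ ''j''} {''x'', ''y''} s s' \<and>
        (\<forall>u<m. arr s' ''x'' u = spread (c - b) w (f_x r X) u \<and>
          arr s' ''y'' u = spread (b - a) w (f_z r Z) u))"
    proof (rule runs_for[where \<tau> = 50 and N = w and I = ?I], goal_cases)
      case 1
      then show ?case using assms(5) by simp
    next
      case (2 j s')
      then show ?case using D[OF 2(2)] bnds by (auto simp: cell_regs_def)
    next
      case (4 j s')
      note env = envD[OF D(1)[OF 4(2)]] and regs = D(2)[OF 4(2), unfolded cell_regs_def]
      have j: "int j \<le> B" using 4(1) bnds(13) by linarith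
      note pos = pos_bounds[OF assms(4) 4(1) 4(1)]
      have vj: "val s' ''j'' = int j" and agr: "agree {pre @ ''j''} {''x'', ''y''} s s'"
        and arr: "\<And>u. u < m \<Longrightarrow> arr s' ''x'' u = spread (c - b) j (f_x r X) u"
          "\<And>u. u < m \<Longrightarrow> arr s' ''y'' u = spread (b - a) j (f_z r Z) u"
        using 4(2) by auto
      have fx: "arr s' (pre @ ''f'') (pos_x r (X + j)) = f_x r X j"
        "arr s' (pre @ ''f'') (pos_z r (Z + j)) = f_z r Z j"
        "\<bar>f_x r X j\<bar> \<le> B" "\<bar>f_z r Z j\<bar> \<le> B"
        using pos env(8) occ_val_bounds by (auto simp: f_x_def f_z_def)
      show ?case
        by (intro straight_line)
          (simp_all add: env regs bnds j index_simps vj agr arr fx spread_Suc ab bc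
            del: of_nat_mult of_nat_add)
    qed (use D bnds in auto)
  qed
qed

lemma gather_prog:
  assumes "env s" "cell_regs r X Z w s" "in_range r X Z w" "inside r X Z w"
    and m: "m = (w - 1) * (c - a) + 1" and "val s ''mm'' = int m"
    and z: "\<forall>j<m. \<bar>arr s ''z'' j\<bar> \<le> int m" and acc: "0 \<le> val s ''acc''" "val s ''acc'' \<le> int (n * (4 * n + 1) * (4 * n + 1))"
  shows "runs W gather_prog s (60 * real m + 10) (\<lambda>s'. agree {pre @ ''j'', pre @ ''acc''} {} s s' \<and>
    val s' ''acc'' = val s ''acc'' + (\<Sum>j<m. arr s ''z'' j * occ_val (int (pos_y r X Z j))))"
proof -
  have k: "k \<le> n" using assms(3) by (simp add: in_range_def)
  note bnds = input_bounds[OF k] in_rangeD[OF assms(3)]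
  have m5: "m \<le> 5 * n" using bnds m by simp
  then have mB: "int m \<le> B" by (intro B_bound) simp
  let ?I = "\<lambda>j s'. agree {pre @ ''j'', pre @ ''acc''} {} s s' \<and> val s' ''j'' = int j \<and>
    val s' ''acc'' = val s ''acc'' + (\<Sum>i<j. arr s ''z'' i * occ_val (int (pos_y r X Z i)))"
  have D: "env s'" "cell_regs r X Z w s'" "val s' ''mm'' = int m" "arr s' ''z'' = arr s ''z''" if "?I j s'" for j s'
  proof -
    show "env s'" using that by (intro env_agree[OF assms(1)]) (auto simp: input_regs_def)
    show "cell_regs r X Z w s'" "val s' ''mm'' = int m" "arr s' ''z'' = arr s ''z''"
      using that assms(2,6) by (auto simp: cell_regs_def agree_def)
  qed
  \<comment> \<open>The earlier total is at most \<open>n\<close> residues times the area of a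
    square of width \<open>4 * n + 1\<close>; the present cell adds at most \<open>m\<close>
    products, each bounded by \<open>m\<close>.\<close>
  have accB: "\<bar>val s ''acc'' + (\<Sum>i<j. arr s ''z'' i * occ_val (int (pos_y r X Z i)))\<bar> \<le> B" if "j \<le> m" for j
  proof -
    have "\<bar>\<Sum>i<j. arr s ''z'' i * occ_val (int (pos_y r X Z i))\<bar> \<le> (\<Sum>i<j. int m)"
      using z that by (intro order_trans[OF sum_abs] sum_mono) (auto simp: occ_val_def)
    also have "\<dots> \<le> int (m * m)" using that by (simp add: mult_right_mono)
    also have "\<dots> \<le> int ((5 * n) * (5 * n))" using m5 by (intro of_nat_mono mult_le_mono)
    finally have "\<bar>val s ''acc'' + (\<Sum>i<j. arr s ''z'' i * occ_val (int (pos_y r X Z i)))\<bar> \<le>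
        int (n * (4 * n + 1) * (4 * n + 1) + (5 * n) * (5 * n))" using acc by linarith
    also have "\<dots> \<le> B" by (rule B_bound) (simp add: algebra_simps)
    finally show ?thesis .
  qed
  show ?thesis
    unfolding gather_prog_def
  proof (intro runs_assign_seq; (use bnds in simp; fail)?)
    show "runs W (While (V ''j'' [<] V ''mm'')
      ((pre @ ''acc'') ::= V ''acc'' [+] Read ''z'' (V ''j'') [*]
         R ''f'' (V ''b'' [*] V ''d0'' [+] V ''r'' [+] (V ''c'' [-] V ''b'') [*] V ''X'' [+]
           (V ''b'' [-] V ''a'') [*] V ''Z'' [+] V ''j'') ;;
       (pre @ ''j'') ::= V ''j'' [+] Const 1)) (setv s (pre @ ''j'') (ev s (Const 0)))
      (60 * real m + 10 - real (1 + cost (Const 0)))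
      (\<lambda>s'. agree {pre @ ''j'', pre @ ''acc''} {} s s' \<and>
        val s' ''acc'' = val s ''acc'' + (\<Sum>j<m. arr s ''z'' j * occ_val (int (pos_y r X Z j))))"
    proof (rule runs_for[where \<tau> = 50 and N = m and I = ?I], goal_cases)
      case (2 j s')
      have "int j \<le> B" using 2(1) mB by linarith
      then show ?case using D[OF 2(2)] 2(2) mB by auto
    next
      case (4 j s')
      note env = envD[OF D(1)[OF 4(2)]] and regs = D(2)[OF 4(2), unfolded cell_regs_def] and zz = D(4)[OF 4(2)]
      have vj: "val s' ''j'' = int j" and agr: "agree {pre @ ''j'', pre @ ''acc''} {} s s'"
        and va: "val s' ''acc'' = val s ''acc'' + (\<Sum>i<j. arr s ''z'' i * occ_val (int (pos_y r X Z i)))"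
        using 4(2) by auto
      have j: "int j \<le> B" "\<bar>arr s ''z'' j\<bar> \<le> B" using 4(1) mB z by (fastforce, fastforce)
      have fy: "arr s' (pre @ ''f'') (pos_y r X Z j) = occ_val (int (pos_y r X Z j))"
        using pos_y_gather[OF assms(4)] 4(1) m bnds(14) env(8) by simp
      show ?case
        by (intro straight_line)
          (simp_all add: env regs bnds j index_simps(5) vj agr va fy zz occ_val_bounds accB 4(1)[THEN less_imp_le]
            del: of_nat_mult of_nat_add)
    qed (use bnds in auto)
  qed
qed

text \<open>The time is charged to \<open>w * (c - a)\<close>, the unit in which the quadtree is
  accounted: \<open>m\<close> is at most this product, and filling, which takes time
  \<open>w\<close>, is covered by \<open>w <= m\<close>.\<close>

lemma conv_prog:
  assumes "env s" "cell_regs r X Z w s" "in_range r X Z w" "inside r X Z w"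
    and acc: "0 \<le> val s ''acc''" "val s ''acc'' \<le> int (n * (4 * n + 1) * (4 * n + 1))"
  shows "runs W conv_prog s ((200 + \<kappa>) * real (w * (c - a))) (\<lambda>s'.
    agree ({pre @ ''mm'', pre @ ''j'', pre @ ''acc'', ''m''} \<union> writes P) ({''x'', ''y''} \<union> writes P) s s' \<and>
    val s' ''acc'' = val s ''acc'' + weight r X Z w)"
proof -
  have k: "k \<le> n" using assms(3) by (simp add: in_range_def)
  note bnds = input_bounds[OF k] in_rangeD[OF assms(3)]
  define m where "m = (w - 1) * (c - a) + 1"
  have m: "0 < m" "m \<le> 5 * n" "w \<le> m" "m \<le> w * (c - a)" using bnds by (simp_all add: m_def)
  then have mB: "int m \<le> B" by (intro B_bound) simp
  define A where "A = {pre @ ''mm'', pre @ ''j'', pre @ ''acc'', ''m''} \<union> writes P"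
  define C where "C = {''x'', ''y''} \<union> writes P"
  have trans: "agree A C s t'" if "agree A C s t" "agree A' C' t t'" "A' \<subseteq> A" "C' \<subseteq> C" for t t' A' C'
    using agree_trans[OF that(1,2)] that(3,4) by blast
  have keep: "env t" "cell_regs r X Z w t" if "agree A C s t" for t
  proof -
    show "env t" using that by (intro env_agree[OF assms(1)]) (auto simp: input_regs_def A_def C_def)
    show "cell_regs r X Z w t" using that assms(2) by (auto simp: cell_regs_def agree_def A_def)
  qed
  have mm: "int m = (int w - 1) * (int c - int a) + 1"
    using bnds(14) ab bc by (simp add: m_def of_nat_diff)
  let ?s = "setv (setv s (pre @ ''mm'') (int m)) ''m'' (int m)"
  have s0: "agree A C s ?s" "var ?s ''m'' = int m" "val ?s ''mm'' = int m" "val ?s ''acc'' = val s ''acc''"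
    by (simp_all add: A_def)
  have rest: "runs W (clear_prog ;; fill_prog ;; P ;; gather_prog) ?s ((180 + \<kappa>) * real m)
      (\<lambda>s'. agree A C s s' \<and> val s' ''acc'' = val s ''acc'' + weight r X Z w)"
  proof (rule runs_call[OF clear_prog[OF s0(2) mB]], elim conjE)
    fix s\<^sub>1 assume a1: "agree {pre @ ''j''} {''x'', ''y''} ?s s\<^sub>1" and z1: "\<forall>u<m. arr s\<^sub>1 ''x'' u = 0 \<and> arr s\<^sub>1 ''y'' u = 0"
    have s1: "agree A C s s\<^sub>1" by (rule trans[OF s0(1) a1]) (auto simp: A_def C_def)
    show "runs W (fill_prog ;; P ;; gather_prog) s\<^sub>1 ((180 + \<kappa>) * real m - (20 * real m + 10))
      (\<lambda>s'. agree A C s s' \<and> val s' ''acc'' = val s ''acc'' + weight r X Z w)"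
    proof (rule runs_call[OF fill_prog[OF keep[OF s1] assms(3,4) z1]], elim conjE)
      fix s\<^sub>2 assume a2: "agree {pre @ ''j''} {''x'', ''y''} s\<^sub>1 s\<^sub>2"
        and xy: "\<forall>u<m. arr s\<^sub>2 ''x'' u = spread (c - b) w (f_x r X) u \<and> arr s\<^sub>2 ''y'' u = spread (b - a) w (f_z r Z) u"
      have s2: "agree A C s s\<^sub>2" by (rule trans[OF s1 a2]) (auto simp: A_def C_def)
      have m2: "var s\<^sub>2 ''m'' = int m" "val s\<^sub>2 ''mm'' = int m" "val s\<^sub>2 ''acc'' = val s ''acc''"
        using a1 a2 s0 by (auto simp: agree_def)
      define xs where "xs = map (spread (c - b) w (f_x r X)) [0..<m]"
      define ys where "ys = map (spread (b - a) w (f_z r Z)) [0..<m]"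
      have len: "length xs = m" "length ys = m" by (simp_all add: xs_def ys_def)
      have le1: "\<forall>v \<in> set xs \<union> set ys. \<bar>v\<bar> \<le> 1"
        using occ_val_bounds by (auto simp: xs_def ys_def spread_def f_x_def f_z_def)
      have hold: "holds_array s\<^sub>2 ''x'' xs" "holds_array s\<^sub>2 ''y'' ys"
        using xy by (auto simp: holds_array_def xs_def ys_def)
      show "runs W (P ;; gather_prog) s\<^sub>2 ((180 + \<kappa>) * real m - (20 * real m + 10) - (60 * real w + 10))
        (\<lambda>s'. agree A C s s' \<and> val s' ''acc'' = val s ''acc'' + weight r X Z w)"
      proof (rule runs_call[OF runs_agree[OF conv[OF m(1,2) len le1 m2(1) hold]]], elim conjE)
        fix s\<^sub>3 assume z3: "\<forall>j<2 * m - 1. arr s\<^sub>3 ''z'' j = acyclic_conv xs ys j"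
          and a3: "agree (writes P) (writes P) s\<^sub>2 s\<^sub>3"
        have s3: "agree A C s s\<^sub>3" by (rule trans[OF s2 a3]) (auto simp: A_def C_def)
        have m3: "val s\<^sub>3 ''mm'' = int m" "val s\<^sub>3 ''acc'' = val s ''acc''"
          using a3 m2 by (simp_all add: agree_def)
        have z: "arr s\<^sub>3 ''z'' j = acyclic_conv xs ys j" if "j < m" for j using z3 that by simp
        have zle: "\<forall>j<m. \<bar>arr s\<^sub>3 ''z'' j\<bar> \<le> int m"
          using abs_acyclic_conv_le[OF le1] len z by simp
        have w: "(\<Sum>j<m. arr s\<^sub>3 ''z'' j * occ_val (int (pos_y r X Z j))) = weight r X Z w"
        proof -
          have "(\<Sum>j<m. acyclic_conv xs ys j * occ_val (int (pos_y r X Z j))) = weight r X Z w"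
            unfolding pos_y_def
            by (rule weight_conv[OF assms(4) bnds(14) m_def len])
              (simp_all add: xs_def ys_def spread_def f_x_def f_z_def pos_x_def pos_z_def)
          then show ?thesis by (simp add: z)
        qed
        note gather_prog[OF keep[OF s3] assms(3,4) m_def m3(1) zle, unfolded m3(2) w, OF acc]
        then show "runs W gather_prog s\<^sub>3
          ((180 + \<kappa>) * real m - (20 * real m + 10) - (60 * real w + 10) - \<kappa> * real m)
          (\<lambda>s'. agree A C s s' \<and> val s' ''acc'' = val s ''acc'' + weight r X Z w)"
        proof (rule runs_mono)
          have "real w \<le> real m" "1 \<le> real m" using m by simp_all
          then show "60 * real m + 10 \<le> (180 + \<kappa>) * real m - (20 * real m + 10) - (60 * real w + 10) - \<kappa> * real m"
            by (simp add: distrib_right)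
        next
          fix t assume "agree {pre @ ''j'', pre @ ''acc''} {} s\<^sub>3 t \<and> val t ''acc'' = val s ''acc'' + weight r X Z w"
          then show "agree A C s t \<and> val t ''acc'' = val s ''acc'' + weight r X Z w"
            using trans[OF s3, of "{pre @ ''j'', pre @ ''acc''}" "{}" t] by (auto simp: A_def)
        qed
      qed
    qed
  qed
  have cost: "(180 + \<kappa>) * real m + 20 \<le> (200 + \<kappa>) * real (w * (c - a))"
  proof -
    have "(180 + \<kappa>) * real m + 20 \<le> (200 + \<kappa>) * real m" using m(1) by (simp add: algebra_simps)
    also have "\<dots> \<le> (200 + \<kappa>) * real (w * (c - a))" using \<kappa>_ge of_nat_mono[OF m(4), where 'a = real] by (intro mult_left_mono) auto
    finally show ?thesis .
  qed
  note env = envD[OF assms(1)] and regs = assms(2)[unfolded cell_regs_def]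
  show ?thesis
    unfolding conv_prog_def
  proof (intro runs_assign_seq; (use bnds env regs mB in \<open>simp add: mm[symmetric]\<close>; fail)?)
    show "runs W (clear_prog ;; fill_prog ;; P ;; gather_prog)
      (setv (setv s (pre @ ''mm'') (ev s ((V ''w'' [-] Const 1) [*] (V ''c'' [-] V ''a'') [+] Const 1))) ''m''
        (ev (setv s (pre @ ''mm'') (ev s ((V ''w'' [-] Const 1) [*] (V ''c'' [-] V ''a'') [+] Const 1))) (V ''mm'')))
      ((200 + \<kappa>) * real (w * (c - a)) - real (1 + cost ((V ''w'' [-] Const 1) [*] (V ''c'' [-] V ''a'') [+] Const 1)) -
        real (1 + cost (V ''mm'')))
      (\<lambda>s'. agree ({pre @ ''mm'', pre @ ''j'', pre @ ''acc'', ''m''} \<union> writes P) ({''x'', ''y''} \<union> writes P) s s' \<and>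
        val s' ''acc'' = val s ''acc'' + weight r X Z w)"
      using runs_mono[OF rest] cost env regs unfolding A_def C_def
      by (simp add: mm[symmetric])
  qed
qed

section \<open>Processing one cell and running through the stack\<close>

definition push_cell :: "aexp \<Rightarrow> aexp \<Rightarrow> com" where
  "push_cell ex ez =
     Store (pre @ ''SX'') (V ''top'') ex ;;
     Store (pre @ ''SZ'') (V ''top'') ez ;;
     Store (pre @ ''SW'') (V ''top'') (V ''w'') ;;
     (pre @ ''top'') ::= V ''top'' [+] Const 1"

definition push_prog :: com where
  "push_prog =
     (pre @ ''w'') ::= Bin Div (V ''w'') (Const 2) ;;
     push_cell (V ''X'') (V ''Z'') ;;
     push_cell (V ''X'' [+] V ''w'') (V ''Z'') ;;
     push_cell (V ''X'') (V ''Z'' [+] V ''w'') ;;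
     push_cell (V ''X'' [+] V ''w'') (V ''Z'' [+] V ''w'')"

definition cell_prog :: com where
  "cell_prog =
     (pre @ ''top'') ::= V ''top'' [-] Const 1 ;;
     (pre @ ''X'') ::= R ''SX'' (V ''top'') ;;
     (pre @ ''Z'') ::= R ''SZ'' (V ''top'') ;;
     (pre @ ''w'') ::= R ''SW'' (V ''top'') ;;
     (pre @ ''i1'') ::= V ''r'' [+] V ''c'' [*] V ''X'' [-] V ''a'' [*] (V ''Z'' [+] V ''w'' [-] Const 1) ;;
     (pre @ ''e1'') ::= V ''d0'' [+] (V ''Z'' [+] V ''w'' [-] Const 1) [-] V ''X'' ;;
     (pre @ ''i2'') ::= V ''r'' [+] V ''c'' [*] (V ''X'' [+] V ''w'' [-] Const 1) [-] V ''a'' [*] V ''Z'' ;;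
     (pre @ ''e2'') ::= V ''d0'' [+] V ''Z'' [-] (V ''X'' [+] V ''w'' [-] Const 1) ;;
     If ((Const 0 [<] V ''i1'') [*] (V ''i1'' [+] (V ''k'' [-] Const 1) [*] V ''e1'' [<=] V ''n'') [*]
         (V ''i2'' [<=] V ''e2'') [*] (V ''n'' [<] V ''i2'' [+] V ''k'' [*] V ''e2''))
      conv_prog
      (If ((Const 0 [<] V ''i2'') [*] (V ''i2'' [+] (V ''k'' [-] Const 1) [*] V ''e2'' [<=] V ''n'') [*]
           (V ''i1'' [<=] V ''e1'') [*] (V ''n'' [<] V ''i1'' [+] V ''k'' [*] V ''e1''))
        push_prog Skip)"

type_synonym cell = "nat \<times> nat \<times> nat"

definition stack_holds :: "cell list \<Rightarrow> state \<Rightarrow> bool" where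
  "stack_holds cs s \<longleftrightarrow> val s ''top'' = int (length cs) \<and>
     (\<forall>j<length cs. case cs ! j of (X, Z, l) \<Rightarrow> arr s (pre @ ''SX'') j = int X \<and>
        arr s (pre @ ''SZ'') j = int Z \<and> arr s (pre @ ''SW'') j = 2 ^ l)"

definition cell_weight :: "nat \<Rightarrow> cell \<Rightarrow> int" where
  "cell_weight r = (\<lambda>(X, Z, l). weight r X Z (2 ^ l))"

definition cell_visits :: "nat \<Rightarrow> cell \<Rightarrow> nat" where
  "cell_visits r = (\<lambda>(X, Z, l). visits r l X Z)"

definition children :: "nat \<Rightarrow> cell \<Rightarrow> cell list" where
  "children r = (\<lambda>(X, Z, l). if crossing r X Z (2 ^ l)
     then let w = 2 ^ (l - 1) in [(X, Z, l - 1), (X + w, Z, l - 1), (X, Z + w, l - 1), (X + w, Z + w, l - 1)]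
     else [])"

text \<open>Guarantees that the truncated \<open>l - 1\<close> in \<open>children\<close> is a true
  predecessor.\<close>

lemma crossing_level: "crossing r X Z (2 ^ l) \<Longrightarrow> 0 < l"
  using not_crossing_1 by (cases l) auto

text \<open>Replacing a cell by its children lowers the total of \<open>visits\<close> by exactly
  the width of the cell; this difference pays for processing it.\<close>

lemma visits_children:
  "sum_list (map (cell_visits r) (children r (X, Z, l))) + 2 ^ l = visits r l X Z"
proof (cases l)
  case 0
  then show ?thesis using not_crossing_1 by (simp add: children_def)
qed (simp add: children_def cell_visits_def Let_def)

text \<open>Keeps the accumulator plus the weight of the stacked cells constant: an inner cell moves
  its weight to the accumulator, an outer one has none, a crossing one passes it on to its
  quarters.\<close>

lemma weight_children:
  "(if inside r X Z (2 ^ l) then weight r X Z (2 ^ l) else 0) +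
     sum_list (map (cell_weight r) (children r (X, Z, l))) = weight r X Z (2 ^ l)"
proof (cases "crossing r X Z (2 ^ l)")
  case True
  then obtain l' where l: "l = Suc l'" using crossing_level gr0_conv_Suc by blast
  have "\<not> inside r X Z (2 ^ l)" using True by (simp add: crossing_def)
  moreover have "2 ^ l = 2 ^ l' + (2 ^ l' :: nat)" by (simp add: l)
  then have "weight r X Z (2 ^ l) = weight r X Z (2 ^ l') + weight r (X + 2 ^ l') Z (2 ^ l') +
      weight r X (Z + 2 ^ l') (2 ^ l') + weight r (X + 2 ^ l') (Z + 2 ^ l') (2 ^ l')"
    by (simp only: weight_split)
  ultimately show ?thesis using True by (simp add: children_def cell_weight_def l Let_def)
next
  case False
  then show ?thesis using outside_weight by (auto simp: children_def crossing_def)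
qed

lemma stack_holds_append:
  "stack_holds (cs @ ds) s \<longleftrightarrow> val s ''top'' = int (length cs + length ds) \<and>
     (\<forall>j<length cs. case cs ! j of (X, Z, l) \<Rightarrow> arr s (pre @ ''SX'') j = int X \<and>
        arr s (pre @ ''SZ'') j = int Z \<and> arr s (pre @ ''SW'') j = 2 ^ l) \<and>
     (\<forall>j<length ds. case ds ! j of (X, Z, l) \<Rightarrow> arr s (pre @ ''SX'') (length cs + j) = int X \<and>
        arr s (pre @ ''SZ'') (length cs + j) = int Z \<and> arr s (pre @ ''SW'') (length cs + j) = 2 ^ l)"
proof -
  have split: "(\<forall>j<p + q. Q j) \<longleftrightarrow> (\<forall>j<p. Q j) \<and> (\<forall>j<q. Q (p + j))" for p q :: nat and Q
    by (metis add_less_cancel_left le_Suc_ex not_le trans_less_add1)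
  show ?thesis
    unfolding stack_holds_def length_append split by (simp add: nth_append)
qed

text \<open>The second coordinate is evaluated after the first store, hence its value and bound are
  also required for states with a modified array \<open>SX\<close>.\<close>

lemma push_cell:
  assumes "stack_holds cs s" and ex: "bounded B s ex" "leaves ex \<le> 32" "ev s ex = int X" "cost ex \<le> 3"
    and ez: "bounded B s ez" "leaves ez \<le> 32" "ev s ez = int Z" "cost ez \<le> 3"
    and ez': "\<And>v. bounded B (seta s (pre @ ''SX'') (length cs) v) ez"
      "\<And>v. ev (seta s (pre @ ''SX'') (length cs) v) ez = int Z"
    and w: "val s ''w'' = 2 ^ l" "2 ^ l \<le> B" and len: "int (length cs) + 1 \<le> B"
  shows "runs W (push_cell ex ez) s 30 (\<lambda>s'. agree {pre @ ''top''} {pre @ ''SX'', pre @ ''SZ'', pre @ ''SW''} s s' \<and>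
    stack_holds (cs @ [(X, Z, l)]) s')"
proof -
  have top: "val s ''top'' = int (length cs)"
    and old: "\<And>j. j < length cs \<Longrightarrow> case cs ! j of (X, Z, l) \<Rightarrow> arr s (pre @ ''SX'') j = int X \<and>
        arr s (pre @ ''SZ'') j = int Z \<and> arr s (pre @ ''SW'') j = 2 ^ l"
    using assms(1) by (auto simp: stack_holds_def)
  have B: "int (length cs) \<le> B" "1 \<le> B" using len B_ge by linarith+
  show ?thesis
    unfolding push_cell_def
    apply (intro straight_line)
    using old ex ez w B apply (simp_all add: top ez' stack_holds_append)
    done
qed

lemma push_prog:
  assumes "stack_holds cs s" "cell_regs r X Z (2 ^ l) s" "crossing r X Z (2 ^ l)" "in_range r X Z (2 ^ l)"
    and len: "int (length cs) + 4 \<le> B"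
  shows "runs W push_prog s 150 (\<lambda>s'. agree {pre @ ''top'', pre @ ''w''} {pre @ ''SX'', pre @ ''SZ'', pre @ ''SW''} s s' \<and>
    stack_holds (cs @ children r (X, Z, l)) s')"
proof -
  obtain l' where l: "l = Suc l'" using crossing_level[OF assms(3)] gr0_conv_Suc by blast
  have ch: "children r (X, Z, l) =
      [(X, Z, l'), (X + 2 ^ l', Z, l'), (X, Z + 2 ^ l', l'), (X + 2 ^ l', Z + 2 ^ l', l')]"
    using assms(3) by (simp add: children_def Let_def l)
  have half: "2 ^ l div 2 = (2 ^ l' :: int)" by (simp add: l)
  have regs: "val s ''X'' = int X" "val s ''Z'' = int Z" "val s ''w'' = 2 ^ l"
    using assms(2) by (auto simp: cell_regs_def)
  have k: "k \<le> n" using assms(4) by (simp add: in_range_def)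
  note bnds = input_bounds(8,9)[OF k] in_rangeD(1-3)[OF assms(4)] B_ge
  have wB: "(2::int) ^ l \<le> B" using in_rangeD(4)[OF assms(4)] by simp
  have wB': "(2::int) ^ l' \<le> B" by (rule order_trans[OF _ wB]) (simp add: l)
  let ?st = "\<lambda>s' cs. agree {pre @ ''top'', pre @ ''w''} {pre @ ''SX'', pre @ ''SZ'', pre @ ''SW''} s s' \<and>
    val s' ''w'' = 2 ^ l' \<and> stack_holds cs s'"
  have one: "runs W (push_cell ex ez) s' 30 (\<lambda>t. ?st t (ds @ [(X', Z', l')]))"
    if st: "?st s' ds" and len: "int (length ds) + 1 \<le> B"
      and ex: "ex = V ''X'' \<and> X' = X \<or> ex = V ''X'' [+] V ''w'' \<and> X' = X + 2 ^ l'"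
      and ez: "ez = V ''Z'' \<and> Z' = Z \<or> ez = V ''Z'' [+] V ''w'' \<and> Z' = Z + 2 ^ l'"
    for ex ez X' Z' s' ds
  proof (rule runs_mono[OF push_cell[where l = l']])
    have r': "val s' ''X'' = int X" "val s' ''Z'' = int Z" "val s' ''w'' = 2 ^ l'"
      using st regs by (auto simp: agree_def)
    show "stack_holds ds s'" "val s' ''w'' = 2 ^ l'" using st by auto
    show "bounded B s' ex" "leaves ex \<le> 32" "ev s' ex = int X'" "cost ex \<le> 3"
      using ex r' bnds wB' by auto
    show "bounded B s' ez" "leaves ez \<le> 32" "ev s' ez = int Z'" "cost ez \<le> 3"
      "\<And>v. bounded B (seta s' (pre @ ''SX'') (length ds) v) ez"
      "\<And>v. ev (seta s' (pre @ ''SX'') (length ds) v) ez = int Z'"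
      using ez r' bnds wB' by auto
    fix t assume t: "agree {pre @ ''top''} {pre @ ''SX'', pre @ ''SZ'', pre @ ''SW''} s' t \<and>
      stack_holds (ds @ [(X', Z', l')]) t"
    have "agree {pre @ ''top'', pre @ ''w''} {pre @ ''SX'', pre @ ''SZ'', pre @ ''SW''} s t"
      by (rule agree_trans[OF st[THEN conjunct1] t[THEN conjunct1]]) auto
    then show "?st t (ds @ [(X', Z', l')])" using t r' by (simp add: agree_def)
  qed (use wB' len in auto)
  show ?thesis
    unfolding push_prog_def
    apply (intro runs_assign_seq)
      apply (use bnds wB regs in simp)
     apply simp
    apply (rule runs_call[OF one[of _ cs "V ''X''" X "V ''Z''" Z]])
        apply (use assms(1) regs half len in \<open>auto simp: stack_holds_def\<close>)[4]
    apply (rule runs_call[OF one[of _ _ "V ''X'' [+] V ''w''" "X + 2 ^ l'" "V ''Z''" Z]], assumption)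
       apply (use len in auto)[3]
    apply (rule runs_call[OF one[of _ _ "V ''X''" X "V ''Z'' [+] V ''w''" "Z + 2 ^ l'"]], assumption)
       apply (use len in auto)[3]
    apply (rule runs_mono[OF one[of _ _ "V ''X'' [+] V ''w''" "X + 2 ^ l'" "V ''Z'' [+] V ''w''" "Z + 2 ^ l'"]], assumption)
        apply (use len in auto)[3]
     apply simp
    apply (simp add: ch)
    done
qed

lemma in_range_children:
  assumes "in_range r X Z (2 ^ l)" "(X', Z', l') \<in> set (children r (X, Z, l))"
  shows "in_range r X' Z' (2 ^ l')"
proof -
  have c: "crossing r X Z (2 ^ l)" using assms(2) by (auto simp: children_def split: if_splits)
  then obtain m where l: "l = Suc m" using crossing_level gr0_conv_Suc by blast
  have *: "l' = m" "X' + 2 ^ m \<le> X + 2 ^ l" "Z' + 2 ^ m \<le> Z + 2 ^ l"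
    using assms(2) c by (auto simp: children_def Let_def l)
  have "2 ^ m * (c - a) \<le> 2 ^ l * (c - a)" by (rule mult_le_mono1) (simp add: l)
  then have "2 ^ m * (c - a) \<le> 5 * n" using assms(1) unfolding in_range_def by linarith
  then show ?thesis using assms(1) * unfolding in_range_def by auto
qed

lemma area_children: "(\<Sum>(X, Z, l)\<leftarrow>children r (X, Z, l). 4 ^ l) \<le> (4 ^ l :: nat)"
proof (cases "crossing r X Z (2 ^ l)")
  case True
  then obtain m where "l = Suc m" using crossing_level gr0_conv_Suc by blast
  then show ?thesis by (simp add: children_def Let_def)
qed (simp add: children_def)

lemma corner_values:
  assumes "in_range r X Z w" "int w = v"
  shows "int r + int c * int X - int a * (int Z + v - 1) = i_at r X (Z + w - 1)"
    "int d\<^sub>0 + (int Z + v - 1) - int X = d_at X (Z + w - 1)"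
    "int r + int c * (int X + v - 1) - int a * int Z = i_at r (X + w - 1) Z"
    "int d\<^sub>0 + int Z - (int X + v - 1) = d_at (X + w - 1) Z"
    "\<bar>i_at r X (Z + w - 1)\<bar> \<le> B" "\<bar>d_at X (Z + w - 1)\<bar> \<le> B"
    "\<bar>i_at r (X + w - 1) Z\<bar> \<le> B" "\<bar>d_at (X + w - 1) Z\<bar> \<le> B"
proof -
  have rg: "r \<le> n" "0 < w" "X + w \<le> 4 * n + 1" "Z + w \<le> 4 * n + 1" "k \<le> n"
    using assms(1) by (auto simp: in_range_def)
  then have "int (Z + w - 1) = int Z + v - 1" "int (X + w - 1) = int X + v - 1"
    using assms(2) by (simp_all add: of_nat_diff)
  then show "int r + int c * int X - int a * (int Z + v - 1) = i_at r X (Z + w - 1)"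
    "int d\<^sub>0 + (int Z + v - 1) - int X = d_at X (Z + w - 1)"
    "int r + int c * (int X + v - 1) - int a * int Z = i_at r (X + w - 1) Z"
    "int d\<^sub>0 + int Z - (int X + v - 1) = d_at (X + w - 1) Z"
    unfolding i_at_def d_at_def by simp_all
  have i: "\<bar>i_at r x z\<bar> \<le> B" if "x \<le> 4 * n" "z \<le> 4 * n" for x z
  proof -
    have "r + c * x \<le> n + n * (4 * n)" "a * z \<le> n * (4 * n)"
      using that rg less_k by (auto intro!: add_mono mult_le_mono)
    moreover have "int (n + n * (4 * n)) \<le> B" "int (n * (4 * n)) \<le> B" by (intro B_bound; simp)+
    ultimately have "int (r + c * x) \<le> B" "int (a * z) \<le> B" by linarith+
    then have "int r + int c * int x \<le> B" "int a * int z \<le> B" by simp_all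
    moreover have "0 \<le> int r + int c * int x" "0 \<le> int a * int z" by simp_all
    ultimately show ?thesis unfolding i_at_def by linarith
  qed
  have d: "\<bar>d_at x z\<bar> \<le> B" if "x \<le> 4 * n" "z \<le> 4 * n" for x z
  proof -
    have "d\<^sub>0 \<le> (k + 1) * d\<^sub>0" by simp
    then have "d\<^sub>0 \<le> n" using d_bounds(1) by linarith
    moreover have "int (5 * n) \<le> B" by (intro B_bound) simp
    ultimately show ?thesis using that unfolding d_at_def by linarith
  qed
  show "\<bar>i_at r X (Z + w - 1)\<bar> \<le> B" "\<bar>d_at X (Z + w - 1)\<bar> \<le> B"
    "\<bar>i_at r (X + w - 1) Z\<bar> \<le> B" "\<bar>d_at (X + w - 1) Z\<bar> \<le> B"
    using rg by (auto intro!: i d)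
qed

definition scratch :: "vname set" where
  "scratch = (@) pre ` {''top'', ''X'', ''Z'', ''w'', ''i1'', ''e1'', ''i2'', ''e2'', ''mm'', ''j'', ''acc''}
     \<union> {''m''} \<union> writes P"

definition scratch_arrays :: "vname set" where
  "scratch_arrays = (@) pre ` {''SX'', ''SZ'', ''SW''} \<union> {''x'', ''y''} \<union> writes P"

lemma cell_prog:
  assumes "env s" "val s ''r'' = int r" "stack_holds (cs @ [(X, Z, l)]) s" "in_range r X Z (2 ^ l)"
    and len: "int (length cs) + 4 \<le> B"
    and acc: "0 \<le> val s ''acc''" "val s ''acc'' \<le> int (n * (4 * n + 1) * (4 * n + 1))"
  shows "runs W cell_prog s ((600 + \<kappa>) * real (2 ^ l * (c - a))) (\<lambda>s'. agree scratch scratch_arrays s s' \<and>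
    stack_holds (cs @ children r (X, Z, l)) s' \<and>
    val s' ''acc'' = val s ''acc'' + (if inside r X Z (2 ^ l) then weight r X Z (2 ^ l) else 0))"
proof -
  have k: "k \<le> n" using assms(4) by (simp add: in_range_def)
  note bnds = input_bounds[OF k] in_rangeD(1-3)[OF assms(4)]
  have w: "int (2 ^ l) = 2 ^ l" by simp
  note cv = corner_values[OF assms(4) w]
  have wB: "(2::int) ^ l \<le> B" using in_rangeD(4)[OF assms(4)] by simp
  have lenB: "int (length cs) \<le> B" "int (length cs) + 1 \<le> B" using len by linarith+
  note env = envD[OF assms(1)]
  have top: "val s ''top'' = int (length cs) + 1" "arr s (pre @ ''SX'') (length cs) = int X"
     "arr s (pre @ ''SZ'') (length cs) = int Z" "arr s (pre @ ''SW'') (length cs) = 2 ^ l"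
    and st: "\<And>j. j < length cs \<Longrightarrow> case cs ! j of (X, Z, l) \<Rightarrow> arr s (pre @ ''SX'') j = int X \<and>
        arr s (pre @ ''SZ'') j = int Z \<and> arr s (pre @ ''SW'') j = 2 ^ l"
    using assms(3) by (auto simp: stack_holds_append)
  \<comment> \<open>Since the product is at least 1, the constant overhead of a visit can be charged
    to it too, and the number of cells need not be bounded separately.\<close>
  have "1 * 1 \<le> 2 ^ l * (c - a)" using ab bc by (intro mult_le_mono) auto
  then have "1 \<le> real (2 ^ l * (c - a))" by (metis mult_1 of_nat_1 of_nat_mono)
  then have cost: "(200 + \<kappa>) * real (2 ^ l * (c - a)) + 400 \<le> (600 + \<kappa>) * real (2 ^ l * (c - a))"
    by (simp only: distrib_right)
  have cost': "600 \<le> (600 + \<kappa>) * real (2 ^ l * (c - a))"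
    using mult_mono[OF _ \<open>1 \<le> real (2 ^ l * (c - a))\<close>, of 600 "600 + \<kappa>"] \<kappa>_ge
    by (simp only: mult_1_right)
  define s\<^sub>1 where "s\<^sub>1 = setv (setv (setv (setv (setv (setv (setv (setv s (pre @ ''top'') (int (length cs)))
    (pre @ ''X'') (int X)) (pre @ ''Z'') (int Z)) (pre @ ''w'') (2 ^ l))
    (pre @ ''i1'') (i_at r X (Z + 2 ^ l - 1))) (pre @ ''e1'') (d_at X (Z + 2 ^ l - 1)))
    (pre @ ''i2'') (i_at r (X + 2 ^ l - 1) Z)) (pre @ ''e2'') (d_at (X + 2 ^ l - 1) Z)"
  have agr: "agree scratch scratch_arrays s s\<^sub>1"
    unfolding s\<^sub>1_def by (simp add: scratch_def)
  have s1: "env s\<^sub>1" "cell_regs r X Z (2 ^ l) s\<^sub>1" "stack_holds cs s\<^sub>1" "val s\<^sub>1 ''acc'' = val s ''acc''"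
    using assms(1,2) st by (auto simp: s\<^sub>1_def env_def cell_regs_def stack_holds_def)
  have s1v: "val s\<^sub>1 ''i1'' = i_at r X (Z + 2 ^ l - 1)" "val s\<^sub>1 ''e1'' = d_at X (Z + 2 ^ l - 1)"
    "val s\<^sub>1 ''i2'' = i_at r (X + 2 ^ l - 1) Z" "val s\<^sub>1 ''e2'' = d_at (X + 2 ^ l - 1) Z"
    by (simp_all add: s\<^sub>1_def)
  note env1 = envD[OF s1(1)]
  let ?Q = "\<lambda>s'. agree scratch scratch_arrays s s' \<and> stack_holds (cs @ children r (X, Z, l)) s' \<and>
    val s' ''acc'' = val s ''acc'' + (if inside r X Z (2 ^ l) then weight r X Z (2 ^ l) else 0)"
  let ?t1 = "(Const 0 [<] V ''i1'') [*] (V ''i1'' [+] (V ''k'' [-] Const 1) [*] V ''e1'' [<=] V ''n'') [*]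
         (V ''i2'' [<=] V ''e2'') [*] (V ''n'' [<] V ''i2'' [+] V ''k'' [*] V ''e2'')"
  let ?t2 = "(Const 0 [<] V ''i2'') [*] (V ''i2'' [+] (V ''k'' [-] Const 1) [*] V ''e2'' [<=] V ''n'') [*]
           (V ''i1'' [<=] V ''e1'') [*] (V ''n'' [<] V ''i1'' [+] V ''k'' [*] V ''e1'')"
  define Q where "Q = ?Q"
  have rest: "runs W (If ?t1 conv_prog (If ?t2 push_prog Skip)) s\<^sub>1
    ((600 + \<kappa>) * real (2 ^ l * (c - a)) - 150) Q"
    unfolding Q_def
  proof (rule runs_if)
    show "bounded B s\<^sub>1 ?t1" using cv bnds by (simp add: env1 s1v)
    assume "ev s\<^sub>1 ?t1 \<noteq> 0"
    then have ins: "inside r X Z (2 ^ l)"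
      by (simp add: env1 s1v inside_def)
    then have "children r (X, Z, l) = []" by (simp add: children_def crossing_def)
    then show "runs W conv_prog s\<^sub>1 ((600 + \<kappa>) * real (2 ^ l * (c - a)) - 150 - real (1 + cost ?t1)) ?Q"
    proof (intro runs_mono[OF conv_prog[OF s1(1,2) assms(4) ins]], goal_cases)
      case 3
      have "real (1 + cost ?t1) \<le> 100" by simp
      then show ?case using cost by linarith
    next
      case (4 t)
      then have a: "agree ({pre @ ''mm'', pre @ ''j'', pre @ ''acc'', ''m''} \<union> writes P) ({''x'', ''y''} \<union> writes P) s\<^sub>1 t"
        and "val t ''acc'' = val s\<^sub>1 ''acc'' + weight r X Z (2 ^ l)" by auto
      moreover have "agree scratch scratch_arrays s t"
        by (rule agree_trans[OF agr a]) (auto simp: scratch_def scratch_arrays_def)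
      moreover have "stack_holds cs t" using s1(3) a by (auto simp: stack_holds_def agree_def)
      ultimately show ?case using 4 ins s1(4) by simp
    qed (use acc s1(4) in auto)
  next
    assume "ev s\<^sub>1 ?t1 = 0"
    then have ins: "\<not> inside r X Z (2 ^ l)"
      by (auto simp add: env1 s1v inside_def)
    show "runs W (If ?t2 push_prog Skip) s\<^sub>1
      ((600 + \<kappa>) * real (2 ^ l * (c - a)) - 150 - real (1 + cost ?t1)) ?Q"
    proof (rule runs_if)
      show "bounded B s\<^sub>1 ?t2" using cv bnds by (simp add: env1 s1v)
      assume "ev s\<^sub>1 ?t2 \<noteq> 0"
      then have cr: "crossing r X Z (2 ^ l)"
        using ins by (simp add: env1 s1v crossing_def outside_def not_le not_less)
      show "runs W push_prog s\<^sub>1 ((600 + \<kappa>) * real (2 ^ l * (c - a)) - 150 -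
          real (1 + cost ?t1) - real (1 + cost ?t2)) ?Q"
      proof (rule runs_mono[OF push_prog[OF s1(3,2) cr assms(4) len]])
        fix t assume t: "agree {pre @ ''top'', pre @ ''w''} {pre @ ''SX'', pre @ ''SZ'', pre @ ''SW''} s\<^sub>1 t \<and>
          stack_holds (cs @ children r (X, Z, l)) t"
        have "agree scratch scratch_arrays s t"
          by (rule agree_trans[OF agr t[THEN conjunct1]]) (auto simp: scratch_def scratch_arrays_def)
        then show "?Q t" using t s1(4) ins by (simp add: agree_def)
      qed (use cost' in \<open>simp only: cost.simps of_nat_add of_nat_1; linarith\<close>)
    next
      assume "ev s\<^sub>1 ?t2 = 0"
      then have out: "outside r X Z (2 ^ l)"
        by (auto simp add: env1 s1v outside_def not_le not_less)
      then have "children r (X, Z, l) = []" by (simp add: children_def crossing_def)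
      then show "runs W Skip s\<^sub>1 ((600 + \<kappa>) * real (2 ^ l * (c - a)) - 150 -
          real (1 + cost ?t1) - real (1 + cost ?t2)) ?Q"
      proof (intro runs_skip, goal_cases)
        case 1
        show ?case using cost' by (simp only: cost.simps of_nat_add of_nat_1; linarith)
      qed (use agr s1 ins in auto)
    qed simp
  qed simp
  show ?thesis
    unfolding cell_prog_def Q_def[symmetric]
    apply (intro runs_assign_seq)
                    apply (simp_all add: env assms(2) top bnds lenB wB cv)
    apply (rule runs_mono[OF rest[unfolded s\<^sub>1_def One_nat_def]])
     apply simp_all
    done
qed

lemma env_scratch: "env s \<Longrightarrow> agree scratch scratch_arrays s s' \<Longrightarrow> env s'"
  by (rule env_agree) (auto simp: scratch_def scratch_arrays_def input_regs_def)

text \<open>The total area of the stacked cells never grows, which bounds the height of the stack.\<close>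

lemma stack_loop:
  assumes "env s" "val s ''r'' = int r" "stack_holds [(0, 0, L)] s" "in_range r 0 0 (2 ^ L)"
    and acc: "0 \<le> val s ''acc''" "val s ''acc'' + weight r 0 0 (2 ^ L) \<le> int (n * (4 * n + 1) * (4 * n + 1))"
  shows "runs W (While (Const 0 [<] V ''top'') cell_prog) s
    ((604 + \<kappa>) * real (c - a) * real (visits r L 0 0) + 4)
    (\<lambda>s'. agree scratch scratch_arrays s s' \<and> val s' ''acc'' = val s ''acc'' + weight r 0 0 (2 ^ L))"
proof -
  let ?I = "\<lambda>cs s'. agree scratch scratch_arrays s s' \<and> stack_holds cs s' \<and>
    (\<forall>(X, Z, l) \<in> set cs. in_range r X Z (2 ^ l)) \<and>
    0 \<le> val s' ''acc'' \<and>
    val s' ''acc'' + (\<Sum>x\<leftarrow>cs. cell_weight r x) = val s ''acc'' + weight r 0 0 (2 ^ L) \<and>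
    (\<Sum>(X, Z, l)\<leftarrow>cs. 4 ^ l) \<le> (4 ^ L :: nat)"
  \<comment> \<open>Of the 604, the part 600 pays for the cell and 4 for the loop test before it;
    the final summand 4 pays for the failing test on the empty stack.\<close>
  let ?\<Phi> = "\<lambda>cs. (604 + \<kappa>) * real (c - a) * real (\<Sum>x\<leftarrow>cs. cell_visits r x) + 4"
  have pos: "1 \<le> real (c - a)" "1 \<le> c - a" using ab bc by auto
  have nonneg: "0 \<le> (\<Sum>x\<leftarrow>cs. cell_weight r x)" for cs
    by (rule sum_list_nonneg) (auto simp: cell_weight_def weight_nonneg)
  have len: "int (length cs) + 4 \<le> B" if "(\<Sum>(X, Z, l)\<leftarrow>cs. 4 ^ l) \<le> (4 ^ L :: nat)" for cs :: "cell list"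
  proof -
    have "length cs \<le> (\<Sum>(X, Z, l)\<leftarrow>cs. 4 ^ l)"
    proof (induction cs)
      case (Cons x cs)
      have "1 \<le> (4 :: nat) ^ snd (snd x)" by simp
      from add_mono[OF this Cons.IH] show ?case by (simp add: case_prod_beta)
    qed simp
    also note that
    also have "(4 ^ L :: nat) = 2 ^ L * 2 ^ L" by (simp flip: power_mult_distrib)
    also have "\<dots> \<le> (4 * n + 1) * (4 * n + 1)"
      using assms(4) by (intro mult_le_mono) (auto simp: in_range_def)
    finally have "length cs + 4 \<le> (4 * n + 1) * (4 * n + 1) + 4" by simp
    then have "int (length cs + 4) \<le> int ((4 * n + 1) * (4 * n + 1) + 4)" by (rule of_nat_mono)
    also have "\<dots> \<le> B" by (rule B_bound) (simp add: algebra_simps)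
    finally show ?thesis by simp
  qed
  show ?thesis
  proof (rule runs_while[where I = ?I and g = "[(0, 0, L)]" and \<Phi> = ?\<Phi>
        and \<tau> = "\<lambda>cs. (600 + \<kappa>) * real (2 ^ (snd (snd (last cs))) * (c - a))"], goal_cases)
    case 1
    show ?case using assms by (simp add: cell_weight_def)
  next
    case (2 cs s')
    then show ?case using len[of cs] B_ge by (auto simp: stack_holds_def)
  next
    case (4 cs s')
    then have "cs \<noteq> []" by (auto simp: stack_holds_def)
    then obtain ds X Z l where cs: "cs = ds @ [(X, Z, l)]" by (metis append_butlast_last_id surj_pair)
    note I = 4(1)[unfolded cs]
    have agr: "agree scratch scratch_arrays s s'" using I by blast
    have env: "env s'" using env_scratch[OF assms(1) agr] .
    have r: "val s' ''r'' = int r" using agr assms(2) by (auto simp: agree_def scratch_def)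
    have rg: "in_range r X Z (2 ^ l)" using I by auto
    have area: "(\<Sum>(X, Z, l)\<leftarrow>ds. 4 ^ l) + 4 ^ l \<le> (4 ^ L :: nat)" using I by simp
    have wt: "val s' ''acc'' + (\<Sum>x\<leftarrow>ds. cell_weight r x) + weight r X Z (2 ^ l) =
        val s ''acc'' + weight r 0 0 (2 ^ L)" using I by (simp add: cell_weight_def)
    have acc': "0 \<le> val s' ''acc''" "val s' ''acc'' \<le> int (n * (4 * n + 1) * (4 * n + 1))"
      using I wt nonneg[of ds] weight_nonneg[of r X Z "2 ^ l"] acc(2) by linarith+
    have lends: "int (length ds) + 4 \<le> B" using area by (intro len) simp
    show ?case
    proof (rule runs_mono[OF cell_prog[OF env r _ rg lends acc']])
      show "stack_holds (ds @ [(X, Z, l)]) s'" using I by blast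
      fix t assume t: "agree scratch scratch_arrays s' t \<and> stack_holds (ds @ children r (X, Z, l)) t \<and>
        val t ''acc'' = val s' ''acc'' + (if inside r X Z (2 ^ l) then weight r X Z (2 ^ l) else 0)"
      have "agree scratch scratch_arrays s t" using agree_trans[OF agr] t by blast
      moreover have "\<forall>(X, Z, l) \<in> set (ds @ children r (X, Z, l)). in_range r X Z (2 ^ l)"
        using I in_range_children[OF rg] by auto
      moreover have "0 \<le> val t ''acc''" using t acc' weight_nonneg[of r X Z "2 ^ l"] by auto
      moreover have "val t ''acc'' + (\<Sum>x\<leftarrow>ds @ children r (X, Z, l). cell_weight r x) =
          val s ''acc'' + weight r 0 0 (2 ^ L)"
        using t wt weight_children[of r X Z l] by simp
      moreover have "(\<Sum>(X, Z, l)\<leftarrow>ds @ children r (X, Z, l). 4 ^ l) \<le> (4 ^ L :: nat)"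
        using area area_children[of r X Z l] by simp
      ultimately have "?I (ds @ children r (X, Z, l)) t" using t by blast
      moreover have "(600 + \<kappa>) * real (2 ^ (snd (snd (last cs))) * (c - a)) +
          real (1 + cost (Const 0 [<] V ''top'')) + ?\<Phi> (ds @ children r (X, Z, l)) \<le> ?\<Phi> cs"
      proof -
        have "(\<Sum>x\<leftarrow>cs. cell_visits r x) = (\<Sum>x\<leftarrow>ds @ children r (X, Z, l). cell_visits r x) + 2 ^ l"
          using visits_children[of r X Z l] by (simp add: cs cell_visits_def)
        then have "?\<Phi> cs = ?\<Phi> (ds @ children r (X, Z, l)) + (604 + \<kappa>) * real (c - a) * real (2 ^ l)"
          by (simp only: of_nat_add distrib_left)
        moreover have "1 * 1 \<le> real (c - a) * real (2 ^ l)" using pos by (intro mult_mono) auto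
        moreover have "(604 + \<kappa>) * real (c - a) * real (2 ^ l) =
            (600 + \<kappa>) * real (2 ^ l * (c - a)) + 4 * (real (c - a) * real (2 ^ l))"
          unfolding of_nat_mult by algebra
        moreover have "real (1 + cost (Const 0 [<] V ''top'')) = 4" by simp
        moreover have "snd (snd (last cs)) = l" by (simp add: cs)
        ultimately show ?thesis by (simp only: mult_1_right)
      qed
      ultimately show "\<exists>cs'. ?I cs' t \<and> (600 + \<kappa>) * real (2 ^ (snd (snd (last cs))) * (c - a)) +
          real (1 + cost (Const 0 [<] V ''top'')) + ?\<Phi> cs' \<le> ?\<Phi> cs" by blast
    qed (simp add: cs)
  next
    case (5 cs s')
    then show ?case using \<kappa>_ge by simp
  next
    case 6
    show ?case by (simp add: cell_visits_def)
  next
    case (7 cs s')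
    then have "cs = []" by (auto simp: stack_holds_def)
    then show ?case using 7 by simp
  qed simp
qed

section \<open>All residues, the initial square and the total time\<close>

definition residue_prog :: com where
  "residue_prog =
     (pre @ ''r'') ::= Const 0 ;;
     While (V ''r'' [<] V ''c'' [-] V ''a'')
      (Store (pre @ ''SX'') (Const 0) (Const 0) ;;
       Store (pre @ ''SZ'') (Const 0) (Const 0) ;;
       Store (pre @ ''SW'') (Const 0) (V ''w0'') ;;
       (pre @ ''top'') ::= Const 1 ;;
       While (Const 0 [<] V ''top'') cell_prog ;;
       (pre @ ''r'') ::= V ''r'' [+] Const 1)"

lemma weight_le: "weight r X Z w \<le> int (w * w)"
proof -
  have "weight r X Z w \<le> (\<Sum>s<w. \<Sum>t<w. 1)"
    unfolding weight_def by (intro sum_mono) (simp add: hit_def)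
  then show ?thesis by simp
qed

lemma residue_prog:
  assumes "env s" "val s ''w0'' = 2 ^ L" "in_range 0 0 0 (2 ^ L)" "val s ''acc'' = 0"
  shows "runs W residue_prog s
     ((c - a) * ((604 + \<kappa>) * real (c - a) * (2 ^ L * (1 + 16 * real L)) + 30) + 10)
     (\<lambda>s'. val s' ''acc'' = (\<Sum>r<c - a. weight r 0 0 (2 ^ L)))"
proof -
  let ?\<beta> = "(604 + \<kappa>) * real (c - a) * (2 ^ L * (1 + 16 * real L))"
  let ?I = "\<lambda>r s'. agree (insert (pre @ ''r'') scratch) scratch_arrays s s' \<and> val s' ''r'' = int r \<and>
    val s' ''acc'' = (\<Sum>i<r. weight i 0 0 (2 ^ L))"
  have k: "k \<le> n" using assms(3) by (simp add: in_range_def)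
  note bnds = input_bounds[OF k] in_rangeD(4)[OF assms(3)] B_ge
  have can: "c - a \<le> n" using less_k k by simp
  have D: "env s'" "val s' ''w0'' = 2 ^ L" if "?I r s'" for r s'
  proof -
    show "env s'" by (rule env_agree[OF assms(1) that[THEN conjunct1]])
        (auto simp: scratch_def scratch_arrays_def input_regs_def)
    show "val s' ''w0'' = 2 ^ L" using that assms(2) by (auto simp: agree_def scratch_def)
  qed
  \<comment> \<open>There are \<open>c - a <= n\<close> residues, and each contributes at most the
    area of its square.\<close>
  have acc_le: "(\<Sum>i<r. weight i 0 0 (2 ^ L)) \<le> int (n * (4 * n + 1) * (4 * n + 1))" if "r \<le> c - a" for r
  proof -
    have "(\<Sum>i<r. weight i 0 0 (2 ^ L)) \<le> (\<Sum>i<r. int (2 ^ L * 2 ^ L))"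
      by (intro sum_mono weight_le)
    also have "\<dots> = int (r * (2 ^ L * 2 ^ L))" by simp
    also have "\<dots> \<le> int (n * ((4 * n + 1) * (4 * n + 1)))"
      using that can assms(3) by (intro of_nat_mono mult_le_mono) (auto simp: in_range_def)
    finally show ?thesis by (simp only: mult.assoc)
  qed
  show ?thesis
    unfolding residue_prog_def
  proof (intro runs_assign_seq; (use bnds in simp; fail)?)
    show "runs W (While (V ''r'' [<] V ''c'' [-] V ''a'')
      (Store (pre @ ''SX'') (Const 0) (Const 0) ;;
       Store (pre @ ''SZ'') (Const 0) (Const 0) ;;
       Store (pre @ ''SW'') (Const 0) (V ''w0'') ;;
       (pre @ ''top'') ::= Const 1 ;;
       While (Const 0 [<] V ''top'') cell_prog ;;
       (pre @ ''r'') ::= V ''r'' [+] Const 1)) (setv s (pre @ ''r'') (ev s (Const 0)))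
      (real (c - a) * (?\<beta> + 30) + 10 - real (1 + cost (Const 0)))
      (\<lambda>s'. val s' ''acc'' = (\<Sum>r<c - a. weight r 0 0 (2 ^ L)))"
    proof (rule runs_for[where \<tau> = "?\<beta> + 24" and N = "c - a" and I = ?I], goal_cases)
      case 1
      show ?case using assms(4) by simp
    next
      case (2 r s')
      have "int r \<le> B" using 2(1) can bnds(1) by linarith
      then show ?case using envD[OF D(1)[OF 2(2)]] 2(2) bnds ab bc 2(1) by auto
    next
      case (4 r s')
      note env = D(1)[OF 4(2)] and w0 = D(2)[OF 4(2)]
      have rB: "int r \<le> B" "r \<le> n" using 4(1) can bnds(1) by linarith+
      define s\<^sub>1 where "s\<^sub>1 = setv (seta (seta (seta s' (pre @ ''SX'') 0 0) (pre @ ''SZ'') 0 0)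
        (pre @ ''SW'') 0 (2 ^ L)) (pre @ ''top'') 1"
      have agr: "agree (insert (pre @ ''r'') scratch) scratch_arrays s s\<^sub>1"
        using 4(2) by (simp add: s\<^sub>1_def scratch_def scratch_arrays_def)
      have env1: "env s\<^sub>1" by (rule env_agree[OF assms(1) agr])
          (auto simp: scratch_def scratch_arrays_def input_regs_def)
      have st: "stack_holds [(0, 0, L)] s\<^sub>1" by (simp add: s\<^sub>1_def stack_holds_def)
      have r1: "val s\<^sub>1 ''r'' = int r" "val s\<^sub>1 ''acc'' = (\<Sum>i<r. weight i 0 0 (2 ^ L))"
        using 4(2) by (simp_all add: s\<^sub>1_def)
      have rg: "in_range r 0 0 (2 ^ L)" using assms(3) rB by (simp add: in_range_def)
      have acc0: "0 \<le> val s\<^sub>1 ''acc''" using r1 by (simp add: sum_nonneg weight_nonneg)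
      have acc1: "val s\<^sub>1 ''acc'' + weight r 0 0 (2 ^ L) \<le> int (n * (4 * n + 1) * (4 * n + 1))"
        using acc_le[of "Suc r"] 4(1) r1 by simp
      have vis: "(604 + \<kappa>) * real (c - a) * real (visits r L 0 0) \<le> ?\<beta>"
      proof (rule mult_left_mono)
        have "real (visits r L 0 0) \<le> real (2 ^ L * (1 + 16 * L))" by (intro of_nat_mono visits_le)
        then show "real (visits r L 0 0) \<le> 2 ^ L * (1 + 16 * real L)" by (simp add: distrib_left)
      qed (use \<kappa>_ge in simp)
      have step: "runs W (While (Const 0 [<] V ''top'') cell_prog ;; (pre @ ''r'') ::= V ''r'' [+] Const 1) s\<^sub>1
          (?\<beta> + 12) (?I (Suc r))"
      proof (rule runs_call[OF stack_loop[OF env1 r1(1) st rg acc0 acc1]], elim conjE)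
        fix t assume t: "agree scratch scratch_arrays s\<^sub>1 t" "val t ''acc'' = val s\<^sub>1 ''acc'' + weight r 0 0 (2 ^ L)"
        have "agree (insert (pre @ ''r'') scratch) scratch_arrays s t"
          by (rule agree_trans[OF agr t(1)]) auto
        moreover have "val t ''r'' = int r" using t(1) r1 by (auto simp: agree_def scratch_def)
        ultimately show "runs W ((pre @ ''r'') ::= V ''r'' [+] Const 1) t
          (?\<beta> + 12 - ((604 + \<kappa>) * real (c - a) * real (visits r L 0 0) + 4)) (?I (Suc r))"
          using t(2) r1(2) rB bnds vis by (intro runs_assign) auto
      qed
      show ?case
        apply (intro runs_store_seq runs_assign_seq)
        apply (use bnds w0 in simp_all)
        apply (rule runs_mono[OF step[unfolded s\<^sub>1_def]])
        apply simp_all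
        done
    next
      case 5
      show ?case by (simp add: algebra_simps)
    next
      case 6
      show ?case using \<kappa>_ge by simp
    qed (use bnds in auto)
  qed
qed

definition size_prog :: com where
  "size_prog =
     (pre @ ''w0'') ::= Const 1 ;;
     While (V ''w0'' [*] (V ''c'' [-] V ''a'') [<=] V ''d1'' [+] V ''c'' [*] (V ''d1'' [-] V ''d0''))
       ((pre @ ''w0'') ::= Const 2 [*] V ''w0'')"

abbreviation extent :: nat where "extent \<equiv> d\<^sub>1 + c * (d\<^sub>1 - d\<^sub>0)"

lemma d\<^sub>0_le_d\<^sub>1: "d\<^sub>0 \<le> d\<^sub>1"
  unfolding d\<^sub>0_def d\<^sub>1_def using k_ge by (intro div_le_mono2) auto

lemma extent_le:
  assumes "k * k \<le> n"
  shows "3 * extent \<le> 5 * n" "3 * k \<le> n"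
proof -
  have "3 * extent \<le> k * extent" using k_ge by (rule mult_le_mono1)
  then show "3 * extent \<le> 5 * n" using square_size[OF assms] by linarith
  have "3 * k \<le> k * k" using k_ge by (rule mult_le_mono1)
  then show "3 * k \<le> n" using assms by linarith
qed

text \<open>The last doubling starts from a product of at most \<open>extent\<close>, so it ends at
  most at \<open>2 * extent\<close>; the summand \<open>c - a\<close> covers the case that the width
  1 already suffices.\<close>

lemma size_prog:
  assumes "env s" "k * k \<le> n"
  shows "runs W size_prog s (60 * real extent + 80) (\<lambda>s'. agree {pre @ ''w0''} {} s s' \<and>
    (\<exists>L. val s' ''w0'' = 2 ^ L \<and> extent < 2 ^ L * (c - a) \<and> 2 ^ L * (c - a) \<le> (c - a) + 2 * extent))"
proof -
  let ?I = "\<lambda>L s'. agree {pre @ ''w0''} {} s s' \<and> val s' ''w0'' = 2 ^ L \<and>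
    2 ^ L * (c - a) \<le> (c - a) + 2 * extent"
  note ext = extent_le[OF assms(2)]
  have k: "k \<le> n" using ext by simp
  note bnds = input_bounds[OF k] B_ge
  have ca: "1 \<le> c - a" using ab bc by simp
  have D: "env s'" if "?I L s'" for L s'
    by (rule env_agree[OF assms(1) that[THEN conjunct1]]) (auto simp: input_regs_def)
  have w: "2 ^ L \<le> 1 + 2 * extent" if "?I L s'" for L s'
  proof -
    have "2 ^ L * (c - a) \<le> (c - a) + 2 * extent" using that by blast
    then have "(2 ^ L - 1) * (c - a) \<le> 2 * extent" unfolding diff_mult_distrib by linarith
    moreover have "(2 ^ L - 1) * 1 \<le> (2 ^ L - 1) * (c - a)" using ca by (rule mult_le_mono2)
    ultimately have "2 ^ L - 1 \<le> 2 * extent" by linarith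
    then show ?thesis by linarith
  qed
  have wB: "(2::int) ^ L \<le> B" if "?I L s'" for L s'
  proof -
    have "int (2 ^ L) \<le> B" by (rule B_bound) (use w[OF that] ext in linarith)
    then show ?thesis by simp
  qed
  have diffs: "int d\<^sub>1 - int d\<^sub>0 = int (d\<^sub>1 - d\<^sub>0)" using d\<^sub>0_le_d\<^sub>1 by simp
  have cond: "ev s' (V ''w0'' [*] (V ''c'' [-] V ''a'') [<=] V ''d1'' [+] V ''c'' [*] (V ''d1'' [-] V ''d0'')) \<noteq> 0 \<longleftrightarrow>
      2 ^ L * (c - a) \<le> extent" if "?I L s'" for L s'
  proof -
    have "ev s' (V ''w0'' [*] (V ''c'' [-] V ''a'') [<=] V ''d1'' [+] V ''c'' [*] (V ''d1'' [-] V ''d0'')) =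
        of_bool (int (2 ^ L * (c - a)) < int extent + 1)"
      using that envD[OF D[OF that]] by (simp only: ev.simps int_diffs diffs of_nat_mult of_nat_add of_nat_power of_nat_numeral)
    then show ?thesis by (simp only: of_bool_eq_0_iff) linarith
  qed
  show ?thesis
    unfolding size_prog_def
  proof (intro runs_assign_seq; (use bnds in simp; fail)?)
    show "runs W (While (V ''w0'' [*] (V ''c'' [-] V ''a'') [<=] V ''d1'' [+] V ''c'' [*] (V ''d1'' [-] V ''d0''))
       ((pre @ ''w0'') ::= Const 2 [*] V ''w0'')) (setv s (pre @ ''w0'') (ev s (Const 1)))
       (60 * real extent + 80 - real (1 + cost (Const 1)))
       (\<lambda>s'. agree {pre @ ''w0''} {} s s' \<and>
         (\<exists>L. val s' ''w0'' = 2 ^ L \<and> extent < 2 ^ L * (c - a) \<and> 2 ^ L * (c - a) \<le> (c - a) + 2 * extent))"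
    \<comment> \<open>A linear estimate of the number of doublings is affordable: each one raises
      \<open>2 ^ L\<close> by at least 1, and the invariant bounds \<open>2 ^ L\<close> by
      \<open>1 + 2 * extent\<close>.\<close>
    proof (rule runs_while[where I = ?I and g = 0 and \<tau> = "\<lambda>_. 4"
          and \<Phi> = "\<lambda>L. 30 * (2 * real extent + 2 - 2 ^ L) + 10"], goal_cases)
      case 1
      show ?case by simp
    next
      case (2 L s')
      then show ?case using envD[OF D[OF 2]] wB[OF 2] bnds by simp
    next
      case (4 L s')
      then have le: "2 ^ L * (c - a) \<le> extent" using cond by blast
      have "1 \<le> (2::real) ^ L" by simp
      then have "2 \<le> 3 * (2::real) ^ L" by linarith
      then show ?case
        using 4(1) wB[OF 4(1)] bnds le
        by (intro runs_assign exI[of _ "Suc L"] conjI) auto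
    next
      case (5 L s')
      have "real (2 ^ L) \<le> real (1 + 2 * extent)" using w[OF 5] by (rule of_nat_mono)
      then show ?case by simp
    next
      case (7 L s')
      then show ?case using cond[of s' L] by (auto simp: not_le)
    qed simp_all
  qed
qed

definition main_prog :: com where
  "main_prog = size_prog ;; residue_prog"

text \<open>Over all residues the widths sum to \<open>(c - a) * (c - a) * 2 ^ L\<close>, at most
  \<open>k * (k + 2 * extent)\<close>. Both \<open>k * k\<close> and \<open>k * extent\<close> are
  linear in \<open>n\<close> by the assumption, giving
  \<open>n + 2 * 5 * n = 11 * n\<close>.\<close>

lemma main_prog:
  assumes "env s" "k * k \<le> n" "val s ''acc'' = 0"
  shows "runs W main_prog s ((604 + \<kappa>) * (1 + 32 * ln (4 * real n + 1)) * (11 * real n) + 150 * real n + 100)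
    (\<lambda>s'. val s' ''acc'' = int (card cadences))"
  unfolding main_prog_def
proof (rule runs_call[OF size_prog[OF assms(1,2)]], elim conjE exE)
  fix t L assume a: "agree {pre @ ''w0''} {} s t" and w0: "val t ''w0'' = 2 ^ L"
    and L: "extent < 2 ^ L * (c - a)" "2 ^ L * (c - a) \<le> (c - a) + 2 * extent"
  note ext = extent_le[OF assms(2)]
  have env: "env t" by (rule env_agree[OF assms(1) a]) (auto simp: input_regs_def)
  have acc: "val t ''acc'' = 0" using a assms(3) by (simp add: agree_def)
  have ca: "1 \<le> c - a" "c - a \<le> k" using ab bc less_k by auto
  have "(2 ^ L - 1) * (c - a) \<le> 2 * extent" using L(2) unfolding diff_mult_distrib by linarith
  moreover have "(2 ^ L - 1) * 1 \<le> (2 ^ L - 1) * (c - a)" using ca(1) by (rule mult_le_mono2)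
  \<comment> \<open>Indeed \<open>2 * extent\<close> is at most \<open>10 * n / 3\<close>; the bound
    \<open>4 * n + 1\<close> required by \<open>in_range\<close> originates here.\<close>
  ultimately have w: "2 ^ L \<le> 4 * n + 1" using ext by linarith
  have rg: "in_range 0 0 0 (2 ^ L)"
    unfolding in_range_def using w L(2) ext ca by simp
  have "L * ln 2 = ln (2 ^ L :: real)" by (simp add: ln_realpow)
  also have "\<dots> \<le> ln (real (4 * n + 1))" using of_nat_mono[OF w, where 'a = real] by simp
  finally have "real L * ln 2 \<le> ln (4 * real n + 1)" by (simp add: add.commute)
  \<comment> \<open>The estimate \<open>ln 2 >= 1 / 2\<close> is
    \<open>ln (1 / 2) <= 1 / 2 - 1\<close> with both signs reversed.\<close>
  moreover have "real L * (1 / 2) \<le> real L * ln 2" using ln_le_minus_one[of "1 / 2 :: real"] by (intro mult_left_mono) (auto simp: ln_div)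
  ultimately have L_le: "real L \<le> 2 * ln (4 * real n + 1)" by simp
  have area: "real (c - a) * (real (c - a) * 2 ^ L) \<le> 11 * real n"
  proof -
    have "(c - a) * (2 ^ L * (c - a)) \<le> k * (k + 2 * extent)" using L(2) ca by (intro mult_le_mono) auto
    also have "\<dots> = k * k + 2 * (k * extent)" by (simp add: distrib_left)
    also have "\<dots> \<le> 11 * n" using square_size[OF assms(2)] assms(2) by linarith
    finally have "real ((c - a) * (2 ^ L * (c - a))) \<le> real (11 * n)" by (rule of_nat_mono)
    moreover have "real ((c - a) * (2 ^ L * (c - a))) = real (c - a) * (real (c - a) * 2 ^ L)"
      by (simp only: of_nat_mult of_nat_power of_nat_numeral mult_ac)
    moreover have "real (11 * n) = 11 * real n" by simp
    ultimately show ?thesis by linarith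
  qed
  have "(604 + \<kappa>) * (1 + 16 * real L) * (real (c - a) * (real (c - a) * 2 ^ L))
      \<le> (604 + \<kappa>) * (1 + 32 * ln (4 * real n + 1)) * (11 * real n)"
  proof (rule mult_mono[OF _ area])
    show "(604 + \<kappa>) * (1 + 16 * real L) \<le> (604 + \<kappa>) * (1 + 32 * ln (4 * real n + 1))"
      using L_le \<kappa>_ge by (intro mult_left_mono) auto
  qed (use \<kappa>_ge in auto)
  moreover have "real (c - a) * ((604 + \<kappa>) * real (c - a) * (2 ^ L * (1 + 16 * real L)) + 30) =
      (604 + \<kappa>) * (1 + 16 * real L) * (real (c - a) * (real (c - a) * 2 ^ L)) + 30 * real (c - a)"
    by algebra
  moreover have "60 * real extent \<le> 100 * real n" "3 * real (c - a) \<le> real n"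
  proof -
    have "real (3 * extent) \<le> real (5 * n)" "real (3 * (c - a)) \<le> real n"
      using ext ca by (intro of_nat_mono; linarith)+
    then show "60 * real extent \<le> 100 * real n" "3 * real (c - a) \<le> real n" by linarith+
  qed
  ultimately show "runs W residue_prog t ((604 + \<kappa>) * (1 + 32 * ln (4 * real n + 1)) * (11 * real n) +
      150 * real n + 100 - (60 * real extent + 80)) (\<lambda>s'. val s' ''acc'' = int (card cadences))"
    by (intro runs_mono[OF residue_prog[OF env w0 rg acc]])
      (linarith, simp add: card_cadences_weight[OF L(1)])
qed

section \<open>Brute force for short strings\<close>

definition brute_inner :: com where
  "brute_inner =
     If ((V ''i'' [+] (V ''k'' [-] Const 1) [*] V ''d'' [<=] V ''n'') [*]
         (V ''n'' [<] V ''i'' [+] V ''k'' [*] V ''d''))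
      ((pre @ ''acc'') ::= V ''acc'' [+] R ''f'' (V ''i'' [+] V ''a'' [*] V ''d'') [*]
         R ''f'' (V ''i'' [+] V ''b'' [*] V ''d'') [*] R ''f'' (V ''i'' [+] V ''c'' [*] V ''d'')) Skip ;;
     (pre @ ''i'') ::= V ''i'' [+] Const 1"

definition brute_prog :: com where
  "brute_prog =
     (pre @ ''d'') ::= V ''d0'' [+] Const 1 ;;
     While (V ''d'' [<=] V ''d1'')
      ((pre @ ''i'') ::= Const 1 ;;
       While (V ''i'' [<=] V ''d'') brute_inner ;;
       (pre @ ''d'') ::= V ''d'' [+] Const 1)"

abbreviation cad :: "nat \<Rightarrow> nat \<Rightarrow> int" where
  "cad d j \<equiv> of_bool ((int j + 1, int d) \<in> cadences)"

text \<open>The enclosing loops run over \<open>0 < i <= d\<close>, so only the two conditions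
  involving \<open>k\<close> are tested. They also guarantee that the three array reads are in
  range.\<close>

lemma brute_inner:
  assumes "env s" "k \<le> n" "val s ''d'' = int d" "d \<le> d\<^sub>1" "val s ''i'' = int j + 1" "j < d"
    "\<bar>val s ''acc''\<bar> \<le> B"
  shows "runs W brute_inner s 60 (\<lambda>s'. agree {pre @ ''i'', pre @ ''acc''} {} s s' \<and>
    val s' ''i'' = int j + 2 \<and> val s' ''acc'' = val s ''acc'' + cad d j)"
proof -
  note env = envD[OF assms(1)] and bnds = input_bounds[OF assms(2)]
  define i where "i = int j + 1"
  have i: "val s ''i'' = i" "0 < i" "i \<le> int d" "i \<le> B" "\<bar>i\<bar> \<le> B" "i + 1 = int j + 2"
    using assms bnds by (auto simp: i_def)
  have dB: "int d \<le> B" using assms bnds by linarith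
  have cond: "i + (int k - 1) * int d \<le> int n \<and> int n < i + int k * int d \<longleftrightarrow> poly i (int d)"
    using i by (simp add: poly_def)
  have cond': "(i + (int k - 1) * int d \<le> int n \<longrightarrow> \<not> int n < i + int k * int d) \<longleftrightarrow> \<not> poly i (int d)"
    using cond by auto
  have f: "arr s (pre @ ''f'') (nat (i + int l * int d)) = occ_val (i + int l * int d)" "0 \<le> i + int l * int d"
    if "poly i (int d)" "l < k" for l
  proof -
    have p: "1 \<le> i + int l * int d" "i + int l * int d \<le> int n" using poly_pos[OF that] by auto
    then show "arr s (pre @ ''f'') (nat (i + int l * int d)) = occ_val (i + int l * int d)"
      using env(8)[of "nat (i + int l * int d)"] by simp
    show "0 \<le> i + int l * int d" using p by simp
  qed
  have cad: "cad d j = (if poly i (int d) then occ_val (i + int a * int d) * occ_val (i + int b * int d) *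
      occ_val (i + int c * int d) else 0)"
    by (simp add: cadences_def i_def occ_val_def)
  define h where "h = cad d j"
  show ?thesis
    unfolding brute_inner_def h_def[symmetric]
    apply (rule runs_if_seq)
       apply (simp add: env assms(3) i bnds dB)
      apply simp
     apply (simp add: env assms(3) i(1) cond)
     apply (intro straight_line)
          apply (use assms(7) in \<open>simp_all add: env assms(3) i bnds dB f less_k occ_val_bounds h_def cad cond'\<close>)
    apply (intro straight_line)
        apply (simp_all add: env assms(3) i bnds dB h_def cad)
    done
qed

lemma n2_le_B: "int (n * n + n) \<le> B" "d \<le> n + 1 \<Longrightarrow> int d \<le> B"
  by (intro B_bound; simp)+

lemma brute_row:
  assumes "env s" "k \<le> n" "val s ''d'' = int d" "d \<le> d\<^sub>1" "val s ''i'' = 1"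
    "0 \<le> val s ''acc''" "val s ''acc'' \<le> int (n * n)"
  shows "runs W (While (V ''i'' [<=] V ''d'') brute_inner) s (70 * real d + 10)
    (\<lambda>s'. agree {pre @ ''i'', pre @ ''acc''} {} s s' \<and>
      val s' ''acc'' = val s ''acc'' + (\<Sum>j<d. cad d j))"
proof (rule runs_for[where \<tau> = 60 and N = d and I = "\<lambda>j s'. agree {pre @ ''i'', pre @ ''acc''} {} s s' \<and>
    val s' ''i'' = int j + 1 \<and> val s' ''acc'' = val s ''acc'' + (\<Sum>j<j. cad d j)"], goal_cases)
  case 1
  show ?case using assms by simp
next
  case (2 j s')
  have "val s' ''d'' = int d" using 2(2) assms(3) by (simp add: agree_def)
  moreover have "d \<le> n" using assms(4) d_bounds(4) by linarith
  then have "int d \<le> B" "int j + 1 \<le> B" using 2(1) n2_le_B(2)[of d] n2_le_B(2)[of "j + 1"] by simp_all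
  ultimately show ?case using 2 B_ge by auto
next
  case (4 j s')
  have env: "env s'"
    by (rule env_agree[OF assms(1) 4(2)[THEN conjunct1]]) (auto simp: input_regs_def)
  have d: "val s' ''d'' = int d" using 4(2) assms(3) by (simp add: agree_def)
  have "0 \<le> (\<Sum>j<j. cad d j)" "(\<Sum>j<j. cad d j) \<le> int j"
    using sum_bounded_above[of "{..<j}" "cad d" 1] by (simp_all add: sum_nonneg)
  moreover have "j \<le> n" using 4(1) assms(4) d_bounds(4) by linarith
  ultimately have "\<bar>val s' ''acc''\<bar> \<le> B"
    using 4(2) assms(6,7) n2_le_B(1) by simp
  note step = brute_inner[OF env assms(2) d assms(4) _ 4(1) this]
  show ?case
    by (rule runs_mono[OF step]) (use 4(2) in \<open>auto intro: agree_trans\<close>)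
next
  case (7 s')
  then show ?case by simp
qed simp_all

text \<open>There are at most four rows, one for each difference, and each has length at most
  \<open>d\<^sub>1 <= n\<close>.\<close>

lemma brute_prog:
  assumes "env s" "k \<le> n" "n < k * k" "val s ''acc'' = 0"
  shows "runs W brute_prog s (300 * real n + 200) (\<lambda>s'. val s' ''acc'' = int (card cadences))"
proof -
  note bnds = input_bounds[OF assms(2)]
  let ?row = "\<lambda>e. \<Sum>j<d\<^sub>0 + 1 + e. cad (d\<^sub>0 + 1 + e) j"
  let ?I = "\<lambda>e s'. agree {pre @ ''d'', pre @ ''i'', pre @ ''acc''} {} s s' \<and> val s' ''d'' = int (d\<^sub>0 + 1 + e) \<and>
    val s' ''acc'' = (\<Sum>i<e. ?row i)"
  have d01: "d\<^sub>0 \<le> d\<^sub>1" "d\<^sub>1 \<le> n" using d\<^sub>0_le_d\<^sub>1 d_bounds(4) by auto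
  have D: "env s'" if "?I e s'" for e s'
    by (rule env_agree[OF assms(1) that[THEN conjunct1]]) (auto simp: input_regs_def)
  have row: "0 \<le> ?row e" "?row e \<le> int n" if "e < d\<^sub>1 - d\<^sub>0" for e
  proof -
    have "?row e \<le> int (d\<^sub>0 + 1 + e)"
      using sum_bounded_above[of "{..<d\<^sub>0 + 1 + e}" "cad (d\<^sub>0 + 1 + e)" 1] by simp
    then show "0 \<le> ?row e" "?row e \<le> int n" using that d01 by (auto intro: sum_nonneg)
  qed
  have accs: "0 \<le> (\<Sum>i<e. ?row i)" "(\<Sum>i<e. ?row i) \<le> int (n * n)" if "e \<le> d\<^sub>1 - d\<^sub>0" for e
  proof -
    show "0 \<le> (\<Sum>i<e. ?row i)" using row that by (intro sum_nonneg) auto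
    have "(\<Sum>i<e. ?row i) \<le> (\<Sum>i<e. int n)" using row that by (intro sum_mono) auto
    also have "\<dots> \<le> int (n * n)" using that d01 by (simp add: mult_right_mono)
    finally show "(\<Sum>i<e. ?row i) \<le> int (n * n)" .
  qed
  show ?thesis
    unfolding brute_prog_def
  proof (intro runs_assign_seq; (use bnds envD[OF assms(1)] in simp; fail)?)
    show "runs W (While (V ''d'' [<=] V ''d1'')
      ((pre @ ''i'') ::= Const 1 ;; While (V ''i'' [<=] V ''d'') brute_inner ;;
       (pre @ ''d'') ::= V ''d'' [+] Const 1)) (setv s (pre @ ''d'') (ev s (V ''d0'' [+] Const 1)))
      (300 * real n + 200 - real (1 + cost (V ''d0'' [+] Const 1)))
      (\<lambda>s'. val s' ''acc'' = int (card cadences))"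
    proof (rule runs_for[where \<tau> = "70 * real n + 20" and N = "d\<^sub>1 - d\<^sub>0" and I = ?I], goal_cases)
      case 1
      show ?case using envD[OF assms(1)] assms(4) by simp
    next
      case (2 e s')
      have "d\<^sub>0 + 1 + e \<le> n + 1" using 2(1) d01 by linarith
      then have "int (d\<^sub>0 + 1 + e) \<le> B" by (rule n2_le_B)
      moreover have "val s' ''d'' = int (d\<^sub>0 + 1 + e)" using 2(2) by blast
      ultimately show ?case using envD[OF D[OF 2(2)]] bnds 2(1) d01 by auto
    next
      case (4 e s')
      define d where "d = d\<^sub>0 + 1 + e"
      have d: "d \<le> d\<^sub>1" "d \<le> n" using 4(1) d01 by (auto simp: d_def)
      have dB: "int d \<le> B" "int d + 1 \<le> B" using n2_le_B(2)[of d] n2_le_B(2)[of "d + 1"] d by simp_all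
      define s\<^sub>1 where "s\<^sub>1 = setv s' (pre @ ''i'') 1"
      have agr: "agree {pre @ ''d'', pre @ ''i'', pre @ ''acc''} {} s s\<^sub>1"
        using 4(2) by (simp add: s\<^sub>1_def)
      have env1: "env s\<^sub>1" by (rule env_agree[OF assms(1) agr]) (auto simp: input_regs_def)
      have s1: "val s\<^sub>1 ''d'' = int d" "val s\<^sub>1 ''i'' = 1" "val s\<^sub>1 ''acc'' = (\<Sum>i<e. ?row i)"
        using 4(2) by (simp_all add: s\<^sub>1_def d_def)
      have acc: "0 \<le> val s\<^sub>1 ''acc''" "val s\<^sub>1 ''acc'' \<le> int (n * n)"
        using accs[of e] 4(1) s1 by simp_all
      have step: "runs W (While (V ''i'' [<=] V ''d'') brute_inner ;; (pre @ ''d'') ::= V ''d'' [+] Const 1) s\<^sub>1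
          (70 * real n + 18) (?I (Suc e))"
      proof (rule runs_call[OF brute_row[OF env1 assms(2) s1(1) d(1) s1(2) acc]], elim conjE)
        fix t assume t: "agree {pre @ ''i'', pre @ ''acc''} {} s\<^sub>1 t"
          "val t ''acc'' = val s\<^sub>1 ''acc'' + (\<Sum>j<d. cad d j)"
        have "agree {pre @ ''d'', pre @ ''i'', pre @ ''acc''} {} s t"
          by (rule agree_trans[OF agr t(1)]) auto
        moreover have "val t ''d'' = int d" using t(1) s1 by (auto simp: agree_def)
        ultimately show "runs W ((pre @ ''d'') ::= V ''d'' [+] Const 1) t
          (70 * real n + 18 - (70 * real d + 10)) (?I (Suc e))"
          using t(2) s1(3) dB d bnds by (intro runs_assign) (auto simp: d_def)
      qed
      show ?case
        by (intro runs_assign_seq)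
          (use bnds in \<open>auto intro: runs_mono[OF step[unfolded s\<^sub>1_def]]\<close>)
    next
      case 5
      have "real (d\<^sub>1 - d\<^sub>0) \<le> 4" using few_differences[OF assms(3)] by simp
      then have "real (d\<^sub>1 - d\<^sub>0) * (70 * real n + 20 + 6) \<le> 4 * (70 * real n + 20 + 6)"
        by (intro mult_right_mono) auto
      then show ?case by simp
    next
      case (7 s')
      then show ?case by (simp only: card_cadences_brute)
    qed simp_all
  qed
qed

end

section \<open>The quasilinear algorithm\<close>

definition order_prog :: "vname \<Rightarrow> vname \<Rightarrow> vname \<Rightarrow> com" where
  "order_prog t x y = If (Var y [<] Var x) (t ::= Var x ;; x ::= Var y ;; y ::= Var t) Skip"

lemma (in word_bound) order_prog:
  assumes "\<bar>var s x\<bar> \<le> B" "\<bar>var s y\<bar> \<le> B" "x \<noteq> y" "x \<noteq> t" "y \<noteq> t"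
  shows "runs W (order_prog t x y) s 20 (\<lambda>s'. agree {t, x, y} {} s s' \<and>
    var s' x = min (var s x) (var s y) \<and> var s' y = max (var s x) (var s y))"
  unfolding order_prog_def
  by (rule runs_if; (intro straight_line)?; use assms in simp)

text \<open>The sorting network on three wires.\<close>

definition sort_prog :: "string \<Rightarrow> com" where
  "sort_prog pre = order_prog (pre @ ''j'') (pre @ ''a'') (pre @ ''b'') ;;
     order_prog (pre @ ''j'') (pre @ ''b'') (pre @ ''c'') ;;
     order_prog (pre @ ''j'') (pre @ ''a'') (pre @ ''b'')"

lemma (in word_bound) sort_prog:
  assumes "var s (pre @ ''a'') = int a" "var s (pre @ ''b'') = int b" "var s (pre @ ''c'') = int c"
    and "int a \<le> B" "int b \<le> B" "int c \<le> B" and "a \<noteq> b" "a \<noteq> c" "b \<noteq> c"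
  shows "runs W (sort_prog pre) s 60 (\<lambda>s'. agree {pre @ ''j'', pre @ ''a'', pre @ ''b'', pre @ ''c''} {} s s' \<and>
    (\<exists>a' b' c'. a' < b' \<and> b' < c' \<and> {a', b', c'} = {a, b, c} \<and> var s' (pre @ ''a'') = int a' \<and>
      var s' (pre @ ''b'') = int b' \<and> var s' (pre @ ''c'') = int c'))"
proof -
  let ?A = "{pre @ ''j'', pre @ ''a'', pre @ ''b'', pre @ ''c''}"
  let ?b = "max (min a b) (min (max a b) c)"
  show ?thesis
    unfolding sort_prog_def
  proof (rule runs_call[OF order_prog], goal_cases)
    case (6 s\<^sub>1)
    then have s1: "agree ?A {} s s\<^sub>1" "var s\<^sub>1 (pre @ ''a'') = int (min a b)" "var s\<^sub>1 (pre @ ''b'') = int (max a b)"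
      "var s\<^sub>1 (pre @ ''c'') = int c"
      using assms by (auto simp: agree_def of_nat_min of_nat_max)
    show ?case
    proof (rule runs_call[OF order_prog], goal_cases)
      case (6 s\<^sub>2)
      then have s2: "agree ?A {} s s\<^sub>2" "var s\<^sub>2 (pre @ ''a'') = int (min a b)"
        "var s\<^sub>2 (pre @ ''b'') = int (min (max a b) c)" "var s\<^sub>2 (pre @ ''c'') = int (max (max a b) c)"
        using s1 by (auto simp: agree_def of_nat_min of_nat_max)
      show ?case
      proof (rule runs_mono[OF order_prog], goal_cases)
        case (7 s\<^sub>3)
        then have s3: "agree ?A {} s s\<^sub>3" "var s\<^sub>3 (pre @ ''a'') = int (min (min a b) (min (max a b) c))"
          "var s\<^sub>3 (pre @ ''b'') = int ?b" "var s\<^sub>3 (pre @ ''c'') = int (max (max a b) c)"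
          using s2 by (auto simp: agree_def of_nat_min of_nat_max)
        moreover have "min (min a b) (min (max a b) c) < ?b" "?b < max (max a b) c"
          "{min (min a b) (min (max a b) c), ?b, max (max a b) c} = {a, b, c}"
          using assms(7-9) by (auto simp: min_def max_def)
        ultimately show ?case by blast
      qed (use s2 assms in auto)
    qed (use s1 assms in auto)
  qed (use assms in auto)
qed

text \<open>Replaces characters, which may be as large as a word, by entries 0 and 1. The array is
  shifted by one so that an index is a position of the string.\<close>

definition index_prog :: "string \<Rightarrow> com" where
  "index_prog pre =
     (pre @ ''j'') ::= Const 0 ;;
     While (Var (pre @ ''j'') [<] Var (pre @ ''n''))
      (Store (pre @ ''f'') (Var (pre @ ''j'') [+] Const 1)
         (Read ''S'' (Var (pre @ ''j'')) [=] Var ''sigma'') ;;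
       (pre @ ''j'') ::= Var (pre @ ''j'') [+] Const 1)"

text \<open>The fixed names of inputs, output and convolution arguments have at most seven letters,
  so a longer prefix separates the private names from all of them.\<close>

lemma append_neq_short: "7 < length p \<Longrightarrow> length v \<le> 7 \<Longrightarrow> p @ u \<noteq> v \<and> v \<noteq> p @ u"
  by auto

locale indexing = cadence_instance + word_bound +
  fixes pre :: string
  assumes pre_len: "7 < length pre"
    and chars: "\<forall>x \<in> set S. \<bar>x\<bar> \<le> W" "\<bar>\<sigma>\<bar> \<le> W" and n_le: "int n + 1 \<le> B"
begin

lemma index_prog:
  assumes "var s (pre @ ''n'') = int n" "holds_array s ''S'' S" "var s ''sigma'' = \<sigma>"
  shows "runs W (index_prog pre) s (20 * real n + 10) (\<lambda>s'. agree {pre @ ''j''} {pre @ ''f''} s s' \<and>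
    (\<forall>j. 1 \<le> j \<and> j \<le> n \<longrightarrow> arr s' (pre @ ''f'') j = of_bool (occ_at (int j))))"
proof -
  have neq [simp]: "pre @ u \<noteq> ''S''" "''S'' \<noteq> pre @ u" "pre @ u \<noteq> ''sigma''" "''sigma'' \<noteq> pre @ u" for u
    using append_neq_short[OF pre_len] by simp_all
  have B: "int n \<le> B" "1 \<le> B" "0 \<le> B" using n_le B_ge by auto
  show ?thesis
    unfolding index_prog_def
  proof (intro runs_assign_seq; (use B in simp; fail)?)
    show "runs W (While (Var (pre @ ''j'') [<] Var (pre @ ''n''))
      (Store (pre @ ''f'') (Var (pre @ ''j'') [+] Const 1)
         (Read ''S'' (Var (pre @ ''j'')) [=] Var ''sigma'') ;;
       (pre @ ''j'') ::= Var (pre @ ''j'') [+] Const 1)) (setv s (pre @ ''j'') (ev s (Const 0)))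
      (20 * real n + 10 - real (1 + cost (Const 0)))
      (\<lambda>s'. agree {pre @ ''j''} {pre @ ''f''} s s' \<and>
        (\<forall>j. 1 \<le> j \<and> j \<le> n \<longrightarrow> arr s' (pre @ ''f'') j = of_bool (occ_at (int j))))"
    proof (rule runs_for[where \<tau> = 12 and N = n and I = "\<lambda>m s'. agree {pre @ ''j''} {pre @ ''f''} s s' \<and>
        var s' (pre @ ''j'') = int m \<and>
        (\<forall>j. 1 \<le> j \<and> j \<le> m \<longrightarrow> arr s' (pre @ ''f'') j = of_bool (occ_at (int j)))"], goal_cases)
      case (2 m s')
      then have "var s' (pre @ ''n'') = int n" using assms(1) by (simp add: agree_def)
      then show ?case using 2 B by auto
    next
      case (4 m s')
      have v: "var s' (pre @ ''j'') = int m" "var s' ''sigma'' = \<sigma>" "arr s' ''S'' m = S ! m"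
        "agree {pre @ ''j''} {pre @ ''f''} s s'"
        "\<And>j. 1 \<le> j \<Longrightarrow> j \<le> m \<Longrightarrow> arr s' (pre @ ''f'') j = of_bool (occ_at (int j))"
        using 4 assms by (auto simp: agree_def holds_array_def n_def)
      have W: "\<bar>S ! m\<bar> \<le> W" "1 \<le> W" "int m \<le> W" "int m \<le> B" "int m + 1 \<le> B" "int m + 1 \<le> W"
        using chars 4(1) n_le self_le_power[of B 32] B_ge B_pow by (auto simp: n_def)
      \<comment> \<open>The character may exceed \<open>B\<close>; this comparison is therefore
        evaluated directly against \<open>W\<close>.\<close>
      have rd: "aval W s' (Read ''S'' (Var (pre @ ''j'')) [=] Var ''sigma'') = Some (of_bool (S ! m = \<sigma>))"
        using v W chars(2) by (simp add: word_def)
      have ix: "aval W s' (Var (pre @ ''j'') [+] Const 1) = Some (int m + 1)"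
        using v W by (simp add: word_def)
      have "occ_at (int (Suc m)) \<longleftrightarrow> S ! m = \<sigma>" using 4(1) by (simp add: occ_at_def)
      then have upd: "\<forall>j. 1 \<le> j \<and> j \<le> Suc m \<longrightarrow>
          (if j = Suc m then of_bool (S ! m = \<sigma>) else arr s' (pre @ ''f'') j) = of_bool (occ_at (int j))"
        using v(5) by (simp add: le_Suc_eq)
      have nat: "nat (int m + 1) = Suc m" by simp
      show ?case
        apply (rule runs_seq[of _ _ _ 8])
        apply (rule runs_store'[OF ix _ rd])
          apply simp
         apply simp
        apply (rule runs_assign)
           apply (use v(1,4) W B upd in \<open>simp_all add: nat\<close>)
        done
    qed (use assms in auto)
  qed
qed

end

text \<open>The two programs taken from the locale depend on the prefix and on \<open>P\<close>
  alone, not on the instance; so this is a single program for all inputs.\<close>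

definition count_prog :: "com \<Rightarrow> string \<Rightarrow> com" where
  "count_prog P pre =
     ''count'' ::= Const 0 ;;
     If (Var ''k'' [<=] Var ''n'')
      ((pre @ ''n'') ::= Var ''n'' ;; (pre @ ''k'') ::= Var ''k'' ;;
       (pre @ ''a'') ::= Var ''a'' ;; (pre @ ''b'') ::= Var ''b'' ;; (pre @ ''c'') ::= Var ''c'' ;;
       sort_prog pre ;; index_prog pre ;;
       (pre @ ''d0'') ::= Bin Div (Var (pre @ ''n'')) (Var (pre @ ''k'') [+] Const 1) ;;
       (pre @ ''d1'') ::= Bin Div (Var (pre @ ''n'')) (Var (pre @ ''k'') [-] Const 1) ;;
       (pre @ ''acc'') ::= Const 0 ;;
       If (Var (pre @ ''n'') [<] Var (pre @ ''k'') [*] Var (pre @ ''k''))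
         (conv_run.brute_prog pre) (conv_run.main_prog P pre) ;;
       ''count'' ::= Var (pre @ ''acc'')) Skip"

section \<open>Assembly and asymptotic bounds\<close>

locale counting = indexing +
  fixes P :: com and \<kappa> :: real
  assumes fresh: "pre @ x \<notin> writes P"
    and B_large: "1000 * (n + 2) ^ 3 \<le> nat B"
    and \<kappa>_ge: "1 \<le> \<kappa>"
    and conv: "0 < m \<Longrightarrow> m \<le> 5 * n \<Longrightarrow> length xs = m \<Longrightarrow> length ys = m \<Longrightarrow>
      \<forall>v \<in> set xs \<union> set ys. \<bar>v\<bar> \<le> 1 \<Longrightarrow> var s ''m'' = int m \<Longrightarrow>
      holds_array s ''x'' xs \<Longrightarrow> holds_array s ''y'' ys \<Longrightarrow>
      runs W P s (\<kappa> * real m) (\<lambda>s'. \<forall>j < 2 * m - 1. arr s' ''z'' j = acyclic_conv xs ys j)"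
begin

abbreviation budget :: real where
  "budget \<equiv> (604 + \<kappa>) * (1 + 32 * ln (4 * real n + 1)) * (11 * real n) + 400 * real n + 500"

lemma count_cadences:
  assumes "k \<le> n" "var s (pre @ ''n'') = int n" "var s (pre @ ''k'') = int k"
    "var s (pre @ ''a'') = int a" "var s (pre @ ''b'') = int b" "var s (pre @ ''c'') = int c"
    "holds_array s ''S'' S" "var s ''sigma'' = \<sigma>"
  shows "runs W (sort_prog pre ;; index_prog pre ;;
       (pre @ ''d0'') ::= Bin Div (Var (pre @ ''n'')) (Var (pre @ ''k'') [+] Const 1) ;;
       (pre @ ''d1'') ::= Bin Div (Var (pre @ ''n'')) (Var (pre @ ''k'') [-] Const 1) ;;
       (pre @ ''acc'') ::= Const 0 ;;
       If (Var (pre @ ''n'') [<] Var (pre @ ''k'') [*] Var (pre @ ''k''))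
         (conv_run.brute_prog pre) (conv_run.main_prog P pre) ;;
       ''count'' ::= Var (pre @ ''acc'')) s (budget - 50)
     (\<lambda>s'. var s' ''count'' = int (card cadences))"
proof -
  have neq [simp]: "pre @ u \<noteq> ''S''" "''S'' \<noteq> pre @ u" "pre @ u \<noteq> ''sigma''" "''sigma'' \<noteq> pre @ u"
    "pre @ u \<noteq> ''count''" "''count'' \<noteq> pre @ u" for u
    using append_neq_short[OF pre_len] by simp_all
  have B: "int n \<le> B" "1 \<le> B" "0 \<le> B" "int k \<le> B" "int a \<le> B" "int b \<le> B" "int c \<le> B"
    using n_le B_ge assms(1) less_k by auto
  show ?thesis
  proof (rule runs_call[OF sort_prog[OF assms(4-6) B(5-7) distinct]], elim conjE exE)
    fix s\<^sub>1 a' b' c'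
    assume a1: "agree {pre @ ''j'', pre @ ''a'', pre @ ''b'', pre @ ''c''} {} s s\<^sub>1"
      and lt: "a' < b'" "b' < c'" and set: "{a', b', c'} = {a, b, c}"
      and abc: "var s\<^sub>1 (pre @ ''a'') = int a'" "var s\<^sub>1 (pre @ ''b'') = int b'" "var s\<^sub>1 (pre @ ''c'') = int c'"
    have "\<forall>l \<in> {a', b', c'}. l < k" unfolding set using less_k by simp
    then have less': "a' < k" "b' < k" "c' < k" by auto
    interpret sorted: conv_run S \<sigma> n k a' b' c' W B P pre \<kappa>
      using n_def k_pos less' lt fresh pre_len B_large \<kappa>_ge conv by unfold_locales auto
    \<comment> \<open>The three character conditions depend only on the set of the three indices, so
      sorting them keeps the cadences.\<close>
    have cad: "sorted.cadences = cadences"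
    proof -
      have "occ_at (i + int a' * d) \<and> occ_at (i + int b' * d) \<and> occ_at (i + int c' * d) \<longleftrightarrow>
          (\<forall>l \<in> {a', b', c'}. occ_at (i + int l * d))" for i d by auto
      then show ?thesis unfolding sorted.cadences_def cadences_def set by auto
    qed
    have s1: "var s\<^sub>1 (pre @ ''n'') = int n" "var s\<^sub>1 (pre @ ''k'') = int k" "holds_array s\<^sub>1 ''S'' S" "var s\<^sub>1 ''sigma'' = \<sigma>"
      using assms a1 by (auto simp: agree_def holds_array_def)
    let ?rest = "(pre @ ''d0'') ::= Bin Div (Var (pre @ ''n'')) (Var (pre @ ''k'') [+] Const 1) ;;
       (pre @ ''d1'') ::= Bin Div (Var (pre @ ''n'')) (Var (pre @ ''k'') [-] Const 1) ;;
       (pre @ ''acc'') ::= Const 0 ;;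
       If (Var (pre @ ''n'') [<] Var (pre @ ''k'') [*] Var (pre @ ''k''))
         (conv_run.brute_prog pre) (conv_run.main_prog P pre) ;;
       ''count'' ::= Var (pre @ ''acc'')"
    show "runs W (index_prog pre ;; ?rest) s\<^sub>1 (budget - 50 - 60) (\<lambda>s'. var s' ''count'' = int (card cadences))"
    proof (rule runs_call[OF index_prog[OF s1(1,3,4)]], elim conjE)
      fix s\<^sub>2 assume a2: "agree {pre @ ''j''} {pre @ ''f''} s\<^sub>1 s\<^sub>2"
        and f: "\<forall>j. 1 \<le> j \<and> j \<le> n \<longrightarrow> arr s\<^sub>2 (pre @ ''f'') j = of_bool (occ_at (int j))"
      have s2: "var s\<^sub>2 (pre @ ''n'') = int n" "var s\<^sub>2 (pre @ ''k'') = int k"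
        "var s\<^sub>2 (pre @ ''a'') = int a'" "var s\<^sub>2 (pre @ ''b'') = int b'" "var s\<^sub>2 (pre @ ''c'') = int c'"
        using s1 abc a2 by (auto simp: agree_def)
      define s\<^sub>3 where "s\<^sub>3 = setv (setv (setv s\<^sub>2 (pre @ ''d0'') (int sorted.d\<^sub>0)) (pre @ ''d1'') (int sorted.d\<^sub>1)) (pre @ ''acc'') 0"
      have env: "sorted.env s\<^sub>3"
        using s2 f by (simp add: s\<^sub>3_def sorted.env_def sorted.occ_val_def)
      have s3: "var s\<^sub>3 (pre @ ''acc'') = 0" "var s\<^sub>3 (pre @ ''n'') = int n" "var s\<^sub>3 (pre @ ''k'') = int k"
        using s2 by (simp_all add: s\<^sub>3_def)
      have d: "int n div (int k + 1) = int sorted.d\<^sub>0" "int n div (int k - 1) = int sorted.d\<^sub>1"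
        unfolding sorted.d\<^sub>0_def sorted.d\<^sub>1_def using k_pos by (simp_all add: zdiv_int of_nat_diff add.commute)
      have accB: "int (card cadences) \<le> B"
      proof -
        have "card cadences \<le> card ({1..int n} \<times> {1..int n})"
          by (rule card_mono[OF _ cadences_subset]) simp
        then have "card cadences \<le> n * n" by simp
        then show ?thesis by (intro sorted.B_bound) simp
      qed
      have fin: "runs W (''count'' ::= Var (pre @ ''acc'')) t 10 (\<lambda>s'. var s' ''count'' = int (card cadences))"
        if "var t (pre @ ''acc'') = int (card cadences)" for t
        using that accB by (intro runs_assign) auto
      have pos: "0 \<le> (604 + \<kappa>) * (1 + 32 * ln (4 * real n + 1)) * (11 * real n)"
        using \<kappa>_ge by (intro mult_nonneg_nonneg) auto
      let ?\<beta> = "(604 + \<kappa>) * (1 + 32 * ln (4 * real n + 1)) * (11 * real n) + 300 * real n + 200"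
      have body: "runs W (If (Var (pre @ ''n'') [<] Var (pre @ ''k'') [*] Var (pre @ ''k''))
         (conv_run.brute_prog pre) (conv_run.main_prog P pre) ;; ''count'' ::= Var (pre @ ''acc'')) s\<^sub>3 (?\<beta> + 50)
          (\<lambda>s'. var s' ''count'' = int (card cadences))"
      proof (rule runs_if_seq)
        show "bounded B s\<^sub>3 (Var (pre @ ''n'') [<] Var (pre @ ''k'') [*] Var (pre @ ''k''))"
          using s3 B by simp
        assume "ev s\<^sub>3 (Var (pre @ ''n'') [<] Var (pre @ ''k'') [*] Var (pre @ ''k'')) \<noteq> 0"
        then have "int n < int (k * k)" by (simp add: s3)
        then have "n < k * k" by (simp only: of_nat_less_iff)
        then show "runs W (conv_run.brute_prog pre ;; ''count'' ::= Var (pre @ ''acc'')) s\<^sub>3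
          (?\<beta> + 50 - real (1 + cost (Var (pre @ ''n'') [<] Var (pre @ ''k'') [*] Var (pre @ ''k''))))
          (\<lambda>s'. var s' ''count'' = int (card cadences))"
          using pos by (intro runs_call[OF sorted.brute_prog[OF env assms(1) _ s3(1)]] runs_mono[OF fin]) (auto simp: cad)
      next
        assume "ev s\<^sub>3 (Var (pre @ ''n'') [<] Var (pre @ ''k'') [*] Var (pre @ ''k'')) = 0"
        then have "int (k * k) \<le> int n" by (simp add: s3)
        then have "k * k \<le> n" by (simp only: of_nat_le_iff)
        then show "runs W (conv_run.main_prog P pre ;; ''count'' ::= Var (pre @ ''acc'')) s\<^sub>3
          (?\<beta> + 50 - real (1 + cost (Var (pre @ ''n'') [<] Var (pre @ ''k'') [*] Var (pre @ ''k''))))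
          (\<lambda>s'. var s' ''count'' = int (card cadences))"
          by (intro runs_call[OF sorted.main_prog[OF env _ s3(1)]] runs_mono[OF fin]) (auto simp: cad)
      qed simp
      show "runs W ?rest s\<^sub>2 (budget - 50 - 60 - (20 * real n + 10)) (\<lambda>s'. var s' ''count'' = int (card cadences))"
        apply (intro runs_assign_seq)
        apply (use sorted.k_ge in \<open>simp_all add: s2 B d\<close>)
        apply (rule runs_mono[OF body[unfolded s\<^sub>3_def]])
        apply simp_all
        done
    qed
  qed
qed

end

text \<open>From an asymptotic to a uniform bound: finitely many initial values are absorbed by a
  sum, and the added 1 is needed because \<open>m * ln m\<close> vanishes at \<open>m = 1\<close>, a
  length that cells of width 1 do produce.\<close>

lemma convolution_time_bound:
  assumes "T \<in> O(\<lambda>m. real m * ln (real m))"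
  obtains K :: real where "1 \<le> K" "\<And>m. 0 < m \<Longrightarrow> T m \<le> K * (real m * (ln (real m) + 1))"
proof -
  obtain c where c: "0 < c" "eventually (\<lambda>m. norm (T m) \<le> c * norm (real m * ln (real m))) at_top"
    using assms by (auto elim!: landau_o.bigE)
  then obtain N where N: "\<And>m. N \<le> m \<Longrightarrow> norm (T m) \<le> c * norm (real m * ln (real m))"
    by (auto simp: eventually_at_top_linorder)
  define K where "K = 1 + c + (\<Sum>m<N. \<bar>T m\<bar>)"
  have sum: "0 \<le> (\<Sum>m<N. \<bar>T m\<bar>)" by (simp add: sum_nonneg)
  have "T m \<le> K * (real m * (ln (real m) + 1))" if "0 < m" for m
  proof -
    have ln: "0 \<le> ln (real m)" using that by simp
    then have ge: "1 * 1 \<le> real m * (ln (real m) + 1)" using that by (intro mult_mono) auto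
    show ?thesis
    proof (cases "N \<le> m")
      case True
      have "T m \<le> c * (real m * ln (real m))" using N[OF True] ln by (simp add: abs_mult)
      also have "\<dots> \<le> K * (real m * (ln (real m) + 1))"
        using c(1) sum ln by (intro mult_mono mult_left_mono) (auto simp: K_def)
      finally show ?thesis .
    next
      case False
      then have "\<bar>T m\<bar> \<le> (\<Sum>m<N. \<bar>T m\<bar>)" by (intro member_le_sum) auto
      then have "T m \<le> K * 1" using c(1) by (simp add: K_def)
      also have "\<dots> \<le> K * (real m * (ln (real m) + 1))"
        using c(1) sum ge by (intro mult_left_mono) (auto simp: K_def)
      finally show ?thesis .
    qed
  qed
  moreover have "1 \<le> K" using c(1) sum by (simp add: K_def)
  ultimately show thesis using that by blast
qed

text \<open>A prefix longer than all names in \<open>P\<close> together cannot begin any of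
  them.\<close>

lemma fresh_prefix:
  obtains pre :: string where "7 < length pre" "\<And>x. pre @ x \<notin> writes P"
proof -
  define N where "N = 8 + (\<Sum>y\<in>writes P. length y)"
  have "replicate N CHR ''p'' @ x \<notin> writes P" for x
  proof
    assume "replicate N CHR ''p'' @ x \<in> writes P"
    then have "length (replicate N CHR ''p'' @ x) \<le> (\<Sum>y\<in>writes P. length y)"
      by (intro member_le_sum finite_writes) auto
    then show False by (simp add: N_def)
  qed
  then show thesis using that[of "replicate N CHR ''p''"] by (simp add: N_def)
qed

text \<open>No cell needs a convolution longer than \<open>5 * n\<close>, so the logarithm is taken
  at \<open>5 * n\<close> throughout and leaves the sum over the cells as a constant factor.\<close>

definition count_time :: "real \<Rightarrow> nat \<Rightarrow> real" where
  "count_time K n = (604 + K * (ln (5 * real n) + 1)) * (1 + 32 * ln (4 * real n + 1)) * (11 * real n) +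
     400 * real n + 600"

lemma count_time_bigo:
  assumes "1 \<le> K"
  shows "count_time K \<in> O(\<lambda>n. real n * (ln (real n))\<^sup>2)"
\<comment> \<open>From \<open>n = 5\<close> on, \<open>ln n >= 1\<close> and both
  \<open>5 * n\<close> and \<open>4 * n + 1\<close> are at most \<open>n * n\<close>. So with
  \<open>L = ln n\<close> the factors are at most \<open>(604 + 3 * K) * L\<close> and
  \<open>65 * L\<close>, and 1000 covers the lower-order terms.\<close>
proof (rule bigoI[of _ "(604 + 3 * K) * 65 * 11 + 1000"], rule eventually_at_top_linorderI[of 5])
  fix n :: nat assume n: "5 \<le> n"
  define L where "L = ln (real n)"
  have "exp 1 \<le> real n" using exp_le n by linarith
  then have L: "1 \<le> L" using n by (simp add: L_def ln_ge_iff)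
  have sq: "2 * L = ln (real n * real n)" using n by (simp add: L_def ln_mult)
  have "5 * real n \<le> real n * real n" using n by (intro mult_right_mono) auto
  moreover from this have "4 * real n + 1 \<le> real n * real n" using n by linarith
  ultimately have ln5: "ln (5 * real n) \<le> 2 * L" "ln (4 * real n + 1) \<le> 2 * L"
    using n unfolding sq by (auto intro!: ln_mono)
  have ge0: "0 \<le> ln (5 * real n)" "0 \<le> ln (4 * real n + 1)" using n by simp_all
  have "K * (ln (5 * real n) + 1) \<le> K * (3 * L)" using ln5 L assms by (intro mult_left_mono) auto
  then have A: "604 + K * (ln (5 * real n) + 1) \<le> (604 + 3 * K) * L" using L by (simp add: distrib_right)
  have "(604 + K * (ln (5 * real n) + 1)) * (1 + 32 * ln (4 * real n + 1)) \<le> ((604 + 3 * K) * L) * (65 * L)"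
    using A ln5 L ge0 assms by (intro mult_mono) auto
  then have "(604 + K * (ln (5 * real n) + 1)) * (1 + 32 * ln (4 * real n + 1)) * (11 * real n)
      \<le> ((604 + 3 * K) * L) * (65 * L) * (11 * real n)"
    by (rule mult_right_mono) simp
  moreover have "400 * real n + 600 \<le> 1000 * (real n * (L * L))"
  proof -
    have "1 * 1 \<le> L * L" using L by (intro mult_mono) auto
    then have "real n * 1 \<le> real n * (L * L)" by (intro mult_left_mono) auto
    then show ?thesis using n by linarith
  qed
  ultimately have "count_time K n \<le> ((604 + 3 * K) * 65 * 11 + 1000) * (real n * (L * L))"
    unfolding count_time_def by (simp add: algebra_simps)
  moreover have "0 \<le> count_time K n"
    unfolding count_time_def using ge0 assms by (intro add_nonneg_nonneg mult_nonneg_nonneg) auto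
  ultimately show "norm (count_time K n) \<le> ((604 + 3 * K) * 65 * 11 + 1000) * norm (real n * (ln (real n))\<^sup>2)"
    by (simp add: L_def power2_eq_square)
qed

lemma count_prog_correct:
  assumes conv: "\<And>W m x y s. 0 < m \<Longrightarrow> length x = m \<Longrightarrow> length y = m \<Longrightarrow>
      \<forall>v \<in> set x \<union> set y. \<bar>v\<bar> \<le> 1 \<Longrightarrow> (int m + 2) ^ q \<le> W \<Longrightarrow> var s ''m'' = int m \<Longrightarrow>
      holds_array s ''x'' x \<Longrightarrow> holds_array s ''y'' y \<Longrightarrow>
      runs W P s (K * (real m * (ln (real m) + 1))) (\<lambda>s'. \<forall>j < 2 * m - 1. arr s' ''z'' j = acyclic_conv x y j)"
    and K: "1 \<le> K" and pre: "7 < length pre" "\<And>x. pre @ x \<notin> writes P"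
    and inst: "set S \<subseteq> \<Sigma>" "0 < k" "a \<in> {0..k-1}" "b \<in> {0..k-1}" "c \<in> {0..k-1}"
      "a \<noteq> b" "a \<noteq> c" "b \<noteq> c" "\<sigma> \<in> \<Sigma>" "(int (length S) + 2) ^ (416 + 3 * q) \<le> W"
      "instance_in_memory W \<Sigma> S k a b c \<sigma> s"
  shows "runs W (count_prog P pre) s (count_time K (length S))
    (\<lambda>s'. var s' ''count'' = int (card (partial_cadences_with k a b c S \<sigma>)))"
proof -
  define n where "n = length S"
  interpret cadence_instance S \<sigma> n k a b c
    using inst by unfold_locales (auto simp: n_def)
  let ?N = "int n + 2"
  \<comment> \<open>The exponent is 10 + 3: \<open>2 ^ 10\<close> exceeds the factor 1000 of the
    cubic bound. Expressions need the 32nd power, whence \<open>416 = 13 * 32\<close>.\<close>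
  let ?B = "?N ^ 13"
  have N: "2 \<le> ?N" by simp
  have B32: "?B ^ 32 = ?N ^ 416" by (simp flip: power_mult)
  have "?N ^ 416 \<le> ?N ^ (416 + 3 * q)" "?N ^ (3 * q) \<le> ?N ^ (416 + 3 * q)"
    by (intro power_increasing; simp)+
  moreover have "?N ^ (416 + 3 * q) \<le> W" using inst(10) by (simp only: n_def)
  ultimately have W: "?B ^ 32 \<le> W" "?N ^ (3 * q) \<le> W" unfolding B32 by (blast intro: order_trans)+
  have NB: "?N \<le> ?B" using self_le_power[of ?N 13] by simp
  have BW: "?B \<le> W" using self_le_power[of ?B 32] NB W(1) by linarith
  interpret word_bound W ?B
    using NB W(1) by unfold_locales auto
  note mem = inst(11)[unfolded instance_in_memory_def, folded n_def]
  have neq: "pre @ u \<noteq> v" "v \<noteq> pre @ u" if "length v \<le> 7" for u v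
    using append_neq_short[OF pre(1) that] by auto
  let ?s = "setv s ''count'' 0"
  have kn: "aval W ?s (Var ''k'' [<=] Var ''n'') = Some (of_bool (k \<le> n))"
    using mem NB BW by (auto simp: word_def)
  show ?thesis
  proof (cases "k \<le> n")
    case True
    define \<kappa> where "\<kappa> = K * (ln (5 * real n) + 1)"
    have n_pos: "0 < n" using True inst(2) by simp
    have "1 * 1 \<le> K * (ln (5 * real n) + 1)" using K n_pos by (intro mult_mono) auto
    then have \<kappa>: "1 \<le> \<kappa>" by (simp add: \<kappa>_def)
    interpret counting S \<sigma> n k a b c W ?B pre P \<kappa>
    proof (unfold_locales, goal_cases)
      case 2
      then show ?case using mem inst by auto
    next
      case 3
      then show ?case using mem inst by auto
    next
      case 4
      then show ?case using NB by simp
    next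
      case 6
      have "1000 * (n + 2) ^ 3 \<le> (n + 2) ^ 10 * (n + 2) ^ 3"
      proof (rule mult_le_mono1)
        have "(2::nat) ^ 10 \<le> (n + 2) ^ 10" by (rule power_mono) auto
        then show "1000 \<le> (n + 2) ^ 10" by simp
      qed
      also have "\<dots> = (n + 2) ^ 13" by (simp flip: power_add)
      also have "\<dots> = nat ?B" by (simp add: nat_power_eq nat_add_distrib)
      finally show ?case .
    next
      case (8 m xs ys s)
      \<comment> \<open>The words demanded by the convolution program are polynomial in its own
        length \<open>m <= 5 * n\<close>; in terms of \<open>n\<close> this costs the factor 3 in
        the exponent \<open>3 * q\<close>.\<close>
      have "int m + 2 \<le> ?N ^ 3"
      proof -
        have "int m + 2 \<le> 5 * int n + 2" using 8(2) by simp
        also have "\<dots> \<le> ?N ^ 3" by (simp add: power3_eq_cube algebra_simps)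
        finally show ?thesis .
      qed
      then have "(int m + 2) ^ q \<le> (?N ^ 3) ^ q" by (intro power_mono) auto
      also have "\<dots> \<le> W" using W(2) by (simp add: power_mult)
      finally have "(int m + 2) ^ q \<le> W" .
      from conv[OF 8(1,3,4,5) this 8(6-8)] show ?case
      proof (rule runs_mono)
        have "real m \<le> real (5 * n)" using 8(2) by (rule of_nat_mono)
        then have "ln (real m) \<le> ln (5 * real n)" using 8(1) by simp
        then have "K * (real m * (ln (real m) + 1)) \<le> K * (real m * (ln (5 * real n) + 1))"
          using K by (intro mult_left_mono) auto
        then show "K * (real m * (ln (real m) + 1)) \<le> \<kappa> * real m" by (simp add: \<kappa>_def mult_ac)
      qed
    qed (use pre \<kappa> in auto)
    let ?t = "setv (setv (setv (setv (setv ?s (pre @ ''n'') (int n)) (pre @ ''k'') (int k)) (pre @ ''a'') (int a))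
      (pre @ ''b'') (int b)) (pre @ ''c'') (int c)"
    have B: "int n \<le> ?B" "int k \<le> ?B" "int a \<le> ?B" "int b \<le> ?B" "int c \<le> ?B" "0 \<le> ?B"
      using NB True less_k by linarith+
    have t: "holds_array ?t ''S'' S" "var ?t ''sigma'' = \<sigma>"
      using mem by (simp_all add: holds_array_def neq)
    have run: "runs W (sort_prog pre ;; index_prog pre ;;
       (pre @ ''d0'') ::= Bin Div (Var (pre @ ''n'')) (Var (pre @ ''k'') [+] Const 1) ;;
       (pre @ ''d1'') ::= Bin Div (Var (pre @ ''n'')) (Var (pre @ ''k'') [-] Const 1) ;;
       (pre @ ''acc'') ::= Const 0 ;;
       If (Var (pre @ ''n'') [<] Var (pre @ ''k'') [*] Var (pre @ ''k''))
         (conv_run.brute_prog pre) (conv_run.main_prog P pre) ;;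
       ''count'' ::= Var (pre @ ''acc'')) ?t (count_time K n - 150)
     (\<lambda>s'. var s' ''count'' = int (card cadences))"
      by (rule runs_mono[OF count_cadences])
        (use t True in \<open>auto simp: count_time_def \<kappa>_def\<close>)
    show ?thesis
      unfolding count_prog_def card_cadences n_def[symmetric]
      apply (intro runs_assign_seq)
        apply (use B in simp)
       apply simp
      apply (unfold ev.simps)
      apply (rule runs_if'[OF kn])
       apply (intro runs_assign_seq)
                apply (use mem B in \<open>simp_all add: neq\<close>)
       apply (rule runs_mono[OF run])
      using True apply simp_all
      done
  next
    case False
    then have "cadences = {}" using cadences_empty by simp
    moreover have "100 \<le> count_time K n"
    \<comment> \<open>For positive \<open>n\<close> both logarithms are nonnegative; for
      \<open>n = 0\<close> the factor \<open>11 * n\<close> removes them.\<close>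
    proof (cases "n = 0")
      case False
      then show ?thesis
        using K unfolding count_time_def by (simp add: add_nonneg_nonneg mult_nonneg_nonneg)
    qed (simp add: count_time_def)
    ultimately show ?thesis
      unfolding count_prog_def card_cadences n_def[symmetric]
      apply (intro runs_assign_seq)
        apply (use NB in simp)
       apply simp
      apply (unfold ev.simps)
      apply (rule runs_if'[OF kn])
       apply (simp add: False)
      apply (intro straight_line)
       apply simp_all
      done
  qed
qed

theorem theorem7:
  assumes "fast_convolution"
  shows
    "(\<exists>(P :: com) (e :: nat) (T :: nat \<Rightarrow> real).
        T \<in> O(\<lambda>n. real n * (ln (real n))\<^sup>2) \<and>
        (\<forall>W \<Sigma> S k a b c \<sigma> s.
           set S \<subseteq> \<Sigma> \<and> 0 < k \<and> a \<in> {0..k-1} \<and> b \<in> {0..k-1} \<and> c \<in> {0..k-1} \<and>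
           a \<noteq> b \<and> a \<noteq> c \<and> b \<noteq> c \<and> \<sigma> \<in> \<Sigma> \<and>
           (int (length S) + 2) ^ e \<le> W \<and>
           instance_in_memory W \<Sigma> S k a b c \<sigma> s \<longrightarrow>
           (\<exists>t s'. exec W P s t s' \<and> real t \<le> T (length S) \<and>
              var s' ''count'' = int (card (partial_cadences_with k a b c S \<sigma>)))))
     \<and>
     (\<exists>(P :: com) (e :: nat) (T :: nat \<Rightarrow> real).
        T \<in> O(\<lambda>n\<^sub>\<sigma>. (real n\<^sub>\<sigma>)\<^sup>2) \<and>
        (\<forall>W \<Sigma> S k a b c \<sigma> occ s.
           set S \<subseteq> \<Sigma> \<and> 0 < k \<and> a \<in> {0..k-1} \<and> b \<in> {0..k-1} \<and> c \<in> {0..k-1} \<and>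
           a \<noteq> b \<and> a \<noteq> c \<and> b \<noteq> c \<and> \<sigma> \<in> \<Sigma> \<and>
           (int (length S) + 2) ^ e \<le> W \<and>
           instance_in_memory W \<Sigma> S k a b c \<sigma> s \<and>
           occurrences_in_memory S \<sigma> occ s \<longrightarrow>
           (\<exists>t s'. exec W P s t s' \<and> real t \<le> T (length occ) \<and>
              var s' ''count'' = int (card (partial_cadences_with k a b c S \<sigma>)))))"
proof (rule conjI, goal_cases)
  case 1
  \<comment> \<open>Indicator sequences have entries 0 and 1 only, so the exponent 0, that is the
    bound 1 on all entries, is enough.\<close>
  from spec[OF assms[unfolded fast_convolution_def], of 0]
  obtain P q T where T: "T \<in> O(\<lambda>m. real m * ln (real m))" and conv: "\<forall>W m x y s.
     length x = m \<and> length y = m \<and> (\<forall>v \<in> set x \<union> set y. \<bar>v\<bar> \<le> (int m + 2) ^ 0) \<and>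
     (int m + 2) ^ q \<le> W \<and> var s ''m'' = int m \<and> holds_array s ''x'' x \<and> holds_array s ''y'' y \<longrightarrow>
     (\<exists>t s'. exec W P s t s' \<and> real t \<le> T m \<and> (\<forall>j < 2 * m - 1. arr s' ''z'' j = acyclic_conv x y j))"
    by (elim exE conjE) (rule that; assumption)
  obtain K where K: "1 \<le> K" "\<And>m. 0 < m \<Longrightarrow> T m \<le> K * (real m * (ln (real m) + 1))"
    by (rule convolution_time_bound[OF T]) blast
  obtain pre where pre: "7 < length pre" "\<And>x. pre @ x \<notin> writes P"
    by (rule fresh_prefix) blast
  have conv': "runs W P s (K * (real m * (ln (real m) + 1))) (\<lambda>s'. \<forall>j < 2 * m - 1. arr s' ''z'' j = acyclic_conv x y j)"
    if hyps: "0 < m" "length x = m" "length y = m" "\<forall>v \<in> set x \<union> set y. \<bar>v\<bar> \<le> 1" "(int m + 2) ^ q \<le> W"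
      "var s ''m'' = int m" "holds_array s ''x'' x" "holds_array s ''y'' y" for W m x y s
  proof -
    obtain t s' where "exec W P s t s'" "real t \<le> T m" "\<forall>j < 2 * m - 1. arr s' ''z'' j = acyclic_conv x y j"
      using conv[THEN spec[of _ W], THEN spec[of _ m], THEN spec[of _ x], THEN spec[of _ y], THEN spec[of _ s]] hyps
      by auto
    then show ?thesis using K(2)[OF hyps(1)] unfolding runs_def by fastforce
  qed
  show ?case
  proof (rule exI[of _ "count_prog P pre"], rule exI[of _ "416 + 3 * q"], rule exI[of _ "count_time K"],
      intro conjI allI impI)
    show "count_time K \<in> O(\<lambda>n. real n * (ln (real n))\<^sup>2)" by (rule count_time_bigo[OF K(1)])
  qed (elim conjE, rule count_prog_correct[OF conv' K(1) pre, unfolded runs_def]; assumption)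
next
  case 2
  have bigo: "(\<lambda>x. 130 * (real x)\<^sup>2 + 20 * real x + 20) \<in> O(\<lambda>x. (real x)\<^sup>2)"
  proof (rule bigoI[of _ 170], rule eventually_at_top_linorderI[of 1])
    fix x :: nat assume "1 \<le> x"
    then have x: "1 \<le> real x" by simp
    then have "1 * real x \<le> real x * real x" by (intro mult_right_mono) auto
    then have "130 * (real x * real x) + 20 * real x + 20 \<le> 170 * (real x * real x)" using x by linarith
    then show "norm (130 * (real x)\<^sup>2 + 20 * real x + 20) \<le> 170 * norm ((real x)\<^sup>2)"
      by (simp add: power2_eq_square)
  qed
  show ?case
  proof (rule exI[of _ pairs_prog], rule exI[of _ 96],
      rule exI[of _ "\<lambda>x. 130 * (real x)\<^sup>2 + 20 * real x + 20"], intro conjI allI impI)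
  qed (rule bigo, (elim conjE, rule pairs_prog_correct[unfolded runs_def]; assumption))
qed

end
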